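(* Let $k$ be an algebraically closed field of characteristic $p$ and suppose $p>2$. Let $\mathcal{N}$ be the nilpotent cone of $\mathfrak{sl}_2$ over $k$. Then for each $r\ge 1$, the commuting varieties $C_r(\mathfrak{gl}_2)$, $C_r(\mathfrak{sl}_2)$ and $C_r(\mathcal{N})$ are irreducible, normal and Cohen-Macaulay.
   Context: For a Lie algebra $\mathfrak{g}$ over $k$, a closed subvariety $V\subseteq\mathfrak{g}$ and $r\ge 1$, the commuting variety of $r$-tuples over $V$ is the closed subvariety $C_r(V)=\{(v_1,\ldots,v_r)\in V^r \mid [v_i,v_j]=0 \text{ for all } 1\le i\le j\le r\}$ of $V^r$, with its reduced structure (i.e. its coordinate ring is the polynomial ring modulo the radical ideal of all polynomials vanishing on it). The nilpotent cone $\mathcal{N}$ of $\mathfrak{sl}_2$ is the closed subvariety of nilpotent matrices. A variety is Cohen-Macaulay (resp. normal) if its coordinate ring is. *)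

theory Defs
  imports
    "HOL-Analysis.Determinants"
    "HOL-Algebra.QuotRing"
    "HOL-Algebra.Ring_Divisibility"
    "HOL-Algebra.Algebraic_Closure_Type"
    "HOL-Library.Poly_Mapping"
    "HOL-Library.Extended_Nat"
    "HOL-Library.FuncSet"
begin

section \<open>Localizations and fraction fields\<close>

text \<open>
  \<open>localization R S\<close> is the ring of fractions \<open>a / s\<close> with \<open>a\<close> in \<open>R\<close> and \<open>s\<close> in the
  multiplicative set \<open>S\<close>; its elements are the classes of \<open>loc_rel R S\<close>.
\<close>

definition loc_rel ::
  "('a, 'b) ring_scheme \<Rightarrow> 'a set \<Rightarrow> (('a \<times> 'a) \<times> ('a \<times> 'a)) set"
  where "loc_rel R S = {((a, s), (b, t)). a \<in> carrier R \<and> b \<in> carrier R \<and> s \<in> S \<and> t \<in> S \<and>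
    (\<exists>u\<in>S. u \<otimes>\<^bsub>R\<^esub> (a \<otimes>\<^bsub>R\<^esub> t \<ominus>\<^bsub>R\<^esub> b \<otimes>\<^bsub>R\<^esub> s) = \<zero>\<^bsub>R\<^esub>)}"

definition loc_frac :: "('a, 'b) ring_scheme \<Rightarrow> 'a set \<Rightarrow> 'a \<Rightarrow> 'a \<Rightarrow> ('a \<times> 'a) set"
  where "loc_frac R S a s = loc_rel R S `` {(a, s)}"

definition localization :: "('a, 'b) ring_scheme \<Rightarrow> 'a set \<Rightarrow> ('a \<times> 'a) set ring"
  where "localization R S = \<lparr>
    carrier = (carrier R \<times> S) // loc_rel R S,
    mult = (\<lambda>x y. \<Union>(a, s)\<in>x. \<Union>(b, t)\<in>y. loc_frac R S (a \<otimes>\<^bsub>R\<^esub> b) (s \<otimes>\<^bsub>R\<^esub> t)),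
    one = loc_frac R S \<one>\<^bsub>R\<^esub> \<one>\<^bsub>R\<^esub>,
    zero = loc_frac R S \<zero>\<^bsub>R\<^esub> \<one>\<^bsub>R\<^esub>,
    add = (\<lambda>x y. \<Union>(a, s)\<in>x. \<Union>(b, t)\<in>y.
      loc_frac R S (a \<otimes>\<^bsub>R\<^esub> t \<oplus>\<^bsub>R\<^esub> b \<otimes>\<^bsub>R\<^esub> s) (s \<otimes>\<^bsub>R\<^esub> t))\<rparr>"

definition localization_at :: "('a, 'b) ring_scheme \<Rightarrow> 'a set \<Rightarrow> ('a \<times> 'a) set ring"
  where "localization_at R P = localization R (carrier R - P)"

definition fraction_field :: "('a, 'b) ring_scheme \<Rightarrow> ('a \<times> 'a) set ring"
  where "fraction_field R = localization R (carrier R - {\<zero>\<^bsub>R\<^esub>})"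

definition to_fraction_field :: "('a, 'b) ring_scheme \<Rightarrow> 'a \<Rightarrow> ('a \<times> 'a) set"
  where "to_fraction_field R a = loc_frac R (carrier R - {\<zero>\<^bsub>R\<^esub>}) a \<one>\<^bsub>R\<^esub>"


section \<open>Normal rings\<close>

text \<open>\<open>x\<close> is a root of a monic polynomial with coefficients in \<open>A\<close>.\<close>

definition integral_element :: "('a, 'b) ring_scheme \<Rightarrow> 'a set \<Rightarrow> 'a \<Rightarrow> bool"
  where "integral_element K A x \<longleftrightarrow> (\<exists>(n::nat) c. (\<forall>i<n. c i \<in> A) \<and>
    x [^]\<^bsub>K\<^esub> n \<oplus>\<^bsub>K\<^esub> (\<Oplus>\<^bsub>K\<^esub>i\<in>{..<n}. c i \<otimes>\<^bsub>K\<^esub> x [^]\<^bsub>K\<^esub> i) = \<zero>\<^bsub>K\<^esub>)"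

definition integrally_closed_domain :: "('a, 'b) ring_scheme \<Rightarrow> bool"
  where "integrally_closed_domain R \<longleftrightarrow> domain R \<and>
    (\<forall>x \<in> carrier (fraction_field R).
       integral_element (fraction_field R) (to_fraction_field R ` carrier R) x \<longrightarrow>
       x \<in> to_fraction_field R ` carrier R)"

definition normal_ring :: "('a, 'b) ring_scheme \<Rightarrow> bool"
  where "normal_ring R \<longleftrightarrow> cring R \<and>
    (\<forall>P. primeideal P R \<longrightarrow> integrally_closed_domain (localization_at R P))"


section \<open>Cohen-Macaulay rings\<close>

definition krull_dim :: "('a, 'b) ring_scheme \<Rightarrow> enat"
  where "krull_dim R = (SUP n \<in> {n. \<exists>P :: nat \<Rightarrow> 'a set.
    (\<forall>i\<le>n. primeideal (P i) R) \<and> (\<forall>i<n. P i \<subset> P (Suc i))}. enat n)"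

text \<open>
  Each entry is a nonzerodivisor modulo the ideal generated by the preceding ones, and the whole
  sequence does not generate the unit ideal.
\<close>

definition regular_sequence :: "('a, 'b) ring_scheme \<Rightarrow> 'a list \<Rightarrow> bool"
  where "regular_sequence R xs \<longleftrightarrow> set xs \<subseteq> carrier R \<and>
    (\<forall>i<length xs. \<forall>y\<in>carrier R.
       xs ! i \<otimes>\<^bsub>R\<^esub> y \<in> Idl\<^bsub>R\<^esub> (set (take i xs)) \<longrightarrow> y \<in> Idl\<^bsub>R\<^esub> (set (take i xs))) \<and>
    Idl\<^bsub>R\<^esub> (set xs) \<noteq> carrier R"

definition ideal_depth :: "('a, 'b) ring_scheme \<Rightarrow> 'a set \<Rightarrow> enat"
  where "ideal_depth R I = (SUP xs \<in> {xs. regular_sequence R xs \<and> set xs \<subseteq> I}. enat (length xs))"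

definition cohen_macaulay_local :: "('a, 'b) ring_scheme \<Rightarrow> bool"
  where "cohen_macaulay_local R \<longleftrightarrow> cring R \<and> noetherian_ring R \<and> (\<exists>!M. maximalideal M R) \<and>
    ideal_depth R (THE M. maximalideal M R) = krull_dim R"

definition cohen_macaulay_ring :: "('a, 'b) ring_scheme \<Rightarrow> bool"
  where "cohen_macaulay_ring R \<longleftrightarrow> cring R \<and> noetherian_ring R \<and>
    (\<forall>P. primeideal P R \<longrightarrow> cohen_macaulay_local (localization_at R P))"


section \<open>Affine varieties\<close>

text \<open>
  For a finite set \<open>S\<close> of variables, affine space is \<open>S \<rightarrow>\<^sub>E UNIV\<close>.  Polynomials are finitely
  supported families of coefficients, indexed by finitely supported exponent functions.
\<close>

definition poly_ring_over :: "'v set \<Rightarrow> (('v \<Rightarrow>\<^sub>0 nat) \<Rightarrow>\<^sub>0 'k::field) ring"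
  where "poly_ring_over S =
    ring_of_type_algebra\<lparr>carrier :=
      {f. \<forall>m\<in>Poly_Mapping.keys f. Poly_Mapping.keys m \<subseteq> S}\<rparr>"

definition poly_eval :: "('v \<Rightarrow> 'k) \<Rightarrow> (('v \<Rightarrow>\<^sub>0 nat) \<Rightarrow>\<^sub>0 'k::field) \<Rightarrow> 'k"
  where "poly_eval x f = (\<Sum>m\<in>Poly_Mapping.keys f.
    Poly_Mapping.lookup f m * (\<Prod>i\<in>Poly_Mapping.keys m. x i ^ Poly_Mapping.lookup m i))"

definition zariski_closed :: "'v set \<Rightarrow> ('v \<Rightarrow> 'k::field) set \<Rightarrow> bool"
  where "zariski_closed S Z \<longleftrightarrow>
    (\<exists>F \<subseteq> carrier (poly_ring_over S). Z = {x \<in> S \<rightarrow>\<^sub>E UNIV. \<forall>f\<in>F. poly_eval x f = 0})"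

definition vanishing_ideal ::
  "'v set \<Rightarrow> ('v \<Rightarrow> 'k::field) set \<Rightarrow> (('v \<Rightarrow>\<^sub>0 nat) \<Rightarrow>\<^sub>0 'k) set"
  where "vanishing_ideal S Z = {f \<in> carrier (poly_ring_over S). \<forall>x\<in>Z. poly_eval x f = 0}"

definition coordinate_ring ::
  "'v set \<Rightarrow> ('v \<Rightarrow> 'k::field) set \<Rightarrow> (('v \<Rightarrow>\<^sub>0 nat) \<Rightarrow>\<^sub>0 'k) set ring"
  where "coordinate_ring S Z = poly_ring_over S Quot vanishing_ideal S Z"

definition irreducible_variety :: "'v set \<Rightarrow> ('v \<Rightarrow> 'k::field) set \<Rightarrow> bool"
  where "irreducible_variety S Z \<longleftrightarrow> Z \<noteq> {} \<and>
    (\<forall>A B. zariski_closed S A \<and> zariski_closed S B \<and> Z \<subseteq> A \<union> B \<longrightarrow> Z \<subseteq> A \<or> Z \<subseteq> B)"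

definition normal_variety :: "'v set \<Rightarrow> ('v \<Rightarrow> 'k::field) set \<Rightarrow> bool"
  where "normal_variety S Z \<longleftrightarrow> normal_ring (coordinate_ring S Z)"

definition cohen_macaulay_variety :: "'v set \<Rightarrow> ('v \<Rightarrow> 'k::field) set \<Rightarrow> bool"
  where "cohen_macaulay_variety S Z \<longleftrightarrow> cohen_macaulay_ring (coordinate_ring S Z)"


section \<open>Commuting varieties of matrices\<close>

definition lie_bracket :: "'k::field^'n^'n \<Rightarrow> 'k^'n^'n \<Rightarrow> 'k^'n^'n"
  where "lie_bracket A B = A ** B - B ** A"

definition gl :: "('k::field^'n^'n) set"
  where "gl = UNIV"

definition sl :: "('k::field^'n^'n) set"
  where "sl = {A. trace A = 0}"

definition nilpotent_matrix :: "'k::field^'n^'n \<Rightarrow> bool"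
  where "nilpotent_matrix A \<longleftrightarrow> (\<exists>m. (((**) A) ^^ m) (mat 1) = 0)"

definition nilpotent_cone :: "('k::field^'n^'n) set"
  where "nilpotent_cone = {A \<in> sl. nilpotent_matrix A}"

text \<open>An \<open>r\<close>-tuple is a function on \<open>{..<r}\<close>, extended by \<open>undefined\<close>.\<close>

definition commuting_tuples :: "nat \<Rightarrow> ('k::field^'n^'n) set \<Rightarrow> (nat \<Rightarrow> 'k^'n^'n) set"
  where "commuting_tuples r V =
    {v \<in> {..<r} \<rightarrow>\<^sub>E V. \<forall>i j. i \<le> j \<and> j < r \<longrightarrow> lie_bracket (v i) (v j) = 0}"

text \<open>
  Tuples of matrices are points of affine space via their entries.  Tuples over a closed subset \<open>V\<close>
  are always embedded in the affine space of all tuples of matrices; for \<open>V \<subseteq> sl\<close> the linear forms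
  given by the traces then lie in the vanishing ideal, so the coordinate ring is the same
  as the one computed inside the linear subspace of tuples over \<open>sl\<close>.
\<close>

definition entry_vars :: "nat \<Rightarrow> (nat \<times> 'n \<times> 'n) set"
  where "entry_vars r = {..<r} \<times> UNIV"

definition entries :: "nat \<Rightarrow> (nat \<Rightarrow> 'k^'n^'n) \<Rightarrow> (nat \<times> 'n \<times> 'n \<Rightarrow> 'k)"
  where "entries r v = (\<lambda>(i, a, b) \<in> entry_vars r. v i $ a $ b)"

definition commuting_variety ::
  "nat \<Rightarrow> ('k::field^'n^'n) set \<Rightarrow> (nat \<times> 'n \<times> 'n \<Rightarrow> 'k) set"
  where "commuting_variety r V = entries r ` commuting_tuples r V"

end

theory Submission
  imports Defs "HOL-Computational_Algebra.Polynomial_Factorial"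
begin

text \<open>
  Since \<open>2\<close> is invertible, the traceless parts of pairwise commuting \<open>2 \<times> 2\<close> matrices are proportional,
  so each of the three varieties is the image of an affine space: the traceless parts are
  \<open>y\<^sub>i (x\<^sub>0, x\<^sub>1, x\<^sub>2)\<close>, with further free variables \<open>z\<^sub>i\<close> for the traces in the case of \<open>gl\<close>, and on the nilpotent
  cone \<open>y\<^sub>i (s\<^sup>2, s t, - t\<^sup>2)\<close>. Hence the coordinate ring is a subring of a polynomial ring, namely the ring
  of invariants of the one-dimensional torus acting with weight \<open>1\<close> on the \<open>x\<close> (respectively on \<open>s\<close>, \<open>t\<close>),
  with weight \<open>- 1\<close> (respectively \<open>- 2\<close>) on the \<open>y\<^sub>i\<close>, and trivially on the \<open>z\<^sub>i\<close>.

  Such a ring of invariants is spanned by the monomials of weight zero. Comparing leading monomials,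
  it is noetherian by Dickson's lemma and integrally closed. For the Cohen--Macaulay property, it is
  free over a polynomial subring in suitable parameters: an explicit family spans, and it has exactly as
  many elements in each degree as a basis needs. A prime \<open>P\<close> contracts to a prime
  of the polynomial subring; a maximal set of variables algebraically independent modulo the contraction
  leaves one relation for each remaining variable, and these relations form a triangular regular sequence
  in \<open>P\<close>. Its length bounds the height of \<open>P\<close> from above by counting algebraically independent elements
  along a chain of primes.
\<close>

text \<open>The parameters come from multiplying polynomials in an auxiliary variable T. With Y(T)
  the sum of the y_i T^i, they are the coefficients of (x0 + x1 T + x2 T^2) Y(T), respectively of
  (s^2 - t^2 T) Y(T). Such a product vanishes only if one factor does, and then every invariant of
  positive degree vanishes; this is what a system of parameters must satisfy. There are r + 2,
  respectively r + 1, coefficients: one less than the number of variables, since the torus uses up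
  one dimension. The sizes of the explicit families are the h-vectors of the two cones: 1, 2 (r -
  1), (r - 1 choose 2) for the matrices of rank at most one, and 1, 2 r - 1 for the nilpotent cone.
  Spanning is proved by hand; independence then costs only a binomial identity. The Cohen-Macaulay
  condition has to be checked at every prime. Depth never exceeds dimension, because a regular
  sequence produces a chain of primes, so at each prime one sequence that is long enough settles the
  equality. The characteristic enters when a matrix is split into its trace part and its traceless
  part, which divides by 2. Algebraic closedness provides infinitely many points and the square
  roots s and t.\<close>

type_synonym ('x, 'k) mpoly = "('x \<Rightarrow>\<^sub>0 nat) \<Rightarrow>\<^sub>0 'k"

abbreviation "lookup \<equiv> Poly_Mapping.lookup"
abbreviation "keys \<equiv> Poly_Mapping.keys"
abbreviation "single \<equiv> Poly_Mapping.single"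

section \<open>Polynomials, evaluation and substitution\<close>

definition cst :: "'k::zero \<Rightarrow> ('x, 'k) mpoly"
  where "cst c = single 0 c"

definition var :: "'x \<Rightarrow> ('x, 'k::zero_neq_one) mpoly"
  where "var i = single (single i 1) 1"

definition mon_eval :: "('x \<Rightarrow> 'r::comm_monoid_mult) \<Rightarrow> ('x \<Rightarrow>\<^sub>0 nat) \<Rightarrow> 'r"
  where "mon_eval \<sigma> m = (\<Prod>i\<in>keys m. \<sigma> i ^ lookup m i)"

text \<open>The coefficient map \<open>C\<close> is a parameter so that evaluation at a point
  (\<open>C\<close> the identity), substitution of polynomials (\<open>cst\<close>) and expansion in
  one variable (constant univariate polynomials) are instances of one definition.\<close>

definition ev :: "('k::zero \<Rightarrow> 'r::comm_semiring_1) \<Rightarrow> ('x \<Rightarrow> 'r) \<Rightarrow> ('x, 'k) mpoly \<Rightarrow> 'r"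
  where "ev C \<sigma> f = (\<Sum>m\<in>keys f. C (lookup f m) * mon_eval \<sigma> m)"

abbreviation psub :: "('x \<Rightarrow> ('y, 'k::comm_semiring_1) mpoly) \<Rightarrow> ('x, 'k) mpoly \<Rightarrow> ('y, 'k) mpoly"
  where "psub \<equiv> ev cst"

definition pv :: "'x set \<Rightarrow> ('x, 'k::zero) mpoly set"
  where "pv V = {f. \<forall>m\<in>keys f. keys m \<subseteq> V}"

lemma poly_eval_eq_ev: "poly_eval x f = ev (\<lambda>c. c) x f"
  by (simp add: poly_eval_def ev_def mon_eval_def)

lemma mon_eval_superset:
  assumes "finite A" "keys m \<subseteq> A"
  shows "mon_eval \<sigma> m = (\<Prod>i\<in>A. \<sigma> i ^ lookup m i)"
  unfolding mon_eval_def
  by (rule prod.mono_neutral_left) (use assms in \<open>auto simp: in_keys_iff\<close>)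

lemma mon_eval_add: "mon_eval \<sigma> (m + n) = mon_eval \<sigma> m * mon_eval \<sigma> n"
proof -
  let ?A = "keys m \<union> keys n"
  have "keys (m + n) \<subseteq> ?A" by (rule Poly_Mapping.keys_add)
  then show ?thesis
    by (simp add: mon_eval_superset[of ?A] lookup_add power_add prod.distrib)
qed

lemma mon_eval_0 [simp]: "mon_eval \<sigma> 0 = 1"
  by (simp add: mon_eval_def)

lemma mon_eval_single [simp]: "mon_eval \<sigma> (single i n) = \<sigma> i ^ n"
  by (cases "n = 0") (auto simp: mon_eval_def)

lemma mpoly_sum_monomials: "(\<Sum>m\<in>keys f. single m (lookup f m)) = f"
proof (rule poly_mapping_eqI)
  fix k
  have "lookup (\<Sum>m\<in>keys f. single m (lookup f m)) k = (\<Sum>m\<in>keys f. if m = k then lookup f m else 0)"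
    unfolding lookup_sum by (rule sum.cong) (auto simp: lookup_single when_def)
  also have "\<dots> = lookup f k"
    by (auto simp: in_keys_iff)
  finally show "lookup (\<Sum>m\<in>keys f. single m (lookup f m)) k = lookup f k" .
qed

lemma mpoly_add_induct [case_names single add]:
  assumes "\<And>m c. P (single m c)" "\<And>f g. P f \<Longrightarrow> P g \<Longrightarrow> P (f + g)"
  shows "P (f :: 'a \<Rightarrow>\<^sub>0 'b::comm_monoid_add)"
proof -
  have "P (\<Sum>m\<in>A. single m (lookup f m))" if "finite A" for A
    using that
  proof induction
    case empty
    show ?case using assms(1)[of _ 0] by simp
  qed (auto intro: assms)
  from this[of "keys f"] show ?thesis by (simp add: mpoly_sum_monomials)
qed

lemma cst_0 [simp]: "cst 0 = 0" and cst_1 [simp]: "cst 1 = 1"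
  by (simp_all add: cst_def)

lemma cst_add: "cst (a + b) = cst a + cst b"
  by (simp add: cst_def single_add)

lemma cst_mult: "cst (a * b) = cst a * cst b"
  by (simp add: cst_def mult_single)

lemma cst_uminus: "cst (- a) = - cst (a :: 'a::ab_group_add)"
  by (simp add: cst_def single_uminus)

lemma cst_eq_iff [simp]: "cst a = cst b \<longleftrightarrow> a = b"
  unfolding cst_def by (metis lookup_single_eq)

lemma cst_mult_single: "cst c * single m d = single m (c * d :: 'a::semiring_0)"
  by (simp add: cst_def mult_single)

locale coef_hom =
  fixes C :: "'k::comm_ring_1 \<Rightarrow> 'r::comm_ring_1"
  assumes C_0: "C 0 = 0" and C_1: "C 1 = 1"
    and C_add: "C (a + b) = C a + C b" and C_mult: "C (a * b) = C a * C b"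
begin

lemma ev_0 [simp]: "ev C \<sigma> 0 = 0"
  by (simp add: ev_def)

lemma ev_single [simp]: "ev C \<sigma> (single m c) = C c * mon_eval \<sigma> m"
  by (cases "c = 0") (auto simp: ev_def C_0)

lemma ev_add [simp]: "ev C \<sigma> (f + g) = ev C \<sigma> f + ev C \<sigma> g"
  unfolding ev_def by (rule setsum_keys_plus_distrib) (auto simp: C_0 C_add algebra_simps)

lemma ev_mult [simp]: "ev C \<sigma> (f * g) = ev C \<sigma> f * ev C \<sigma> g"
proof (induction f rule: mpoly_add_induct)
  case (single m c)
  show ?case
    by (induction g rule: mpoly_add_induct)
      (simp_all add: mult_single C_mult mon_eval_add algebra_simps)
next
  case (add f1 f2)
  then show ?case by (simp add: distrib_right)
qed

lemma ev_cst [simp]: "ev C \<sigma> (cst c) = C c"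
  by (simp add: cst_def)

lemma ev_1 [simp]: "ev C \<sigma> 1 = 1"
  using ev_cst[of \<sigma> 1] by (simp add: C_1)

lemma ev_var [simp]: "ev C \<sigma> (var i) = \<sigma> i"
  by (simp add: var_def C_1)

lemma ev_uminus [simp]: "ev C \<sigma> (- f) = - ev C \<sigma> f"
  using ev_add[of \<sigma> f "- f"] by (simp add: eq_neg_iff_add_eq_0 add.commute)

lemma ev_diff [simp]: "ev C \<sigma> (f - g) = ev C \<sigma> f - ev C \<sigma> g"
  using ev_add[of \<sigma> f "- g"] by simp

lemma ev_sum: "ev C \<sigma> (sum h A) = (\<Sum>a\<in>A. ev C \<sigma> (h a))"
  by (induction A rule: infinite_finite_induct) auto

lemma ev_prod: "ev C \<sigma> (prod h A) = (\<Prod>a\<in>A. ev C \<sigma> (h a))"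
  by (induction A rule: infinite_finite_induct) auto

lemma ev_power [simp]: "ev C \<sigma> (f ^ n) = ev C \<sigma> f ^ n"
  by (induction n) auto

lemma ev_ev:
  "ev C \<sigma> (psub \<tau> f) = ev C (\<lambda>i. ev C \<sigma> (\<tau> i)) f"
  by (simp add: ev_def[of cst] ev_def[of C _ f] ev_sum mon_eval_def[of \<tau>] ev_prod
      mon_eval_def[of "\<lambda>i. ev C \<sigma> (\<tau> i)"])

end

interpretation cst_hom: coef_hom "cst :: 'k::comm_ring_1 \<Rightarrow> ('x, 'k) mpoly"
  by unfold_locales (simp_all add: cst_add cst_mult)

interpretation id_hom: coef_hom "\<lambda>c. c :: 'k::comm_ring_1"
  by unfold_locales simp_all

interpretation pcst_hom: coef_hom "\<lambda>c. [:cst c :: ('x, 'k::comm_ring_1) mpoly:]"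
  by unfold_locales (simp_all add: cst_add cst_mult one_pCons)

lemma ev_cong:
  assumes "f \<in> pv V" "\<And>i. i \<in> V \<Longrightarrow> \<sigma> i = \<tau> i"
  shows "ev C \<sigma> f = ev C \<tau> f"
proof -
  have "\<sigma> i = \<tau> i" if "m \<in> keys f" "i \<in> keys m" for m i
    using assms that unfolding pv_def by blast
  then show ?thesis
    by (simp add: ev_def mon_eval_def)
qed

text \<open>One closure argument for many memberships: depending on \<open>A\<close> it yields
  polynomials in fewer variables, coefficients of an expansion, and values in a ring of
  invariants.\<close>

lemma ev_in_subsemiring:
  fixes f :: "('x, 'k::zero) mpoly" and \<sigma> :: "'x \<Rightarrow> 'r::comm_semiring_1"
  assumes "f \<in> pv V" "0 \<in> A" "1 \<in> A" "\<And>a b. a \<in> A \<Longrightarrow> b \<in> A \<Longrightarrow> a + b \<in> A"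
    "\<And>a b. a \<in> A \<Longrightarrow> b \<in> A \<Longrightarrow> a * b \<in> A" "\<And>c. C c \<in> A" "\<And>i. i \<in> V \<Longrightarrow> \<sigma> i \<in> A"
  shows "ev C \<sigma> f \<in> A"
proof -
  have pow: "a ^ n \<in> A" if "a \<in> A" for a n
    using that by (induction n) (auto intro: assms)
  have prd: "prod h B \<in> A" if "\<And>b. b \<in> B \<Longrightarrow> h b \<in> A" for h :: "'x \<Rightarrow> 'r" and B
    using that by (induction B rule: infinite_finite_induct) (auto intro: assms)
  have sm: "sum h B \<in> A" if "\<And>b. b \<in> B \<Longrightarrow> h b \<in> A" for h :: "('x \<Rightarrow>\<^sub>0 nat) \<Rightarrow> 'r" and B
    using that by (induction B rule: infinite_finite_induct) (auto intro: assms)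
  have "i \<in> V" if "m \<in> keys f" "i \<in> keys m" for m i
    using assms(1) that unfolding pv_def by blast
  then show ?thesis unfolding ev_def mon_eval_def
    by (intro sm assms(5) prd pow assms(6,7))
qed

lemma ev_cst_var [simp]: "ev cst var (f :: ('x, 'k::comm_ring_1) mpoly) = f"
proof (induction f rule: mpoly_add_induct)
  case (single m c)
  have "mon_eval var m = (single m 1 :: ('x, 'k) mpoly)"
  proof (induction m rule: mpoly_add_induct)
    case (single i n)
    have "single (single i 1) 1 ^ n = (single (single i n) 1 :: ('x, 'k) mpoly)"
      by (induction n) (auto simp: mult_single simp flip: single_add)
    then show ?case by (simp add: var_def)
  qed (simp add: mon_eval_add mult_single)
  then show ?case by (simp add: cst_mult_single)
qed simp

lemma mon_eval_var: "mon_eval var m = (single m 1 :: ('x, 'k::comm_ring_1) mpoly)"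
  using ev_cst_var[of "single m (1::'k)"] by (simp del: ev_cst_var)

lemma single_eq_prod_var:
  assumes "finite A" "keys m \<subseteq> A"
  shows "(single m 1 :: ('x, 'k::comm_ring_1) mpoly) = (\<Prod>i\<in>A. var i ^ lookup m i)"
  using mon_eval_superset[OF assms, of "var :: 'x \<Rightarrow> ('x, 'k) mpoly"] by (simp add: mon_eval_var)

subsection \<open>Polynomials in a subset of the variables\<close>

lemma pv_zero [simp]: "0 \<in> pv V"
  by (simp add: pv_def)

lemma pv_add: "f \<in> pv V \<Longrightarrow> g \<in> pv V \<Longrightarrow> f + g \<in> pv V"
  unfolding pv_def using Poly_Mapping.keys_add[of f g] by blast

lemma pv_mult: "f \<in> pv V \<Longrightarrow> g \<in> pv V \<Longrightarrow> f * g \<in> pv V"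
proof -
  assume *: "f \<in> pv V" "g \<in> pv V"
  show ?thesis unfolding pv_def
  proof (intro CollectI ballI)
    fix m assume "m \<in> keys (f * g)"
    then obtain a b where "m = a + b" "a \<in> keys f" "b \<in> keys g"
      using keys_mult[of f g] by auto
    then show "keys m \<subseteq> V"
      using * Poly_Mapping.keys_add[of a b] unfolding pv_def by blast
  qed
qed

lemma pv_single: "keys m \<subseteq> V \<Longrightarrow> single m c \<in> pv V"
  by (auto simp: pv_def)

lemma pv_cst [simp]: "cst c \<in> pv V"
  by (auto simp: cst_def pv_def)

lemma pv_one [simp]: "1 \<in> pv V"
  by (auto simp: pv_def)

lemma pv_var: "i \<in> V \<Longrightarrow> var i \<in> pv V"
  by (auto simp: var_def pv_def)

lemma pv_uminus: "f \<in> pv V \<Longrightarrow> - f \<in> pv V" for f :: "('x, 'k::ab_group_add) mpoly"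
  by (auto simp: pv_def in_keys_iff)

lemma pv_diff: "f \<in> pv V \<Longrightarrow> g \<in> pv V \<Longrightarrow> f - g \<in> pv V" for f :: "('x, 'k::ab_group_add) mpoly"
  using pv_add[of f V "- g"] pv_uminus[of g V] by simp

lemma pv_sum: "(\<And>a. a \<in> A \<Longrightarrow> h a \<in> pv V) \<Longrightarrow> sum h A \<in> pv V"
  by (induction A rule: infinite_finite_induct) (auto intro: pv_add)

lemma pv_prod: "(\<And>a. a \<in> A \<Longrightarrow> h a \<in> pv V) \<Longrightarrow> prod h A \<in> pv V" for h :: "_ \<Rightarrow> ('x, 'k::comm_semiring_1) mpoly"
  by (induction A rule: infinite_finite_induct) (auto intro: pv_mult)

lemma pv_power: "f \<in> pv V \<Longrightarrow> f ^ n \<in> pv V" for f :: "('x, 'k::comm_semiring_1) mpoly"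
  by (induction n) (auto intro: pv_mult)

lemma pv_mono: "V \<subseteq> W \<Longrightarrow> f \<in> pv V \<Longrightarrow> f \<in> pv W"
  by (auto simp: pv_def)

lemma pv_psub:
  fixes f :: "('x, 'k::comm_ring_1) mpoly" and \<sigma> :: "'x \<Rightarrow> ('y, 'k) mpoly"
  assumes "f \<in> pv V" "\<And>i. i \<in> V \<Longrightarrow> \<sigma> i \<in> pv U"
  shows "psub \<sigma> f \<in> pv U"
  by (rule ev_in_subsemiring[OF assms(1)]) (auto intro: pv_add pv_mult assms)

lemma pv_UNIV [simp]: "pv UNIV = UNIV"
  by (auto simp: pv_def)

lemma pv_empty: "f \<in> pv {} \<Longrightarrow> \<exists>c. f = cst c"
proof -
  assume "f \<in> pv {}"
  then have "keys f \<subseteq> {0}" by (auto simp: pv_def)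
  then have "f = cst (lookup f 0)"
    by (intro poly_mapping_eqI) (auto simp: cst_def lookup_single when_def in_keys_iff)
  then show ?thesis ..
qed

text \<open>The coefficients stay in the same polynomial type although \<open>j\<close> no longer
  occurs in them (\<open>coeff_expand_pv\<close>), and inserting \<open>var j\<close> recovers
  \<open>f\<close> (\<open>poly_expand\<close>). Degree and leading coefficient in
  \<open>var j\<close> are thus those of a univariate polynomial.\<close>

definition expand :: "'x \<Rightarrow> ('x, 'k::comm_ring_1) mpoly \<Rightarrow> ('x, 'k) mpoly poly"
  where "expand j = ev (\<lambda>c. [:cst c:]) (\<lambda>i. if i = j then [:0, 1:] else [:var i:])"

lemma expand_0 [simp]: "expand j 0 = 0" and expand_1 [simp]: "expand j 1 = 1"
  and expand_add [simp]: "expand j (f + g) = expand j f + expand j g"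
  and expand_mult [simp]: "expand j (f * g) = expand j f * expand j g"
  and expand_cst [simp]: "expand j (cst c) = [:cst c:]"
  and expand_var: "expand j (var i) = (if i = j then [:0, 1:] else [:var i:])"
  and expand_sum: "expand j (sum h A) = (\<Sum>a\<in>A. expand j (h a))"
  and expand_power [simp]: "expand j (f ^ n) = expand j f ^ n"
  by (simp_all add: expand_def pcst_hom.ev_sum)

lemma poly_expand [simp]: "poly (expand j f) (var j) = f"
proof -
  have 1: "poly (ev (\<lambda>c. [:cst c:]) \<sigma> f) p = ev cst (\<lambda>i. poly (\<sigma> i) p) f"
    for \<sigma> :: "'a \<Rightarrow> ('a, 'b) mpoly poly" and p
    by (simp add: ev_def poly_sum mon_eval_def poly_prod)
  have 2: "(\<lambda>i. poly (if i = j then [:0, 1:] else [:var i:]) (var j)) = (var :: 'a \<Rightarrow> ('a, 'b) mpoly)"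
    by auto
  show ?thesis unfolding expand_def 1 2 by simp
qed

lemma expand_const:
  assumes "f \<in> pv V" "j \<notin> V"
  shows "expand j f = [:f:]"
proof -
  have "expand j f = ev (\<lambda>c. [:cst c:]) (\<lambda>i. [:var i:]) f"
    unfolding expand_def by (rule ev_cong[OF assms(1)]) (use assms(2) in auto)
  also have "\<dots> = [:ev cst var f:]"
  proof -
    have p: "(\<Prod>i\<in>A. [:h i:]) = [:\<Prod>i\<in>A. h i:]" for h :: "'a \<Rightarrow> ('a, 'b) mpoly" and A
      by (induction A rule: infinite_finite_induct) (auto simp: one_pCons)
    have s: "(\<Sum>i\<in>A. [:h i:]) = [:\<Sum>i\<in>A. h i:]" for h :: "('a \<Rightarrow>\<^sub>0 nat) \<Rightarrow> ('a, 'b) mpoly" and A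
      by (induction A rule: infinite_finite_induct) auto
    have q: "[:a:] ^ n = [:a ^ n:]" for a :: "('a, 'b) mpoly" and n
      by (induction n) (auto simp: one_pCons)
    show ?thesis by (simp add: ev_def mon_eval_def q p mult.commute flip: s)
  qed
  finally show ?thesis by simp
qed

lemma coeff_expand_pv:
  assumes "f \<in> pv V"
  shows "coeff (expand j f) l \<in> pv (V - {j})"
proof -
  let ?A = "{p. \<forall>l. coeff p l \<in> pv (V - {j})}"
  have "expand j f \<in> ?A" unfolding expand_def
  proof (rule ev_in_subsemiring[OF assms])
    show "p * q \<in> ?A" if "p \<in> ?A" "q \<in> ?A" for p q :: "('a, 'b) mpoly poly"
      using that by (auto simp: coeff_mult intro!: pv_sum pv_mult)
  qed (auto simp: pv_add coeff_pCons pv_var split: nat.split)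
  then show ?thesis by simp
qed

lemma expand_eq_0_iff [simp]: "expand j f = 0 \<longleftrightarrow> f = 0"
  using poly_expand[of j f] by (metis expand_0 poly_0)

lemma mpoly_eq_sum_coeff_expand:
  "f = (\<Sum>l\<le>degree (expand j f). coeff (expand j f) l * var j ^ l)"
  using poly_expand[of j f] unfolding poly_altdef by simp

text \<open>The coefficients of the expansion do not involve \<open>j\<close>, so changing the value
  at \<open>j\<close> affects only the powers.\<close>

lemma (in coef_hom) ev_upd:
  "ev C (\<sigma>(j := t)) f = (\<Sum>l\<le>degree (expand j f). ev C \<sigma> (coeff (expand j f) l) * t ^ l)"
proof -
  have "ev C (\<sigma>(j := t)) (coeff (expand j f) l) = ev C \<sigma> (coeff (expand j f) l)" for l
    by (rule ev_cong[OF coeff_expand_pv[of _ UNIV]]) auto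
  then show ?thesis
    by (subst mpoly_eq_sum_coeff_expand[of f j]) (simp add: ev_sum)
qed

section \<open>Polynomials that vanish at every point\<close>

lemma poly_eq_0_of_infinite:
  assumes "infinite (UNIV :: 'a::idom set)" "\<And>t. (\<Sum>l\<le>n. c l * t ^ l) = (0::'a)" "l \<le> n"
  shows "c l = 0"
proof -
  let ?p = "\<Sum>l\<le>n. monom (c l) l"
  have "poly ?p t = 0" for t
    using assms(2)[of t] by (simp add: poly_sum poly_monom)
  then have "?p = 0"
    using assms(1) poly_roots_finite[of ?p] by auto
  then have "coeff ?p l = 0" by simp
  also have "coeff ?p l = c l"
    using assms(3) by (simp add: coeff_sum)
  finally show ?thesis .
qed

text \<open>Induction on the variables: with all other values fixed, varying the value at
  \<open>j\<close> gives a univariate polynomial with infinitely many roots, so each coefficient of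
  the expansion vanishes at every point as well.\<close>

lemma mpoly_eq_0_of_eval:
  fixes f :: "('x, 'k::idom) mpoly"
  assumes "infinite (UNIV :: 'k set)" "finite V" "f \<in> pv V" "\<And>x. ev (\<lambda>c. c) x f = 0"
  shows "f = 0"
  using assms(2-)
proof (induction V arbitrary: f rule: finite_induct)
  case empty
  then obtain c where "f = cst c" using pv_empty by blast
  then have "c = 0" using empty(2)[of "\<lambda>_. 0"] by (simp only: id_hom.ev_cst)
  then show ?case using \<open>f = cst c\<close> by simp
next
  case (insert j V)
  have "coeff (expand j f) l = 0" for l
  proof (rule insert.IH)
    show "coeff (expand j f) l \<in> pv V"
      using coeff_expand_pv[OF insert.prems(1), of j l] insert.hyps(2) by simp
    show "ev (\<lambda>c. c) x (coeff (expand j f) l) = 0" for x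
    proof (cases "l \<le> degree (expand j f)")
      case True
      have "(\<Sum>l\<le>degree (expand j f). ev (\<lambda>c. c) x (coeff (expand j f) l) * t ^ l) = 0" for t
        using trans[OF id_hom.ev_upd[of x j t f, symmetric] insert.prems(2)[of "x(j := t)"]] .
      then show ?thesis by (rule poly_eq_0_of_infinite[OF assms(1) _ True])
    next
      case False
      then show ?thesis by (simp add: coeff_eq_0)
    qed
  qed
  then have "expand j f = 0" by (intro poly_eqI) simp
  then show ?case by simp
qed

text \<open>Over a finite field the product of all \<open>X - a\<close> plus \<open>1\<close> would
  be a nonconstant polynomial without roots.\<close>

lemma infinite_alg_closed: "infinite (UNIV :: 'k::alg_closed_field set)"
proof
  assume fin: "finite (UNIV :: 'k set)"
  let ?p = "(\<Prod>a\<in>UNIV. [:-a, 1:]) + (1 :: 'k poly)"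
  have "degree (\<Prod>a\<in>(UNIV::'k set). [:-a, 1:]) = card (UNIV :: 'k set)"
    by (subst degree_prod_eq_sum_degree) auto
  moreover have "card (UNIV :: 'k set) > 0" using fin by (simp add: card_gt_0_iff)
  ultimately have "degree ?p > 0"
    by (subst degree_add_eq_left) auto
  then obtain x where "poly ?p x = 0" using alg_closed_imp_poly_has_root by blast
  moreover have "poly (\<Prod>a\<in>UNIV. [:-a, 1:]) x = 0"
    using fin by (auto simp: poly_prod)
  ultimately show False by simp
qed

section \<open>Rings embedded in a ring on a type\<close>

text \<open>A ring with explicit carrier is studied through an injective homomorphism into a ring on
  a type. Identities are transported along \<open>h\<close> and proved there by
  simplification.\<close>

locale ring_emb = cring L for L (structure) +
  fixes h :: "'a \<Rightarrow> 'f::comm_ring_1"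
  assumes inj: "inj_on h (carrier L)"
    and h_zero [simp]: "h \<zero> = 0" and h_one [simp]: "h \<one> = 1"
    and h_add: "x \<in> carrier L \<Longrightarrow> y \<in> carrier L \<Longrightarrow> h (x \<oplus> y) = h x + h y"
    and h_mult: "x \<in> carrier L \<Longrightarrow> y \<in> carrier L \<Longrightarrow> h (x \<otimes> y) = h x * h y"
begin

lemma h_eq_iff: "x \<in> carrier L \<Longrightarrow> y \<in> carrier L \<Longrightarrow> h x = h y \<longleftrightarrow> x = y"
  using inj by (auto dest: inj_onD)

lemma h_uminus: "x \<in> carrier L \<Longrightarrow> h (\<ominus> x) = - h x"
  using h_add[of "\<ominus> x" x] by (simp add: eq_neg_iff_add_eq_0 l_neg)

lemma h_minus: "x \<in> carrier L \<Longrightarrow> y \<in> carrier L \<Longrightarrow> h (x \<ominus> y) = h x - h y"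
  by (simp add: a_minus_def h_add h_uminus)

lemma h_pow: "x \<in> carrier L \<Longrightarrow> h (x [^] (n::nat)) = h x ^ n"
  by (induction n) (auto simp: h_mult mult.commute)

lemma h_finsum:
  "f \<in> A \<rightarrow> carrier L \<Longrightarrow> h (finsum L f A) = (\<Sum>a\<in>A. h (f a))"
proof (induction A rule: infinite_finite_induct)
  case (insert a A)
  then show ?case by (simp add: h_add Pi_iff)
qed auto

end

text \<open>The ring axioms are pulled back along the injection; what remains is closure of the
  carrier and the existence of negatives.\<close>

lemma ring_embI:
  fixes L (structure) and h :: "'a \<Rightarrow> 'f::comm_ring_1"
  assumes closed: "\<zero> \<in> carrier L" "\<one> \<in> carrier L"
    "\<And>x y. x \<in> carrier L \<Longrightarrow> y \<in> carrier L \<Longrightarrow> x \<oplus> y \<in> carrier L"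
    "\<And>x y. x \<in> carrier L \<Longrightarrow> y \<in> carrier L \<Longrightarrow> x \<otimes> y \<in> carrier L"
    and neg: "\<And>x. x \<in> carrier L \<Longrightarrow> \<exists>y\<in>carrier L. h y = - h x"
    and inj: "inj_on h (carrier L)"
    and hom: "h \<zero> = 0" "h \<one> = 1"
    "\<And>x y. x \<in> carrier L \<Longrightarrow> y \<in> carrier L \<Longrightarrow> h (x \<oplus> y) = h x + h y"
    "\<And>x y. x \<in> carrier L \<Longrightarrow> y \<in> carrier L \<Longrightarrow> h (x \<otimes> y) = h x * h y"
  shows "ring_emb L h"
proof -
  have eq: "x = y" if "x \<in> carrier L" "y \<in> carrier L" "h x = h y" for x y
    using that inj by (auto dest: inj_onD)
  have "abelian_group L"
  proof (rule abelian_groupI)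
    show "\<exists>y\<in>carrier L. y \<oplus> x = \<zero>" if x: "x \<in> carrier L" for x
    proof -
      obtain y where "y \<in> carrier L" "h y = - h x" using neg[OF x] by blast
      then show ?thesis by (intro bexI[of _ y] eq) (use x closed in \<open>auto simp: hom\<close>)
    qed
  qed (auto intro!: eq closed simp: hom closed algebra_simps)
  moreover have "comm_monoid L"
    by (rule comm_monoidI) (auto intro!: eq closed simp: hom closed algebra_simps)
  moreover have "(x \<oplus> y) \<otimes> z = x \<otimes> z \<oplus> y \<otimes> z"
    if "x \<in> carrier L" "y \<in> carrier L" "z \<in> carrier L" for x y z
    by (intro eq) (use that in \<open>auto simp: hom closed algebra_simps\<close>)
  ultimately have "cring L" by (rule cringI)
  then show ?thesis
    by (intro ring_emb.intro ring_emb_axioms.intro) (use inj hom in auto)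
qed

lemma ring_emb_comp:
  assumes "ring_emb L h" "inj g" "g 0 = 0" "g 1 = 1"
    "\<And>x y. g (x + y) = g x + g y" "\<And>x y. g (x * y) = g x * g y"
  shows "ring_emb L (\<lambda>x. g (h x))"
proof -
  interpret ring_emb L h by fact
  show ?thesis
  proof
    show "inj_on (\<lambda>x. g (h x)) (carrier L)"
      using inj_onD[OF inj] injD[OF assms(2)] by (intro inj_onI) blast
  qed (auto simp: assms h_add h_mult)
qed

subsection \<open>Localizations\<close>

text \<open>The operations of \<open>localization\<close> are unions over all representatives. Such
  a union collapses once the result does not depend on the representatives.\<close>

lemma UN_UN_const:
  assumes "A \<noteq> {}" "B \<noteq> {}" "\<And>a s b t. (a, s) \<in> A \<Longrightarrow> (b, t) \<in> B \<Longrightarrow> f a s b t = c"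
  shows "(\<Union>(a, s)\<in>A. \<Union>(b, t)\<in>B. f a s b t) = c"
proof -
  have "(\<Union>(a, s)\<in>A. \<Union>(b, t)\<in>B. f a s b t) = (\<Union>x\<in>A. \<Union>y\<in>B. c)"
    by (intro SUP_cong refl) (auto simp: assms(3))
  then show ?thesis using assms(1,2) by simp
qed

text \<open>In a field the multiplier \<open>u\<close> of \<open>loc_rel\<close> can be cancelled,
  as \<open>S\<close> omits zero; a class is then determined by the quotient
  \<open>h a / h s\<close>. The lemma serves both localizations at primes and the fraction
  field.\<close>

lemma loc_props:
  fixes Q (structure) and h :: "'a \<Rightarrow> 'f::field"
  assumes emb: "ring_emb Q h"
    and S: "S \<subseteq> carrier Q" "\<one> \<in> S" "\<And>x y. x \<in> S \<Longrightarrow> y \<in> S \<Longrightarrow> x \<otimes> y \<in> S" "\<zero> \<notin> S"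
  obtains g where "ring_emb (localization Q S) g"
    "g ` carrier (localization Q S) = {h a / h s | a s. a \<in> carrier Q \<and> s \<in> S}"
    "\<And>a s. a \<in> carrier Q \<Longrightarrow> s \<in> S \<Longrightarrow> g (loc_frac Q S a s) = h a / h s"
    "\<And>a s. a \<in> carrier Q \<Longrightarrow> s \<in> S \<Longrightarrow> loc_frac Q S a s \<in> carrier (localization Q S)"
proof -
  interpret ring_emb Q h by fact
  let ?L = "localization Q S"
  have Sc [simp]: "s \<in> S \<Longrightarrow> s \<in> carrier Q" for s using S(1) by auto
  have hS [simp]: "h s \<noteq> 0" if "s \<in> S" for s
    using h_eq_iff[of s \<zero>] that S(4) by auto
  have rel: "((a, s), (b, t)) \<in> loc_rel Q S \<longleftrightarrow>
      a \<in> carrier Q \<and> b \<in> carrier Q \<and> s \<in> S \<and> t \<in> S \<and> h a / h s = h b / h t" for a s b t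
  proof (cases "a \<in> carrier Q \<and> b \<in> carrier Q \<and> s \<in> S \<and> t \<in> S")
    case True
    have "u \<otimes> (a \<otimes> t \<ominus> b \<otimes> s) = \<zero> \<longleftrightarrow> h a / h s = h b / h t" if "u \<in> S" for u
    proof -
      have "u \<otimes> (a \<otimes> t \<ominus> b \<otimes> s) = \<zero> \<longleftrightarrow> h (u \<otimes> (a \<otimes> t \<ominus> b \<otimes> s)) = h \<zero>"
        using True that by (subst h_eq_iff) auto
      also have "\<dots> \<longleftrightarrow> h u * (h a * h t - h b * h s) = 0"
        using True that by (simp add: h_mult h_minus)
      also have "\<dots> \<longleftrightarrow> h a / h s = h b / h t"
        using True that by (simp add: frac_eq_eq)
      finally show ?thesis .
    qed
    then show ?thesis using True S(2) unfolding loc_rel_def by blast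
  qed (auto simp: loc_rel_def)
  have frac: "loc_frac Q S a s = {(b, t). b \<in> carrier Q \<and> t \<in> S \<and> h b / h t = h a / h s}"
    if "a \<in> carrier Q" "s \<in> S" for a s
    using that unfolding loc_frac_def by (auto simp: rel)
  have frac_self: "(a, s) \<in> loc_frac Q S a s" if "a \<in> carrier Q" "s \<in> S" for a s
    using that by (simp add: frac)
  have carr: "carrier ?L = {loc_frac Q S a s | a s. a \<in> carrier Q \<and> s \<in> S}"
    by (auto simp: localization_def quotient_def loc_frac_def)
  define g where "g u = (case SOME x. x \<in> u of (a, s) \<Rightarrow> h a / h s)" for u
  have g: "g (loc_frac Q S a s) = h a / h s" if "a \<in> carrier Q" "s \<in> S" for a s
  proof -
    have "(SOME x. x \<in> loc_frac Q S a s) \<in> loc_frac Q S a s"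
      using frac_self[OF that] by (rule someI)
    then show ?thesis unfolding g_def using frac[OF that] by auto
  qed
  have frac_eq: "loc_frac Q S a s = loc_frac Q S b t"
    if "h a / h s = h b / h t" "a \<in> carrier Q" "s \<in> S" "b \<in> carrier Q" "t \<in> S" for a s b t
    using that by (simp add: frac)
  \<comment> \<open>Sum and product are treated together: \<open>F\<close> computes the numerator,
    and well-definedness follows because the value of the result is a function \<open>G\<close> of
    the values of the arguments.\<close>
  have op: "(\<Union>(a, s)\<in>loc_frac Q S a s. \<Union>(b, t)\<in>loc_frac Q S b t. loc_frac Q S (F a s b t) (s \<otimes> t))
      = loc_frac Q S (F a s b t) (s \<otimes> t)"
    if "a \<in> carrier Q" "s \<in> S" "b \<in> carrier Q" "t \<in> S"
      and F: "\<And>a s b t. a \<in> carrier Q \<Longrightarrow> s \<in> S \<Longrightarrow> b \<in> carrier Q \<Longrightarrow> t \<in> S \<Longrightarrow> F a s b t \<in> carrier Q \<and>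
        h (F a s b t) / h (s \<otimes> t) = G (h a / h s) (h b / h t)" for a s b t F G
  proof -
    have "loc_frac Q S (F a' s' b' t') (s' \<otimes> t') = loc_frac Q S (F a s b t) (s \<otimes> t)"
      if "(a', s') \<in> loc_frac Q S a s" "(b', t') \<in> loc_frac Q S b t" for a' s' b' t'
    proof (rule frac_eq)
      have m: "a' \<in> carrier Q" "s' \<in> S" "b' \<in> carrier Q" "t' \<in> S"
        and e: "h a' / h s' = h a / h s" "h b' / h t' = h b / h t"
        using that \<open>a \<in> carrier Q\<close> \<open>s \<in> S\<close> \<open>b \<in> carrier Q\<close> \<open>t \<in> S\<close> by (auto simp: frac)
      show "F a' s' b' t' \<in> carrier Q" "s' \<otimes> t' \<in> S" using F m S by auto
      show "h (F a' s' b' t') / h (s' \<otimes> t') = h (F a s b t) / h (s \<otimes> t)"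
        using F m e \<open>a \<in> carrier Q\<close> \<open>s \<in> S\<close> \<open>b \<in> carrier Q\<close> \<open>t \<in> S\<close> by simp
    qed (use that \<open>a \<in> carrier Q\<close> \<open>s \<in> S\<close> \<open>b \<in> carrier Q\<close> \<open>t \<in> S\<close> F S in auto)
    moreover have "loc_frac Q S a s \<noteq> {}" "loc_frac Q S b t \<noteq> {}"
      using frac_self[OF \<open>a \<in> carrier Q\<close> \<open>s \<in> S\<close>] frac_self[OF \<open>b \<in> carrier Q\<close> \<open>t \<in> S\<close>] by auto
    ultimately show ?thesis by (intro UN_UN_const)
  qed
  have mult: "loc_frac Q S a s \<otimes>\<^bsub>?L\<^esub> loc_frac Q S b t = loc_frac Q S (a \<otimes> b) (s \<otimes> t)"
    if "a \<in> carrier Q" "s \<in> S" "b \<in> carrier Q" "t \<in> S" for a s b t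
    unfolding localization_def using op[OF that, of "\<lambda>a s b t. a \<otimes> b" "\<lambda>x y. x * y"]
    by (simp add: h_mult)
  have add: "loc_frac Q S a s \<oplus>\<^bsub>?L\<^esub> loc_frac Q S b t = loc_frac Q S (a \<otimes> t \<oplus> b \<otimes> s) (s \<otimes> t)"
    if "a \<in> carrier Q" "s \<in> S" "b \<in> carrier Q" "t \<in> S" for a s b t
    unfolding localization_def using op[OF that, of "\<lambda>a s b t. a \<otimes> t \<oplus> b \<otimes> s" "\<lambda>x y. x + y"]
    by (simp add: h_mult h_add add_frac_eq)
  have zero: "\<zero>\<^bsub>?L\<^esub> = loc_frac Q S \<zero> \<one>" and one: "\<one>\<^bsub>?L\<^esub> = loc_frac Q S \<one> \<one>"
    by (simp_all add: localization_def)
  have "ring_emb ?L g"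
  proof (rule ring_embI)
    show "x \<oplus>\<^bsub>?L\<^esub> y \<in> carrier ?L" if xy: "x \<in> carrier ?L" "y \<in> carrier ?L" for x y
    proof -
      obtain a s b t where e: "x = loc_frac Q S a s" "y = loc_frac Q S b t"
        and m: "a \<in> carrier Q" "s \<in> S" "b \<in> carrier Q" "t \<in> S" using xy unfolding carr by blast
      have "x \<oplus>\<^bsub>?L\<^esub> y = loc_frac Q S (a \<otimes> t \<oplus> b \<otimes> s) (s \<otimes> t)" "a \<otimes> t \<oplus> b \<otimes> s \<in> carrier Q" "s \<otimes> t \<in> S"
        using m S by (auto simp: e add)
      then show ?thesis unfolding carr by blast
    qed
    show "x \<otimes>\<^bsub>?L\<^esub> y \<in> carrier ?L" if xy: "x \<in> carrier ?L" "y \<in> carrier ?L" for x y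
    proof -
      obtain a s b t where e: "x = loc_frac Q S a s" "y = loc_frac Q S b t"
        and m: "a \<in> carrier Q" "s \<in> S" "b \<in> carrier Q" "t \<in> S" using xy unfolding carr by blast
      have "x \<otimes>\<^bsub>?L\<^esub> y = loc_frac Q S (a \<otimes> b) (s \<otimes> t)" "a \<otimes> b \<in> carrier Q" "s \<otimes> t \<in> S"
        using m S by (auto simp: e mult)
      then show ?thesis unfolding carr by blast
    qed
    show "\<exists>y\<in>carrier ?L. g y = - g x" if x: "x \<in> carrier ?L" for x
    proof -
      obtain a s where "x = loc_frac Q S a s" "a \<in> carrier Q" "s \<in> S" using x unfolding carr by blast
      then show ?thesis
        by (intro bexI[of _ "loc_frac Q S (\<ominus> a) s"]) (auto simp: g h_uminus carr)
    qed
    show "inj_on g (carrier ?L)"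
      by (rule inj_onI) (simp add: carr, elim exE conjE, metis frac_eq g)
    show "g (x \<oplus>\<^bsub>?L\<^esub> y) = g x + g y" if "x \<in> carrier ?L" "y \<in> carrier ?L" for x y
      using that S(3) by (auto simp: carr add g h_add h_mult add_frac_eq)
    show "g (x \<otimes>\<^bsub>?L\<^esub> y) = g x * g y" if "x \<in> carrier ?L" "y \<in> carrier ?L" for x y
      using that S(3) by (auto simp: carr mult g h_mult)
  qed (use S(2) in \<open>auto simp: zero one g carr\<close>)
  moreover have "g ` carrier ?L = {h a / h s | a s. a \<in> carrier Q \<and> s \<in> S}"
    unfolding carr by (auto simp: g image_iff) (metis g)+
  ultimately show thesis
    using g that carr by blast
qed

subsection \<open>Coordinate rings of parametrized varieties\<close>

lemma carrier_poly_ring_over [simp]: "carrier (poly_ring_over S) = pv S"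
  and poly_ring_over_simps [simp]:
    "\<zero>\<^bsub>poly_ring_over S\<^esub> = 0" "\<one>\<^bsub>poly_ring_over S\<^esub> = 1"
    "x \<oplus>\<^bsub>poly_ring_over S\<^esub> y = x + y" "x \<otimes>\<^bsub>poly_ring_over S\<^esub> y = x * y"
  by (simp_all add: poly_ring_over_def pv_def ring_of_type_algebra_def)

lemma ring_emb_poly_ring_over: "ring_emb (poly_ring_over S) (\<lambda>f. f)"
  by (rule ring_embI) (auto intro: pv_add pv_mult pv_uminus)

lemma ring_of_type_algebra_simps [simp]:
  "carrier ring_of_type_algebra = UNIV"
  "\<zero>\<^bsub>ring_of_type_algebra\<^esub> = 0" "\<one>\<^bsub>ring_of_type_algebra\<^esub> = 1"
  "x \<oplus>\<^bsub>ring_of_type_algebra\<^esub> y = x + y" "x \<otimes>\<^bsub>ring_of_type_algebra\<^esub> y = x * y"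
  by (simp_all add: ring_of_type_algebra_def)

locale parametrized_variety =
  fixes S :: "'s set" and V :: "'x::linorder set" and \<tau> :: "'s \<Rightarrow> ('x, 'k::field) mpoly"
    and Z :: "('s \<Rightarrow> 'k) set"
  assumes inf: "infinite (UNIV :: 'k set)" and fin: "finite V"
    and \<tau>: "s \<in> S \<Longrightarrow> \<tau> s \<in> pv V"
    and Z: "Z = range (\<lambda>x. \<lambda>s\<in>S. poly_eval x (\<tau> s))"
begin

lemma eval_point:
  assumes "f \<in> pv S"
  shows "poly_eval (\<lambda>s\<in>S. poly_eval x (\<tau> s)) f = poly_eval x (psub \<tau> f)"
  unfolding poly_eval_eq_ev id_hom.ev_ev by (rule ev_cong[OF assms]) simp

text \<open>A polynomial vanishes on the image exactly when its pullback vanishes at every point,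
  and over an infinite field this makes the pullback zero. So the vanishing ideal is the kernel of
  \<open>psub \<tau>\<close>.\<close>

lemma vanish_iff:
  assumes "f \<in> pv S"
  shows "(\<forall>z\<in>Z. poly_eval z f = 0) \<longleftrightarrow> psub \<tau> f = 0"
proof
  assume "\<forall>z\<in>Z. poly_eval z f = 0"
  then have "ev (\<lambda>c. c) x (psub \<tau> f) = 0" for x
    using eval_point[OF assms, of x] unfolding Z poly_eval_eq_ev by fastforce
  then show "psub \<tau> f = 0"
    by (intro mpoly_eq_0_of_eval[OF inf fin]) (auto intro: pv_psub[OF assms] \<tau>)
qed (auto simp: Z eval_point[OF assms] poly_eval_eq_ev[of _ 0])

text \<open>Pullbacks live in an integral domain: if \<open>f\<close> and \<open>g\<close> cut out
  proper parts covering \<open>Z\<close>, the pullback of \<open>f * g\<close> is zero, hence one of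
  the two pullbacks is.\<close>

lemma irreducible: "irreducible_variety S Z"
  unfolding irreducible_variety_def
proof (intro conjI allI impI)
  show "Z \<noteq> {}" by (simp add: Z)
  fix A B assume "zariski_closed S A \<and> zariski_closed S B \<and> Z \<subseteq> A \<union> B"
  then obtain F G where F: "F \<subseteq> pv S" "A = {x \<in> S \<rightarrow>\<^sub>E UNIV. \<forall>f\<in>F. poly_eval x f = 0}"
    and G: "G \<subseteq> pv S" "B = {x \<in> S \<rightarrow>\<^sub>E UNIV. \<forall>f\<in>G. poly_eval x f = 0}"
    and sub: "Z \<subseteq> A \<union> B"
    unfolding zariski_closed_def by auto
  have ZE: "Z \<subseteq> S \<rightarrow>\<^sub>E UNIV" by (auto simp: Z)
  show "Z \<subseteq> A \<or> Z \<subseteq> B"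
  proof (rule ccontr)
    assume "\<not> (Z \<subseteq> A \<or> Z \<subseteq> B)"
    then obtain z z' where "z \<in> Z" "z \<notin> A" "z' \<in> Z" "z' \<notin> B" by blast
    then obtain f g where f: "f \<in> F" "poly_eval z f \<noteq> 0" and g: "g \<in> G" "poly_eval z' g \<noteq> 0"
      unfolding F(2) G(2) using ZE by blast
    have fg: "f \<in> pv S" "g \<in> pv S" using f g F G by auto
    have "poly_eval y (f * g) = 0" if "y \<in> Z" for y
      using sub f(1) g(1) that unfolding F(2) G(2) by (auto simp: poly_eval_eq_ev)
    then have "psub \<tau> (f * g) = 0"
      using vanish_iff[OF pv_mult[OF fg]] by blast
    then have "psub \<tau> f = 0 \<or> psub \<tau> g = 0" by simp
    then show False
      using vanish_iff[OF fg(1)] vanish_iff[OF fg(2)] f g \<open>z \<in> Z\<close> \<open>z' \<in> Z\<close> by blast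
  qed
qed

text \<open>The first isomorphism theorem for \<open>psub \<tau>\<close>. From here on the quotient
  ring is replaced by its image in the polynomials over the parameter space.\<close>

lemma coordinate_ring_emb:
  obtains g where "ring_emb (coordinate_ring S Z) g"
    "g ` carrier (coordinate_ring S Z) = psub \<tau> ` pv S"
proof -
  let ?P = "poly_ring_over S :: (('s \<Rightarrow>\<^sub>0 nat) \<Rightarrow>\<^sub>0 'k) ring"
  let ?T = "ring_of_type_algebra :: ('x, 'k) mpoly ring"
  interpret P: ring_emb ?P "\<lambda>f. f" by (rule ring_emb_poly_ring_over)
  have "ring ?T" by (rule ring_from_type_algebra)
  interpret ring_hom_ring ?P ?T "psub \<tau>"
    by (rule ring_hom_ringI[OF P.ring_axioms \<open>ring ?T\<close>]) simp_all
  have ker: "vanishing_ideal S Z = a_kernel ?P ?T (psub \<tau>)"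
    unfolding vanishing_ideal_def a_kernel_def' using vanish_iff by auto
  define g where "g u = the_elem (psub \<tau> ` u)" for u
  have iso: "g \<in> ring_iso (coordinate_ring S Z) (?T\<lparr>carrier := psub \<tau> ` pv S\<rparr>)"
    using FactRing_iso_set_aux unfolding coordinate_ring_def ker g_def by simp
  have id: "ideal (vanishing_ideal S Z) ?P"
    unfolding ker by (rule kernel_is_ideal)
  have cr: "cring (coordinate_ring S Z)"
    unfolding coordinate_ring_def by (rule ideal.quotient_is_cring[OF id P.is_cring])
  interpret C: cring "coordinate_ring S Z" by (rule cr)
  have hom: "g \<in> ring_hom (coordinate_ring S Z) (?T\<lparr>carrier := psub \<tau> ` pv S\<rparr>)"
    and bij: "bij_betw g (carrier (coordinate_ring S Z)) (psub \<tau> ` pv S)"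
    using iso unfolding ring_iso_def by auto
  have g_add: "g (x \<oplus>\<^bsub>coordinate_ring S Z\<^esub> y) = g x + g y"
    if "x \<in> carrier (coordinate_ring S Z)" "y \<in> carrier (coordinate_ring S Z)" for x y
    using ring_hom_add[OF hom that] by simp
  have "ring_emb (coordinate_ring S Z) g"
  proof
    show "g \<zero>\<^bsub>coordinate_ring S Z\<^esub> = 0"
      using g_add[OF C.zero_closed C.zero_closed] C.l_zero[OF C.zero_closed] by (metis add_cancel_right_left)
    show "g \<one>\<^bsub>coordinate_ring S Z\<^esub> = 1"
      using ring_hom_one[OF hom] by simp
    show "g (x \<otimes>\<^bsub>coordinate_ring S Z\<^esub> y) = g x * g y"
      if "x \<in> carrier (coordinate_ring S Z)" "y \<in> carrier (coordinate_ring S Z)" for x y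
      using ring_hom_mult[OF hom that] by simp
  qed (use bij g_add in \<open>auto simp: bij_betw_def\<close>)
  then show thesis using that bij by (auto simp: bij_betw_def)
qed

end

section \<open>Rings of torus invariants\<close>

definition mdvd :: "('x \<Rightarrow>\<^sub>0 nat) \<Rightarrow> ('x \<Rightarrow>\<^sub>0 nat) \<Rightarrow> bool"
  where "mdvd m n \<longleftrightarrow> (\<forall>i. lookup m i \<le> lookup n i)"

text \<open>\<open>h N\<close> is an index beyond \<open>N\<close> with the least value there.
  Iterating \<open>h\<close>, each chosen value is minimal over a range that contains the next
  chosen index.\<close>

lemma nat_incseq_subseq:
  fixes s :: "nat \<Rightarrow> nat"
  shows "\<exists>g. strict_mono g \<and> incseq (\<lambda>n. s (g n))"
proof -
  define h where "h N = arg_min s (\<lambda>m. m > N)" for N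
  have h: "h N > N" "m > N \<Longrightarrow> s (h N) \<le> s m" for N m
    using arg_min_nat_lemma[of "\<lambda>m. m > N" "Suc N" s] unfolding h_def by auto
  define g where "g = rec_nat (h 0) (\<lambda>_ N. h N)"
  have g: "g 0 = h 0" "g (Suc n) = h (g n)" for n by (simp_all add: g_def)
  have mono: "strict_mono g" by (simp add: strict_mono_Suc_iff g h)
  have "s (g n) \<le> s (g (Suc n))" for n
  proof (cases n)
    case 0
    have "0 < h (h 0)" using h(1)[of "h 0"] by simp
    then show ?thesis by (simp add: 0 g h)
  next
    case (Suc l)
    have "g l < h (h (g l))" using h(1)[of "g l"] h(1)[of "h (g l)"] by simp
    then show ?thesis by (simp add: Suc g h)
  qed
  then show ?thesis using mono by (auto intro: incseq_SucI)
qed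

text \<open>One variable at a time: thinning the sequence again makes a new exponent increase, and
  monotonicity of the earlier exponents survives passing to a subsequence.\<close>

lemma dickson_subseq:
  fixes f :: "nat \<Rightarrow> 'x \<Rightarrow>\<^sub>0 nat"
  assumes "finite V"
  shows "\<exists>g::nat \<Rightarrow> nat. strict_mono g \<and> (\<forall>i\<in>V. incseq (\<lambda>n. lookup (f (g n)) i))"
  using assms
proof induction
  case empty
  show ?case by (intro exI[of _ "\<lambda>n. n"]) (auto simp: strict_mono_def)
next
  case (insert v V)
  then obtain g :: "nat \<Rightarrow> nat" where g: "strict_mono g" "\<forall>i\<in>V. incseq (\<lambda>n. lookup (f (g n)) i)"
    by blast
  obtain g' :: "nat \<Rightarrow> nat" where g': "strict_mono g'" "incseq (\<lambda>n. lookup (f (g (g' n))) v)"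
    using nat_incseq_subseq[of "\<lambda>n. lookup (f (g n)) v"] by blast
  have "strict_mono (\<lambda>n. g (g' n))"
    using g(1) g'(1) by (auto simp: strict_mono_def)
  moreover have "incseq (\<lambda>n. lookup (f (g (g' n))) i)" if "i \<in> V" for i
    using g(2) that strict_mono_mono[OF g'(1)] by (auto simp: mono_def)
  ultimately show ?case using g'(2) by (intro exI[of _ "\<lambda>n. g (g' n)"]) auto
qed

lemma dickson_pair:
  fixes f :: "nat \<Rightarrow> 'x \<Rightarrow>\<^sub>0 nat"
  assumes "finite V" "\<And>n. keys (f n) \<subseteq> V"
  shows "\<exists>i j. i < j \<and> mdvd (f i) (f j)"
proof -
  obtain g :: "nat \<Rightarrow> nat" where g: "strict_mono g" "\<forall>i\<in>V. incseq (\<lambda>n. lookup (f (g n)) i)"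
    using dickson_subseq[OF assms(1)] by blast
  have "lookup (f (g 0)) i \<le> lookup (f (g 1)) i" for i
  proof (cases "i \<in> V")
    case True
    then show ?thesis using g(2) by (auto simp: mono_def)
  next
    case False
    then have "i \<notin> keys (f (g 0))" using assms(2) by blast
    then show ?thesis by (simp add: in_keys_iff)
  qed
  moreover have "g 0 < g 1" using g(1) by (auto simp: strict_mono_def)
  ultimately show ?thesis unfolding mdvd_def by blast
qed

text \<open>Otherwise one could keep picking elements that no earlier pick divides, against
  \<open>dickson_pair\<close>.\<close>

lemma dickson_basis:
  fixes A :: "('x \<Rightarrow>\<^sub>0 nat) set"
  assumes "finite V" "\<And>m. m \<in> A \<Longrightarrow> keys m \<subseteq> V"
  shows "\<exists>B\<subseteq>A. finite B \<and> (\<forall>a\<in>A. \<exists>b\<in>B. mdvd b a)"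
proof (rule ccontr)
  assume *: "\<not> ?thesis"
  define pick where "pick B = (SOME a. a \<in> A \<and> (\<forall>b\<in>B. \<not> mdvd b a))" for B
  have pick: "pick B \<in> A \<and> (\<forall>b\<in>B. \<not> mdvd b (pick B))" if "finite B" "B \<subseteq> A" for B
    unfolding pick_def by (rule someI_ex) (use * that in blast)
  define F where "F = rec_nat {} (\<lambda>_ B. insert (pick B) B)"
  have F: "F 0 = {}" "F (Suc n) = insert (pick (F n)) (F n)" for n by (simp_all add: F_def)
  have fin: "finite (F n) \<and> F n \<subseteq> A" for n
    by (induction n) (auto simp: F pick)
  have mem: "i < n \<Longrightarrow> pick (F i) \<in> F n" for i n
    by (induction n) (auto simp: F less_Suc_eq)
  obtain i j where "i < j" "mdvd (pick (F i)) (pick (F j))"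
    using dickson_pair[OF assms(1), of "\<lambda>n. pick (F n)"] assms(2) pick fin by blast
  then show False using pick[of "F j"] fin mem by blast
qed

text \<open>The order on exponents is lexicographic; \<open>m < 0\<close> would require a natural
  number below \<open>0\<close> at the first difference.\<close>

lemma zero_le_mon: "0 \<le> (m :: 'x::linorder \<Rightarrow>\<^sub>0 nat)"
proof -
  have "\<not> m < 0" by transfer (auto simp: less_fun_def)
  then show ?thesis by simp
qed

lemma mdvd_add_diff: "mdvd m n \<Longrightarrow> m + (n - m) = n"
  by (rule poly_mapping_eqI) (simp add: mdvd_def lookup_add lookup_minus)

lemma mdvd_imp_le: "mdvd m n \<Longrightarrow> m \<le> (n :: 'x::linorder \<Rightarrow>\<^sub>0 nat)"
  using add_left_mono[OF zero_le_mon[of "n - m"], of m] by (simp add: mdvd_add_diff)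

text \<open>A lexicographically descending sequence contains, by \<open>dickson_pair\<close>, an
  earlier term that divides a later one; divisibility implies \<open>\<le>\<close>, a contradiction.
  Finiteness of \<open>V\<close> enters through Dickson's lemma.\<close>

lemma wf_mon:
  assumes "finite V"
  shows "wf {(m, n :: 'x::linorder \<Rightarrow>\<^sub>0 nat). m < n \<and> keys m \<subseteq> V \<and> keys n \<subseteq> V}"
  unfolding wf_iff_no_infinite_down_chain
proof
  assume "\<exists>f. \<forall>i. (f (Suc i), f i) \<in> {(m, n :: 'x \<Rightarrow>\<^sub>0 nat). m < n \<and> keys m \<subseteq> V \<and> keys n \<subseteq> V}"
  then obtain f where "\<forall>i. (f (Suc i), f i) \<in> {(m, n :: 'x \<Rightarrow>\<^sub>0 nat). m < n \<and> keys m \<subseteq> V \<and> keys n \<subseteq> V}" ..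
  then have f: "\<And>i. f (Suc i) < f i" "\<And>i. keys (f i) \<subseteq> V" by auto
  obtain i j where ij: "i < j" "mdvd (f i) (f j)"
    using dickson_pair[OF assms f(2)] by blast
  have "f j < f i" using ij(1)
    by (induction j) (use f(1) less_trans in \<open>auto simp: less_Suc_eq\<close>)
  then show False using mdvd_imp_le[OF ij(2)] by simp
qed

section \<open>Leading monomials and the division step\<close>

definition lmon :: "('x::linorder, 'k::zero) mpoly \<Rightarrow> ('x \<Rightarrow>\<^sub>0 nat)"
  where "lmon f = Max (keys f)"

abbreviation "lcoeff f \<equiv> lookup f (lmon f)"

lemma lmon_in_keys: "f \<noteq> 0 \<Longrightarrow> lmon f \<in> keys f"
  unfolding lmon_def by (rule Max_in) (auto simp: poly_mapping_eq_iff in_keys_iff fun_eq_iff)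

lemma lcoeff_nonzero: "f \<noteq> 0 \<Longrightarrow> lcoeff f \<noteq> 0"
  using lmon_in_keys by (auto simp: in_keys_iff)

lemma le_lmon: "m \<in> keys f \<Longrightarrow> m \<le> lmon f"
  unfolding lmon_def by simp

lemma keys_mult_le:
  "m \<in> keys (f * g) \<Longrightarrow> m \<le> lmon f + lmon (g :: ('x::linorder, 'k::semiring_0) mpoly)"
  using keys_mult[of f g] by (auto intro!: add_mono le_lmon)

text \<open>Addition of exponents is strictly monotone, so the leading pair is the only pair of
  monomials with this sum and nothing can cancel.\<close>

lemma lookup_mult_lmon:
  "lookup (f * g) (lmon f + lmon g) = lcoeff f * lcoeff (g :: ('x::linorder, 'k::comm_ring_1) mpoly)"
proof (cases "f = 0 \<or> g = 0")
  case False
  have *: "a + b = lmon f + lmon g \<longleftrightarrow> a = lmon f \<and> b = lmon g" if "a \<in> keys f" "b \<in> keys g" for a b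
    using le_lmon[OF that(1)] le_lmon[OF that(2)]
    by (metis add_less_le_mono add_le_less_mono le_neq_trans less_irrefl)
  have "f * g = (\<Sum>a\<in>keys f. \<Sum>b\<in>keys g. single (a + b) (lookup f a * lookup g b))"
    by (subst mpoly_sum_monomials[of f, symmetric], subst mpoly_sum_monomials[of g, symmetric])
      (simp only: sum_product mult_single)
  then have "lookup (f * g) (lmon f + lmon g) =
      (\<Sum>a\<in>keys f. \<Sum>b\<in>keys g. if a = lmon f \<and> b = lmon g then lookup f a * lookup g b else 0)"
    by (simp add: lookup_sum lookup_single when_def * cong: sum.cong)
  also have "\<dots> = (\<Sum>a\<in>keys f. if a = lmon f then lookup f a * lcoeff g else 0)"
    using False by (intro sum.cong refl) (auto simp: lmon_in_keys)
  also have "\<dots> = lcoeff f * lcoeff g"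
    using False by (auto simp: lmon_in_keys)
  finally show ?thesis .
qed (auto simp: lmon_def)

lemma lmon_mult:
  fixes f g :: "('x::linorder, 'k::idom) mpoly"
  assumes "f \<noteq> 0" "g \<noteq> 0"
  shows "lmon (f * g) = lmon f + lmon g"
proof (rule antisym)
  show "lmon (f * g) \<le> lmon f + lmon g"
    using lmon_in_keys[of "f * g"] assms by (intro keys_mult_le) auto
  show "lmon f + lmon g \<le> lmon (f * g)"
    by (rule le_lmon) (simp add: in_keys_iff lookup_mult_lmon lcoeff_nonzero assms)
qed

lemma lmon_power: "f \<noteq> 0 \<Longrightarrow> lookup (lmon (f ^ n)) i = n * lookup (lmon f) i"
  for f :: "('x::linorder, 'k::idom) mpoly"
proof (induction n)
  case 0
  show ?case by (simp add: lmon_def)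
qed (simp add: lmon_mult lookup_add)

lemma lmon_single_mult:
  fixes g :: "('x::linorder, 'k::idom) mpoly"
  assumes "c \<noteq> 0" "g \<noteq> 0"
  shows "lmon (single m c * g) = m + lmon g"
proof -
  have "single m c \<noteq> (0 :: ('x, 'k) mpoly)"
    using assms(1) by (metis lookup_single_eq lookup_zero)
  moreover have "lmon (single m c :: ('x, 'k) mpoly) = m"
    using assms(1) by (simp add: lmon_def)
  ultimately show ?thesis using assms(2) by (simp add: lmon_mult)
qed

text \<open>\<open>t\<close> is chosen so that \<open>t * g\<close> has the leading term of
  \<open>f\<close>; the two leading terms cancel and only smaller monomials remain.\<close>

lemma lmon_reduce:
  fixes f g :: "('x::linorder, 'k::field) mpoly"
  assumes "f \<noteq> 0" "g \<noteq> 0" "mdvd (lmon g) (lmon f)"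
  defines "t \<equiv> single (lmon f - lmon g) (lcoeff f / lcoeff g)"
  assumes "f - t * g \<noteq> 0"
  shows "lmon (f - t * g) < lmon f"
proof -
  have c: "lcoeff f / lcoeff g \<noteq> 0" using assms(1,2) by (simp add: lcoeff_nonzero)
  have lm: "lmon (t * g) = lmon f"
    unfolding t_def lmon_single_mult[OF c assms(2)] using mdvd_add_diff[OF assms(3)]
    by (simp add: add.commute)
  have "lookup (t * g) (lmon t + lmon g) = lcoeff t * lcoeff g"
    by (rule lookup_mult_lmon)
  moreover have "lmon t = lmon f - lmon g" using c by (simp add: t_def lmon_def)
  ultimately have "lookup (t * g) (lmon f) = lcoeff f"
    using mdvd_add_diff[OF assms(3)] assms(2) by (simp add: t_def add.commute lcoeff_nonzero)
  then have "lmon f \<notin> keys (f - t * g)" by (simp add: in_keys_iff lookup_minus)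
  moreover have "m \<le> lmon f" if "m \<in> keys (f - t * g)" for m
    using that le_lmon[of m f] le_lmon[of m "t * g"] lm
    by (cases "lookup f m = 0") (auto simp: in_keys_iff lookup_minus)
  ultimately show ?thesis
    using lmon_in_keys[OF assms(5)] by (metis le_neq_trans)
qed

section \<open>Weights and the ring of invariants\<close>

definition wt :: "('x \<Rightarrow> int) \<Rightarrow> ('x \<Rightarrow>\<^sub>0 nat) \<Rightarrow> int"
  where "wt w m = (\<Sum>i\<in>keys m. w i * int (lookup m i))"

lemma wt_superset: "finite A \<Longrightarrow> keys m \<subseteq> A \<Longrightarrow> wt w m = (\<Sum>i\<in>A. w i * int (lookup m i))"
  unfolding wt_def by (rule sum.mono_neutral_left) (auto simp: in_keys_iff)

lemma wt_add: "wt w (m + n) = wt w m + wt w n"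
proof -
  let ?A = "keys m \<union> keys n"
  have "keys (m + n) \<subseteq> ?A" by (rule Poly_Mapping.keys_add)
  then show ?thesis
    by (simp add: wt_superset[of ?A] lookup_add sum.distrib distrib_left)
qed

text \<open>The invariants of the one-dimensional torus with weights \<open>w\<close>, encoded by
  the monomials that occur instead of by a group action.\<close>

definition invs :: "'x set \<Rightarrow> ('x \<Rightarrow> int) \<Rightarrow> ('x, 'k::zero) mpoly set"
  where "invs V w = {f. \<forall>m\<in>keys f. keys m \<subseteq> V \<and> wt w m = 0}"

lemma invs_zero [simp]: "0 \<in> invs V w"
  by (simp add: invs_def)

lemma invs_cst [simp]: "cst c \<in> invs V w"
  by (auto simp: invs_def cst_def wt_def)

lemma invs_one [simp]: "1 \<in> invs V w"
  by (auto simp: invs_def wt_def)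

lemma invs_add: "f \<in> invs V w \<Longrightarrow> g \<in> invs V w \<Longrightarrow> f + g \<in> invs V w"
  unfolding invs_def using Poly_Mapping.keys_add[of f g] by blast

lemma invs_mult: "f * g \<in> invs V w" if "f \<in> invs V w" "g \<in> invs V w"
proof -
  have "keys m \<subseteq> V \<and> wt w m = 0" if "m \<in> keys (f * g)" for m
  proof -
    from that obtain a b where m: "m = a + b" "a \<in> keys f" "b \<in> keys g"
      using keys_mult[of f g] by blast
    with \<open>f \<in> invs V w\<close> \<open>g \<in> invs V w\<close> have "keys a \<subseteq> V" "keys b \<subseteq> V" "wt w a = 0" "wt w b = 0"
      by (auto simp: invs_def)
    then show ?thesis using Poly_Mapping.keys_add[of a b] by (auto simp: m wt_add)
  qed
  then show ?thesis by (simp add: invs_def)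
qed

lemma invs_uminus: "f \<in> invs V w \<Longrightarrow> - f \<in> invs V w" for f :: "('x, 'k::ab_group_add) mpoly"
  by (auto simp: invs_def in_keys_iff)

lemma invs_diff: "f \<in> invs V w \<Longrightarrow> g \<in> invs V w \<Longrightarrow> f - g \<in> invs V w" for f :: "('x, 'k::ab_group_add) mpoly"
  using invs_add[of f V w "- g"] invs_uminus[of g V w] by simp

lemma invs_pv: "f \<in> invs V w \<Longrightarrow> f \<in> pv V"
  by (auto simp: invs_def pv_def)

lemma invs_single_quotient:
  fixes f g :: "('x::linorder, 'k::field) mpoly"
  assumes "f \<in> invs V w" "g \<in> invs V w" "f \<noteq> 0" "g \<noteq> 0" "mdvd (lmon g) (lmon f)"
  shows "single (lmon f - lmon g) c \<in> invs V w"
proof -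
  have f: "keys (lmon f) \<subseteq> V" "wt w (lmon f) = 0" and g: "wt w (lmon g) = 0"
    using assms(1,2) lmon_in_keys[OF assms(3)] lmon_in_keys[OF assms(4)] by (auto simp: invs_def)
  have "keys (lmon f - lmon g) \<subseteq> keys (lmon f)"
    by (auto simp: in_keys_iff lookup_minus)
  moreover have "wt w (lmon g) + wt w (lmon f - lmon g) = wt w (lmon f)"
    using mdvd_add_diff[OF assms(5)] by (metis wt_add)
  ultimately show ?thesis using f g by (auto simp: invs_def)
qed

text \<open>Induction along \<open>wf_mon\<close>. The zero polynomial has no leading monomial and
  is a case of its own; therefore every use of the hypothesis first asks whether the remainder is
  zero.\<close>

lemma lmon_induct [consumes 2, case_names zero step]:
  fixes f :: "('x::linorder, 'k::zero) mpoly"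
  assumes "finite V" "f \<in> pv V" "P 0"
    "\<And>f. f \<in> pv V \<Longrightarrow> f \<noteq> 0 \<Longrightarrow>
      (\<And>g. g \<in> pv V \<Longrightarrow> g \<noteq> 0 \<Longrightarrow> lmon g < lmon f \<Longrightarrow> P g) \<Longrightarrow> P f"
  shows "P f"
proof -
  have "f \<in> pv V \<longrightarrow> f \<noteq> 0 \<longrightarrow> P f"
  proof (induction f rule: wf_induct_rule[OF wf_inv_image[OF wf_mon[OF assms(1)], of lmon]])
    case (1 f)
    show ?case
    proof (intro impI)
      assume f: "f \<in> pv V" "f \<noteq> 0"
      show "P f"
      proof (rule assms(4)[OF f])
        fix g :: "('x, 'k) mpoly" assume g: "g \<in> pv V" "g \<noteq> 0" "lmon g < lmon f"
        then have "(g, f) \<in> inv_image {(m, n). m < n \<and> keys m \<subseteq> V \<and> keys n \<subseteq> V} lmon"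
          using f lmon_in_keys[of f] lmon_in_keys[of g] by (auto simp: pv_def)
        then show "P g" using 1 g by blast
      qed
    qed
  qed
  then show ?thesis using assms(2,3) by blast
qed

text \<open>Leading monomials of an ideal are generated by finitely many of them by Dickson's lemma, and
  quotients of weight-zero monomials have weight zero, so the division algorithm stays inside the
  invariants.\<close>

lemma invs_ideal_finitely_generated:
  fixes I :: "('x::linorder, 'k::field) mpoly set"
  assumes "finite V" "I \<subseteq> invs V w" "0 \<in> I"
    "\<And>f g. f \<in> I \<Longrightarrow> g \<in> I \<Longrightarrow> f + g \<in> I" "\<And>f g. f \<in> invs V w \<Longrightarrow> g \<in> I \<Longrightarrow> f * g \<in> I"
  shows "\<exists>G\<subseteq>I. finite G \<and> (\<forall>f\<in>I. \<exists>c. (\<forall>g\<in>G. c g \<in> invs V w) \<and> f = (\<Sum>g\<in>G. c g * g))"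
proof -
  let ?A = "lmon ` (I - {0})"
  have "keys m \<subseteq> V" if "m \<in> ?A" for m
    using that assms(2) lmon_in_keys by (fastforce simp: invs_def)
  then obtain B where B: "B \<subseteq> ?A" "finite B" "\<forall>a\<in>?A. \<exists>b\<in>B. mdvd b a"
    using dickson_basis[OF assms(1), of ?A] by blast
  obtain G where G: "G \<subseteq> I - {0}" "finite G" "B = lmon ` G"
    using finite_subset_image[OF B(2,1)] by blast
  have "f \<in> I \<longrightarrow> (\<exists>c. (\<forall>g\<in>G. c g \<in> invs V w) \<and> f = (\<Sum>g\<in>G. c g * g))" if "f \<in> pv V" for f
    using assms(1) that
  proof (induction f rule: lmon_induct)
    case zero
    show ?case by (auto intro!: exI[of _ "\<lambda>_. 0"])
  next
    case (step f)
    show ?case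
    proof
      assume f: "f \<in> I"
      then obtain g where g: "g \<in> G" "mdvd (lmon g) (lmon f)"
        using B(3) step.hyps G(3) by blast
      have gI: "g \<in> I" "g \<noteq> 0" using G(1) g(1) by auto
      define t where "t = single (lmon f - lmon g) (lcoeff f / lcoeff g)"
      have t: "t \<in> invs V w"
        unfolding t_def using f gI g step.hyps assms(2) by (intro invs_single_quotient) auto
      have I: "f - t * g \<in> I"
        using assms(4)[OF f assms(5)[OF invs_uminus[OF t] gI(1)]] by simp
      have "\<exists>c. (\<forall>g\<in>G. c g \<in> invs V w) \<and> f - t * g = (\<Sum>g\<in>G. c g * g)"
      proof (cases "f - t * g = 0")
        case True
        then show ?thesis by (auto intro!: exI[of _ "\<lambda>_. 0"])
      next
        case False
        have "lmon (f - t * g) < lmon f"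
          using lmon_reduce[OF step.hyps(2) gI(2) g(2)] False unfolding t_def by blast
        moreover have "f - t * g \<in> pv V" using I assms(2) invs_pv by blast
        ultimately show ?thesis using step.IH False I by blast
      qed
      then obtain c where c: "\<forall>g\<in>G. c g \<in> invs V w" "f - t * g = (\<Sum>g\<in>G. c g * g)" by blast
      have "f = (\<Sum>g\<in>G. c g * g) + t * g" using c(2) by (simp add: algebra_simps)
      also have "\<dots> = (\<Sum>h\<in>G. (c(g := c g + t)) h * h)"
      proof -
        have "(\<Sum>h\<in>G. (c(g := c g + t)) h * h) = (\<Sum>h\<in>G. c h * h + (if h = g then t * g else 0))"
          by (intro sum.cong refl) (auto simp: algebra_simps)
        also have "\<dots> = (\<Sum>g\<in>G. c g * g) + t * g"
          using G(2) g(1) by (simp add: sum.distrib)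
        finally show ?thesis by simp
      qed
      finally show "\<exists>c. (\<forall>g\<in>G. c g \<in> invs V w) \<and> f = (\<Sum>g\<in>G. c g * g)"
        using c(1) t by (intro exI[of _ "c(g := c g + t)"]) (auto intro: invs_add)
    qed
  qed
  then show ?thesis using G assms(2) invs_pv by (intro exI[of _ G]) blast
qed

text \<open>If all powers of \<open>a / b\<close> have a common denominator \<open>d\<close>, then comparing leading monomials of
  \<open>d a^k\<close> and \<open>b^k\<close> for large \<open>k\<close> shows that the leading monomial of \<open>b\<close> divides that of \<open>a\<close>.\<close>

lemma invs_almost_integral:
  fixes a b d :: "('x::linorder, 'k::field) mpoly"
  assumes "finite V" "a \<in> invs V w" "b \<in> invs V w" "b \<noteq> 0" "d \<noteq> 0" "\<And>k. b ^ k dvd d * a ^ k"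
  shows "\<exists>q\<in>invs V w. a = b * q"
proof -
  have "a \<in> invs V w \<longrightarrow> (\<forall>k. b ^ k dvd d * a ^ k) \<longrightarrow> (\<exists>q\<in>invs V w. a = b * q)" if "a \<in> pv V" for a
    using assms(1) that
  proof (induction a rule: lmon_induct)
    case zero
    show ?case by (auto intro!: bexI[of _ 0])
  next
    case (step a)
    show ?case
    proof (intro impI)
      assume a: "a \<in> invs V w" and dv: "\<forall>k. b ^ k dvd d * a ^ k"
      have md: "mdvd (lmon b) (lmon a)"
        unfolding mdvd_def
      proof (rule allI, rule ccontr)
        fix i assume "\<not> lookup (lmon b) i \<le> lookup (lmon a) i"
        then have lt: "lookup (lmon a) i + 1 \<le> lookup (lmon b) i" by simp
        \<comment> \<open>One more than the exponent of \<open>d\<close>: each of the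
          \<open>k\<close> factors loses at least one in the exponent at \<open>i\<close>, which
          \<open>d\<close> can no longer make up for.\<close>
        define k where "k = lookup (lmon d) i + 1"
        obtain q where q: "d * a ^ k = b ^ k * q" using dv by (auto elim: dvdE)
        have "d * a ^ k \<noteq> 0" using assms(5) step.hyps by simp
        then have "q \<noteq> 0" using q by auto
        have "lmon (d * a ^ k) = lmon (b ^ k * q)" using q by simp
        then have "lmon d + lmon (a ^ k) = lmon (b ^ k) + lmon q"
          using \<open>q \<noteq> 0\<close> assms(4,5) step.hyps by (simp add: lmon_mult)
        then have "lookup (lmon d) i + k * lookup (lmon a) i = k * lookup (lmon b) i + lookup (lmon q) i"
          using lmon_power[OF step.hyps(2)] lmon_power[OF assms(4)] by (metis lookup_add)
        moreover have "k * (lookup (lmon a) i + 1) \<le> k * lookup (lmon b) i"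
          using lt by (rule mult_left_mono) simp
        ultimately show False by (simp add: k_def algebra_simps)
      qed
      define t where "t = single (lmon a - lmon b) (lcoeff a / lcoeff b)"
      have t: "t \<in> invs V w"
        unfolding t_def using a assms(3,4) md step.hyps by (intro invs_single_quotient) auto
      have I: "a - t * b \<in> invs V w" using a t assms(3) by (intro invs_diff invs_mult)
      \<comment> \<open>The hypothesis survives the division step: in the binomial expansion every
        term has a factor \<open>b ^ (k - i)\<close> beside \<open>d * a ^ i\<close>, and
        \<open>b ^ i\<close> divides the latter.\<close>
      have dv': "b ^ k dvd d * (a - t * b) ^ k" for k
      proof -
        have "d * (a - t * b) ^ k = (\<Sum>i\<le>k. of_nat (k choose i) * (- t * b) ^ (k - i) * (d * a ^ i))"
          by (subst diff_conv_add_uminus, subst binomial_ring) (simp add: sum_distrib_left mult_ac)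
        moreover have "b ^ k dvd of_nat (k choose i) * (- t * b) ^ (k - i) * (d * a ^ i)" if "i \<le> k" for i
        proof -
          have "b ^ (k - i) * b ^ i dvd (- t * b) ^ (k - i) * (d * a ^ i)"
            using dv by (intro mult_dvd_mono) (auto simp: power_mult_distrib power_minus[of "t * b"])
          then show ?thesis using that
            by (metis (no_types, lifting) dvd_mult le_add_diff_inverse2 mult.assoc power_add)
        qed
        ultimately show ?thesis by (auto intro!: dvd_sum simp del: mult_minus_left)
      qed
      have "\<exists>q\<in>invs V w. a - t * b = b * q"
      proof (cases "a - t * b = 0")
        case True
        then show ?thesis by (auto intro!: bexI[of _ 0])
      next
        case False
        then have "lmon (a - t * b) < lmon a"
          using lmon_reduce[OF step.hyps(2) assms(4) md] unfolding t_def by blast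
        then show ?thesis using step.IH[OF invs_pv[OF I] False] I dv' by blast
      qed
      then obtain q where "q \<in> invs V w" "a - t * b = b * q" by blast
      then show "\<exists>q\<in>invs V w. a = b * q"
        using t by (intro bexI[of _ "q + t"]) (auto intro: invs_add simp: algebra_simps)
    qed
  qed
  then show ?thesis using assms(2,6) invs_pv by blast
qed

section \<open>Prime ideals and regular sequences\<close>

text \<open>An ideal maximal among those containing \<open>I\<close> and missing \<open>S\<close> is
  prime: enlarging it by \<open>a\<close> or by \<open>b\<close> makes it meet \<open>S\<close>, and
  the product of the two meeting elements would lie in both \<open>S\<close> and \<open>Q\<close> if
  \<open>a \<otimes> b\<close> were in \<open>Q\<close>.\<close>

lemma (in cring) primeideal_avoiding:
  assumes I: "ideal I R" and S: "S \<subseteq> carrier R" "\<one> \<in> S" "\<And>x y. x \<in> S \<Longrightarrow> y \<in> S \<Longrightarrow> x \<otimes> y \<in> S"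
    and disj: "I \<inter> S = {}"
  shows "\<exists>Q. primeideal Q R \<and> I \<subseteq> Q \<and> Q \<inter> S = {}"
proof -
  let ?A = "{J. ideal J R \<and> I \<subseteq> J \<and> J \<inter> S = {}}"
  have "\<exists>M\<in>?A. \<forall>J\<in>?A. M \<subseteq> J \<longrightarrow> J = M"
  proof (rule subset_Zorn_nonempty)
    show "?A \<noteq> {}" using I disj by blast
    fix C assume C: "C \<noteq> {}" "subset.chain ?A C"
    then have "subset.chain {J. ideal J R} C" unfolding pred_on.chain_def by blast
    then have "ideal (\<Union>C) R" using chain_Union_is_ideal[of C] C(1) by simp
    then show "\<Union>C \<in> ?A" using C unfolding pred_on.chain_def by blast
  qed
  then obtain Q where "Q \<in> ?A" and Qmax: "\<forall>J\<in>?A. Q \<subseteq> J \<longrightarrow> J = Q" by (elim bexE)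
  then have Q: "ideal Q R" "I \<subseteq> Q" "Q \<inter> S = {}" by simp_all
  have max: "J = Q" if "ideal J R" "Q \<subseteq> J" "J \<inter> S = {}" for J
    using Qmax[rule_format, of J] that Q(2) by simp
  interpret Q: ideal Q R by (rule Q(1))
  have meet: "\<exists>q\<in>Q. \<exists>r\<in>carrier R. q \<oplus> r \<otimes> a \<in> S" if a: "a \<in> carrier R" "a \<notin> Q" for a
  proof (rule ccontr)
    assume no: "\<not> ?thesis"
    let ?J = "Q <+>\<^bsub>R\<^esub> PIdl a"
    have J: "ideal ?J R" by (rule add_ideals[OF Q(1) cgenideal_ideal[OF a(1)]])
    have mem: "?J = {q \<oplus> r \<otimes> a | q r. q \<in> Q \<and> r \<in> carrier R}"
      by (auto simp: set_add_def' cgenideal_def)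
    have "q \<in> ?J" if "q \<in> Q" for q
      unfolding mem using that a(1) by (intro CollectI exI[of _ q] exI[of _ \<zero>]) auto
    moreover have "a \<in> ?J"
      unfolding mem using a(1) by (intro CollectI exI[of _ \<zero>] exI[of _ \<one>]) auto
    moreover have "?J \<inter> S = {}" using no unfolding mem by blast
    ultimately show False using max[OF J] a(2) by blast
  qed
  have "primeideal Q R"
  proof (rule primeidealI[OF Q(1) is_cring])
    show "carrier R \<noteq> Q" using Q(3) S(2) by auto
    fix a b assume ab: "a \<in> carrier R" "b \<in> carrier R" "a \<otimes> b \<in> Q"
    show "a \<in> Q \<or> b \<in> Q"
    proof (rule ccontr)
      assume "\<not> (a \<in> Q \<or> b \<in> Q)"
      then have nQ: "a \<notin> Q" "b \<notin> Q" by simp_all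
      obtain q r where q: "q \<in> Q" "r \<in> carrier R" "q \<oplus> r \<otimes> a \<in> S"
        using meet[OF ab(1) nQ(1)] by (elim bexE)
      obtain q' r' where q': "q' \<in> Q" "r' \<in> carrier R" "q' \<oplus> r' \<otimes> b \<in> S"
        using meet[OF ab(2) nQ(2)] by (elim bexE)
      have c: "q \<in> carrier R" "q' \<in> carrier R" using q(1) q'(1) Q.a_subset by auto
      have "(q \<oplus> r \<otimes> a) \<otimes> (q' \<oplus> r' \<otimes> b) =
          q \<otimes> (q' \<oplus> r' \<otimes> b) \<oplus> ((r \<otimes> a) \<otimes> q' \<oplus> (r \<otimes> r') \<otimes> (a \<otimes> b))"
        using c q(2) q'(2) ab by (simp add: l_distr r_distr m_ac a_ac)
      moreover have "\<dots> \<in> Q"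
      proof (intro Q.a_closed)
        show "q \<otimes> (q' \<oplus> r' \<otimes> b) \<in> Q" by (rule Q.I_r_closed[OF q(1)]) (use c q' ab in simp)
        show "(r \<otimes> a) \<otimes> q' \<in> Q" by (rule Q.I_l_closed[OF q'(1)]) (use q ab in simp)
        show "(r \<otimes> r') \<otimes> (a \<otimes> b) \<in> Q" by (rule Q.I_l_closed[OF ab(3)]) (use q q' in simp)
      qed
      ultimately show False using S(3)[OF q(3) q'(3)] Q(3) by auto
    qed
  qed
  then show ?thesis using Q by blast
qed

text \<open>The chain is built from the top. Given a prime over the ideal of the first
  \<open>j + 1\<close> entries, there is a strictly smaller prime over the ideal of the first
  \<open>j\<close> entries, because entry \<open>j\<close> is a nonzerodivisor modulo that ideal and
  can be avoided.\<close>

lemma (in cring) regular_sequence_prime_chain: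
  assumes reg: "regular_sequence R xs"
  shows "\<exists>P. (\<forall>i\<le>length xs. primeideal (P i) R) \<and> (\<forall>i<length xs. P i \<subset> P (Suc i))"
proof -
  let ?n = "length xs" and ?I = "\<lambda>j. Idl (set (take j xs))"
  have xs: "set xs \<subseteq> carrier R" and nz: "\<And>i y. i < ?n \<Longrightarrow> y \<in> carrier R \<Longrightarrow> xs ! i \<otimes> y \<in> ?I i \<Longrightarrow> y \<in> ?I i"
    and proper: "Idl (set xs) \<noteq> carrier R"
    using reg unfolding regular_sequence_def by auto
  have sub: "set (take j xs) \<subseteq> carrier R" for j using xs set_take_subset[of j xs] by blast
  have idl: "ideal (?I j) R" for j by (rule genideal_ideal[OF sub])
  have "\<exists>P. (\<forall>i. ?n - k \<le> i \<and> i \<le> ?n \<longrightarrow> primeideal (P i) R) \<and>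
      (\<forall>i. ?n - k \<le> i \<and> i < ?n \<longrightarrow> P i \<subset> P (Suc i)) \<and> ?I (?n - k) \<subseteq> P (?n - k)"
    if "k \<le> ?n" for k
    using that
  proof (induction k)
    case 0
    have "\<one> \<notin> ?I ?n" using proper ideal.one_imp_carrier[OF idl[of ?n]] by auto
    then obtain Q where "primeideal Q R" "?I ?n \<subseteq> Q"
      using primeideal_avoiding[OF idl[of ?n], of "{\<one>}"] by auto
    then show ?case by (intro exI[of _ "\<lambda>_. Q"]) auto
  next
    case (Suc k)
    define j where "j = ?n - Suc k"
    have j: "?n - k = Suc j" "j < ?n" using Suc.prems by (auto simp: j_def)
    obtain P where P': "\<forall>i. Suc j \<le> i \<and> i \<le> ?n \<longrightarrow> primeideal (P i) R"
      "\<forall>i. Suc j \<le> i \<and> i < ?n \<longrightarrow> P i \<subset> P (Suc i)" "?I (Suc j) \<subseteq> P (Suc j)"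
      using Suc.IH[OF Suc_leD[OF Suc.prems]] unfolding j(1) by (elim exE conjE)
    then have P: "\<And>i. Suc j \<le> i \<Longrightarrow> i \<le> ?n \<Longrightarrow> primeideal (P i) R"
      "\<And>i. Suc j \<le> i \<Longrightarrow> i < ?n \<Longrightarrow> P i \<subset> P (Suc i)" "?I (Suc j) \<subseteq> P (Suc j)"
      by simp_all
    let ?P = "P (Suc j)" and ?x = "xs ! j"
    interpret P: primeideal ?P R using P(1) j(2) by simp
    have xc: "?x \<in> carrier R" using xs j(2) by auto
    have "?x \<in> ?I (Suc j)"
      using genideal_self[OF sub[of "Suc j"]] j(2) by (auto simp: take_Suc_conv_app_nth)
    then have xP: "?x \<in> ?P" using P(3) by blast
    have IP: "?I j \<subseteq> ?P"
    proof -
      have "set (take j xs) \<subseteq> ?I (Suc j)"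
        using genideal_self[OF sub[of "Suc j"]] set_take_subset_set_take[of j "Suc j" xs] by auto
      then show ?thesis using P(3) by (intro genideal_minimal P.ideal_axioms) auto
    qed
    \<comment> \<open>Missing this set does two things at once: exponent \<open>0\<close> confines
      the new prime to \<open>?P\<close>, and exponent \<open>1\<close> with
      \<open>s = \<one>\<close> excludes \<open>?x\<close> from it.\<close>
    let ?S = "{?x [^] (l::nat) \<otimes> s | l s. s \<in> carrier R - ?P}"
    have pow: "s \<in> ?I j" if "?x [^] (l::nat) \<otimes> s \<in> ?I j" "s \<in> carrier R" for l s
      using that
    proof (induction l)
      case (Suc l)
      then have "?x \<otimes> (?x [^] l \<otimes> s) \<in> ?I j" using xc by (simp add: m_ac)
      then show ?case using nz[OF j(2), of "?x [^] l \<otimes> s"] Suc xc by auto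
    qed auto
    have oneP: "\<one> \<notin> ?P" using P.I_notcarr P.one_imp_carrier by auto
    have "\<exists>Q. primeideal Q R \<and> ?I j \<subseteq> Q \<and> Q \<inter> ?S = {}"
    proof (rule primeideal_avoiding[OF idl])
      show "?S \<subseteq> carrier R" using xc by auto
      show "\<one> \<in> ?S" using oneP by (intro CollectI exI[of _ 0] exI[of _ \<one>]) auto
      show "?I j \<inter> ?S = {}" using pow IP by blast
      fix a b assume "a \<in> ?S" "b \<in> ?S"
      then obtain l s l' s' where ab: "a = ?x [^] (l::nat) \<otimes> s" "b = ?x [^] (l'::nat) \<otimes> s'"
        and s: "s \<in> carrier R" "s \<notin> ?P" "s' \<in> carrier R" "s' \<notin> ?P" by blast
      have "a \<otimes> b = ?x [^] (l + l') \<otimes> (s \<otimes> s')"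
        using xc s by (simp add: ab nat_pow_mult[symmetric] m_ac)
      moreover have "s \<otimes> s' \<in> carrier R - ?P" using s P.I_prime by auto
      ultimately show "a \<otimes> b \<in> ?S" by blast
    qed
    then obtain Q where Q: "primeideal Q R" "?I j \<subseteq> Q" "Q \<inter> ?S = {}" by blast
    interpret Q: primeideal Q R by (rule Q(1))
    have "?x \<in> ?S"
      using xc oneP by (intro CollectI exI[of _ 1] exI[of _ \<one>]) auto
    then have xQ: "?x \<notin> Q" using Q(3) by auto
    have "Q \<subseteq> ?P"
    proof
      fix s assume s: "s \<in> Q"
      then have sc: "s \<in> carrier R" using Q.a_subset by auto
      show "s \<in> ?P"
      proof (rule ccontr)
        assume "s \<notin> ?P"
        then have "s \<in> ?S" using sc by (intro CollectI exI[of _ 0] exI[of _ s]) auto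
        then show False using Q(3) s by blast
      qed
    qed
    then have "Q \<subset> ?P" using xP xQ by blast
    then show ?case unfolding j_def[symmetric]
      using Q P(1,2) by (intro exI[of _ "P(j := Q)"]) (auto simp: le_Suc_eq not_less_eq_eq[symmetric])
  qed
  from this[of ?n] show ?thesis by auto
qed

lemma (in cring) ideal_depth_le_krull_dim: "ideal_depth R I \<le> krull_dim R"
  unfolding ideal_depth_def
proof (rule SUP_least)
  fix xs assume "xs \<in> {xs. regular_sequence R xs \<and> set xs \<subseteq> I}"
  then have "length xs \<in> {n. \<exists>P. (\<forall>i\<le>n. primeideal (P i) R) \<and> (\<forall>i<n. P i \<subset> P (Suc i))}"
    using regular_sequence_prime_chain by blast
  then show "enat (length xs) \<le> krull_dim R"
    unfolding krull_dim_def by (rule SUP_upper)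
qed

text \<open>\<open>genideal\<close> is an intersection of ideals. The explicit combinations form an
  ideal containing the generators, and each of them lies in the generated ideal; both sides are
  compared under \<open>h\<close>.\<close>

lemma (in ring_emb) in_genideal_iff:
  assumes "set xs \<subseteq> carrier L" "y \<in> carrier L"
  shows "y \<in> Idl (set xs) \<longleftrightarrow>
    (\<exists>c. (\<forall>i<length xs. c i \<in> carrier L) \<and> h y = (\<Sum>i<length xs. h (c i) * h (xs ! i)))"
proof
  let ?J = "{y \<in> carrier L. \<exists>c. (\<forall>i<length xs. c i \<in> carrier L) \<and> h y = (\<Sum>i<length xs. h (c i) * h (xs ! i))}"
  have xs: "i < length xs \<Longrightarrow> xs ! i \<in> carrier L" for i using assms(1) by auto
  have l: "a \<otimes> y \<in> ?J" if a: "a \<in> carrier L" and y: "y \<in> ?J" for a y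
  proof -
    obtain c where "\<forall>i<length xs. c i \<in> carrier L" "h y = (\<Sum>i<length xs. h (c i) * h (xs ! i))" "y \<in> carrier L"
      using y by blast
    then show ?thesis using a
      by (auto simp: h_mult sum_distrib_left mult.assoc intro!: exI[of _ "\<lambda>i. a \<otimes> c i"])
  qed
  have "ideal ?J L"
  proof (rule idealI[OF ring_axioms])
    show "subgroup ?J (add_monoid L)"
    proof
      show "x \<otimes>\<^bsub>add_monoid L\<^esub> y \<in> ?J" if x: "x \<in> ?J" and y: "y \<in> ?J" for x y
      proof -
        obtain c where "\<forall>i<length xs. c i \<in> carrier L" "h x = (\<Sum>i<length xs. h (c i) * h (xs ! i))" "x \<in> carrier L"
          using x by blast
        moreover obtain d where "\<forall>i<length xs. d i \<in> carrier L" "h y = (\<Sum>i<length xs. h (d i) * h (xs ! i))" "y \<in> carrier L"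
          using y by blast
        ultimately show ?thesis
          by (auto simp: h_add sum.distrib distrib_right intro!: exI[of _ "\<lambda>i. c i \<oplus> d i"])
      qed
      show "inv\<^bsub>add_monoid L\<^esub> x \<in> ?J" if x: "x \<in> ?J" for x
      proof -
        have "\<ominus> \<one> \<otimes> x \<in> ?J" using l[OF _ x] by simp
        moreover have "\<ominus> \<one> \<otimes> x = inv\<^bsub>add_monoid L\<^esub> x"
          using x by (auto simp: l_minus a_inv_def[symmetric])
        ultimately show ?thesis by simp
      qed
    qed (auto intro!: exI[of _ "\<lambda>_. \<zero>"])
    show "x \<otimes> a \<in> ?J" "a \<otimes> x \<in> ?J" if "a \<in> ?J" "x \<in> carrier L" for a x
    proof -
      show "x \<otimes> a \<in> ?J" by (rule l[OF that(2,1)])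
      then show "a \<otimes> x \<in> ?J" using that by (simp add: m_comm)
    qed
  qed
  moreover have "set xs \<subseteq> ?J"
  proof
    fix x assume "x \<in> set xs"
    then obtain j where j: "j < length xs" "x = xs ! j" by (auto simp: in_set_conv_nth)
    have "h x = (\<Sum>i<length xs. h (if i = j then \<one> else \<zero>) * h (xs ! i))"
    proof -
      have "(\<Sum>i<length xs. h (if i = j then \<one> else \<zero>) * h (xs ! i)) = (\<Sum>i<length xs. if i = j then h (xs ! i) else 0)"
        by (rule sum.cong) auto
      then show ?thesis using j by simp
    qed
    then show "x \<in> ?J" using xs j by (auto intro!: exI[of _ "\<lambda>i. if i = j then \<one> else \<zero>"])
  qed
  ultimately have "Idl (set xs) \<subseteq> ?J" by (rule genideal_minimal)
  then show "y \<in> Idl (set xs) \<Longrightarrow>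
    \<exists>c. (\<forall>i<length xs. c i \<in> carrier L) \<and> h y = (\<Sum>i<length xs. h (c i) * h (xs ! i))" by blast
next
  interpret I: ideal "Idl (set xs)" L by (rule genideal_ideal[OF assms(1)])
  have xs: "i < length xs \<Longrightarrow> xs ! i \<in> carrier L" for i using assms(1) by auto
  assume "\<exists>c. (\<forall>i<length xs. c i \<in> carrier L) \<and> h y = (\<Sum>i<length xs. h (c i) * h (xs ! i))"
  then obtain c where c: "\<forall>i<length xs. c i \<in> carrier L" "h y = (\<Sum>i<length xs. h (c i) * h (xs ! i))" by blast
  have "\<exists>z\<in>Idl (set xs). h z = (\<Sum>i<m. h (c i) * h (xs ! i))" if "m \<le> length xs" for m
    using that
  proof (induction m)
    case 0
    show ?case by (intro bexI[of _ \<zero>]) auto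
  next
    case (Suc m)
    then obtain z where z: "z \<in> Idl (set xs)" "h z = (\<Sum>i<m. h (c i) * h (xs ! i))" by auto
    have zc: "z \<in> carrier L" using z(1) I.a_subset by auto
    have "xs ! m \<in> Idl (set xs)" using genideal_self[OF assms(1)] Suc.prems by auto
    then have "z \<oplus> c m \<otimes> xs ! m \<in> Idl (set xs)"
      using z c(1) Suc.prems by (intro I.a_closed I.I_l_closed) auto
    moreover have "h (z \<oplus> c m \<otimes> xs ! m) = (\<Sum>i<Suc m. h (c i) * h (xs ! i))"
      using zc c(1) Suc.prems xs z(2) by (simp add: h_add h_mult)
    ultimately show ?case by blast
  qed
  then obtain z where z: "z \<in> Idl (set xs)" "h z = h y" using c(2) by auto
  have "z \<in> carrier L" using z(1) I.a_subset by auto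
  then show "y \<in> Idl (set xs)" using z assms(2) h_eq_iff by auto
qed

section \<open>Localizations of subrings of integral domains\<close>

definition prime_in :: "'b::comm_ring_1 set \<Rightarrow> 'b set \<Rightarrow> bool"
  where "prime_in R P \<longleftrightarrow> P \<subseteq> R \<and> 0 \<in> P \<and> (\<forall>a\<in>P. \<forall>b\<in>P. a + b \<in> P) \<and>
    (\<forall>r\<in>R. \<forall>a\<in>P. r * a \<in> P) \<and> 1 \<notin> P \<and> (\<forall>a\<in>R. \<forall>b\<in>R. a * b \<in> P \<longrightarrow> a \<in> P \<or> b \<in> P)"

definition combs :: "'b::comm_ring_1 set \<Rightarrow> 'b list \<Rightarrow> 'b set"
  where "combs R xs = {x. \<exists>c. (\<forall>i<length xs. c i \<in> R) \<and> x = (\<Sum>i<length xs. c i * xs ! i)}"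

text \<open>Witness for the Cohen--Macaulay property at \<open>P\<close>: a sequence in \<open>P\<close> that becomes regular in
  the localization at \<open>P\<close> and is at least as long as every chain of primes inside \<open>P\<close>.\<close>

definition cm_witness :: "'b::comm_ring_1 set \<Rightarrow> 'b set \<Rightarrow> 'b list \<Rightarrow> bool"
  where "cm_witness R P xs \<longleftrightarrow> set xs \<subseteq> P \<and>
    (\<forall>i<length xs. \<forall>z\<in>R. xs ! i * z \<in> combs R (take i xs) \<longrightarrow>
      (\<exists>c\<in>R - P. c * z \<in> combs R (take i xs))) \<and>
    (\<forall>n Q. (\<forall>i\<le>n. prime_in R (Q i)) \<and> (\<forall>i<n. Q i \<subset> Q (Suc i)) \<and> Q n \<subseteq> P \<longrightarrow> n \<le> length xs)"

lemma to_fract_power: "to_fract (a ^ n) = to_fract a ^ n"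
  by (induction n) auto

locale subring_set =
  fixes R :: "'b::idom set"
  assumes R_0 [simp]: "0 \<in> R" and R_1 [simp]: "1 \<in> R"
    and R_add: "a \<in> R \<Longrightarrow> b \<in> R \<Longrightarrow> a + b \<in> R" and R_mult: "a \<in> R \<Longrightarrow> b \<in> R \<Longrightarrow> a * b \<in> R"
    and R_uminus: "a \<in> R \<Longrightarrow> - a \<in> R"
begin

lemma R_sum: "(\<And>a. a \<in> A \<Longrightarrow> f a \<in> R) \<Longrightarrow> sum f A \<in> R"
  by (induction A rule: infinite_finite_induct) (auto intro: R_add)

lemma R_prod: "(\<And>a. a \<in> A \<Longrightarrow> f a \<in> R) \<Longrightarrow> prod f A \<in> R"
  by (induction A rule: infinite_finite_induct) (auto intro: R_mult)

lemma R_power: "a \<in> R \<Longrightarrow> a ^ n \<in> R"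
  by (induction n) (auto intro: R_mult)

end

text \<open>\<open>L\<close> is the localization of \<open>R\<close> at \<open>P\<close>, seen
  inside the fraction field of the ambient domain \<open>'b\<close>, which contains that of
  \<open>R\<close>.\<close>

locale local_emb = ring_emb L h + subring_set R
  for L (structure) and h :: "'a \<Rightarrow> 'b::idom fract" and R :: "'b set" +
  fixes P :: "'b set"
  assumes prime_P: "prime_in R P"
    and img: "h ` carrier L = {to_fract a / to_fract s | a s. a \<in> R \<and> s \<in> R \<and> s \<notin> P}"
begin

lemma P_sub: "a \<in> P \<Longrightarrow> a \<in> R" and P_0: "0 \<in> P" and P_add: "a \<in> P \<Longrightarrow> b \<in> P \<Longrightarrow> a + b \<in> P"
  and P_lmult: "r \<in> R \<Longrightarrow> a \<in> P \<Longrightarrow> r * a \<in> P" and P_1: "1 \<notin> P"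
  and P_prime: "a \<in> R \<Longrightarrow> b \<in> R \<Longrightarrow> a * b \<in> P \<Longrightarrow> a \<in> P \<or> b \<in> P"
  using prime_P unfolding prime_in_def by auto

lemma den_nonzero [simp]: "s \<notin> P \<Longrightarrow> s \<noteq> 0"
  using P_0 by auto

lemma notin_mult: "s \<in> R \<Longrightarrow> s \<notin> P \<Longrightarrow> t \<in> R \<Longrightarrow> t \<notin> P \<Longrightarrow> s * t \<notin> P"
  using P_prime by blast

lemma prod_notin_P: "finite A \<Longrightarrow> (\<And>a. a \<in> A \<Longrightarrow> f a \<in> R - P) \<Longrightarrow> prod f A \<in> R - P"
proof (induction A rule: finite_induct)
  case empty
  then show ?case using P_1 by simp
next
  case (insert a A)
  then have "f a \<in> R - P" "prod f A \<in> R - P" by auto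
  then show ?case using insert.hyps P_prime[of "f a" "prod f A"] by (auto intro: R_mult)
qed

lemma obtain_frac:
  assumes "x \<in> carrier L"
  obtains a s where "a \<in> R" "s \<in> R" "s \<notin> P" "h x = to_fract a / to_fract s"
  using assms img by blast

lemma obtain_elem:
  assumes "a \<in> R" "s \<in> R" "s \<notin> P"
  obtains x where "x \<in> carrier L" "h x = to_fract a / to_fract s"
proof -
  have "to_fract a / to_fract s \<in> h ` carrier L" using assms unfolding img by blast
  then show thesis using that by auto
qed

definition lift where "lift a = (SOME x. x \<in> carrier L \<and> h x = to_fract a)"

lemma lift: "a \<in> R \<Longrightarrow> lift a \<in> carrier L" "a \<in> R \<Longrightarrow> h (lift a) = to_fract a"
proof -
  assume a: "a \<in> R"
  obtain x where "x \<in> carrier L" "h x = to_fract a" using obtain_elem[OF a R_1 P_1] by auto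
  then have "lift a \<in> carrier L \<and> h (lift a) = to_fract a"
    unfolding lift_def by (intro someI_ex[of "\<lambda>x. x \<in> carrier L \<and> h x = to_fract a"]) blast
  then show "lift a \<in> carrier L" "h (lift a) = to_fract a" by auto
qed

definition contr where "contr I = {a \<in> R. lift a \<in> I}"

text \<open>\<open>a / s\<close> and \<open>a / 1\<close> differ by a unit of \<open>L\<close>, so
  every ideal of \<open>L\<close> is determined by its contraction to \<open>R\<close>.\<close>

lemma mem_ideal_iff:
  assumes I: "ideal I L" and x: "x \<in> carrier L" "a \<in> R" "s \<in> R" "s \<notin> P" "h x = to_fract a / to_fract s"
  shows "x \<in> I \<longleftrightarrow> a \<in> contr I"
proof -
  interpret I: ideal I L by fact
  obtain u where u: "u \<in> carrier L" "h u = to_fract 1 / to_fract s"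
    using obtain_elem[OF R_1 x(3,4)] .
  have "lift s \<otimes> x = lift a" "u \<otimes> lift a = x"
    by (rule iffD1[OF h_eq_iff]; use x u in \<open>simp add: h_mult lift\<close>)+
  then show ?thesis
    unfolding contr_def using x u I.I_l_closed[of x "lift s"] I.I_l_closed[of "lift a" u]
    by (auto simp: lift)
qed

lemma lift_eqs: "lift 0 = \<zero>" "lift 1 = \<one>"
  "a \<in> R \<Longrightarrow> b \<in> R \<Longrightarrow> lift (a + b) = lift a \<oplus> lift b"
  "a \<in> R \<Longrightarrow> b \<in> R \<Longrightarrow> lift (a * b) = lift a \<otimes> lift b"
  by (rule iffD1[OF h_eq_iff]; simp add: lift R_add R_mult h_add h_mult)+

lemma contr_ideal:
  assumes "ideal I L"
  shows "contr I \<subseteq> R" "0 \<in> contr I" "a \<in> contr I \<Longrightarrow> b \<in> contr I \<Longrightarrow> a + b \<in> contr I"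
    "r \<in> R \<Longrightarrow> a \<in> contr I \<Longrightarrow> r * a \<in> contr I"
proof -
  interpret I: ideal I L by fact
  show "contr I \<subseteq> R" "0 \<in> contr I" "a \<in> contr I \<Longrightarrow> b \<in> contr I \<Longrightarrow> a + b \<in> contr I"
    "r \<in> R \<Longrightarrow> a \<in> contr I \<Longrightarrow> r * a \<in> contr I"
    by (auto simp: contr_def lift_eqs R_add R_mult lift intro: I.I_l_closed)
qed

lemma noetherian:
  assumes fg: "\<And>I. I \<subseteq> R \<Longrightarrow> 0 \<in> I \<Longrightarrow> (\<And>f g. f \<in> I \<Longrightarrow> g \<in> I \<Longrightarrow> f + g \<in> I) \<Longrightarrow>
    (\<And>f g. f \<in> R \<Longrightarrow> g \<in> I \<Longrightarrow> f * g \<in> I) \<Longrightarrow>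
    \<exists>G\<subseteq>I. finite G \<and> (\<forall>f\<in>I. \<exists>c. (\<forall>g\<in>G. c g \<in> R) \<and> f = (\<Sum>g\<in>G. c g * g))"
  shows "noetherian_ring L"
proof (rule noetherian_ringI)
  fix I assume I: "ideal I L"
  interpret I: ideal I L by fact
  obtain G where G: "G \<subseteq> contr I" "finite G"
    "\<forall>f\<in>contr I. \<exists>c. (\<forall>g\<in>G. c g \<in> R) \<and> f = (\<Sum>g\<in>G. c g * g)"
    using fg[OF contr_ideal[OF I]] by blast
  let ?A = "lift ` G"
  have GR: "G \<subseteq> R" using G(1) contr_ideal(1)[OF I] by blast
  have AI: "?A \<subseteq> I" using G(1) by (auto simp: contr_def)
  have Ac: "?A \<subseteq> carrier L" using AI I.a_subset by blast
  interpret J: ideal "Idl ?A" L by (rule genideal_ideal[OF Ac])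
  have "I \<subseteq> Idl ?A"
  proof
    fix x assume x: "x \<in> I"
    have xc: "x \<in> carrier L" using x I.a_subset by blast
    obtain a s where a: "a \<in> R" "s \<in> R" "s \<notin> P" "h x = to_fract a / to_fract s"
      using obtain_frac[OF xc] .
    have "a \<in> contr I" using mem_ideal_iff[OF I xc a] x by simp
    then obtain c where c: "\<forall>g\<in>G. c g \<in> R" "a = (\<Sum>g\<in>G. c g * g)" using G(3) by blast
    have "(\<Sum>g\<in>B. c g * g) \<in> contr (Idl ?A)" if "B \<subseteq> G" for B
      using finite_subset[OF that G(2)] that
    proof (induction B rule: finite_induct)
      case empty
      show ?case using contr_ideal(2)[OF J.ideal_axioms] by simp
    next
      case (insert g B)
      have "lift g \<in> Idl ?A" using genideal_self[OF Ac] insert.prems by blast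
      then have "g \<in> contr (Idl ?A)" using insert.prems GR by (auto simp: contr_def)
      then have "c g * g \<in> contr (Idl ?A)"
        using contr_ideal(4)[OF J.ideal_axioms] c(1) insert.prems by blast
      then show ?case
        using insert contr_ideal(3)[OF J.ideal_axioms] by auto
    qed
    then have "a \<in> contr (Idl ?A)" using c(2) by simp
    then show "x \<in> Idl ?A" using mem_ideal_iff[OF J.ideal_axioms xc a] by simp
  qed
  then have "I = Idl ?A" using genideal_minimal[OF I AI] by blast
  then show "\<exists>A\<subseteq>carrier L. finite A \<and> I = Idl A" using Ac G(2) by blast
qed

text \<open>This is the unique maximal ideal of \<open>L\<close> (\<open>maximalideal_iff\<close>):
  a fraction whose numerator lies outside \<open>P\<close> is invertible.\<close>

definition M where "M = {x \<in> carrier L. \<exists>a s. a \<in> P \<and> s \<in> R \<and> s \<notin> P \<and> h x = to_fract a / to_fract s}"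

lemma MI: "x \<in> carrier L \<Longrightarrow> a \<in> P \<Longrightarrow> s \<in> R \<Longrightarrow> s \<notin> P \<Longrightarrow> h x = to_fract a / to_fract s \<Longrightarrow> x \<in> M"
  unfolding M_def by blast

text \<open>Membership does not depend on how the fraction is written: if \<open>a = b / s\<close>
  with \<open>b\<close> in \<open>P\<close>, then \<open>s * a\<close> is in \<open>P\<close> with
  \<open>s\<close> outside, and primeness applies.\<close>

lemma lift_in_M_iff: "a \<in> R \<Longrightarrow> lift a \<in> M \<longleftrightarrow> a \<in> P"
proof -
  assume a: "a \<in> R"
  have "a \<in> P" if "b \<in> P" "s \<in> R" "s \<notin> P" "to_fract a = to_fract b / to_fract s" for b s
  proof -
    have "to_fract (s * a) = to_fract b" using that by (simp add: field_simps)
    then have "s * a \<in> P" using that(1) by (simp only: to_fract_eq_iff)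
    then show "a \<in> P" using P_prime[OF that(2) a] that(3) by blast
  qed
  moreover have "\<exists>b s. b \<in> P \<and> s \<in> R \<and> s \<notin> P \<and> to_fract a = to_fract b / to_fract s" if "a \<in> P"
    using that P_1 by (intro exI[of _ a] exI[of _ 1]) simp
  ultimately show ?thesis unfolding M_def using a by (auto simp: lift)
qed

lemma ideal_M: "ideal M L"
proof (rule idealI[OF ring_axioms])
  have l: "x \<otimes> a \<in> M" if a: "a \<in> M" and x: "x \<in> carrier L" for a x
  proof -
    obtain b s where b: "b \<in> P" "s \<in> R" "s \<notin> P" "h a = to_fract b / to_fract s" "a \<in> carrier L"
      using a unfolding M_def by blast
    obtain c t where c: "c \<in> R" "t \<in> R" "t \<notin> P" "h x = to_fract c / to_fract t"
      using obtain_frac[OF x] .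
    have "h (x \<otimes> a) = to_fract (c * b) / to_fract (t * s)" using b c x by (simp add: h_mult)
    moreover have "c * b \<in> P" "t * s \<in> R" "t * s \<notin> P" using b c by (simp_all add: P_lmult R_mult notin_mult)
    ultimately show ?thesis using b(5) x by (intro MI) auto
  qed
  show "x \<otimes> a \<in> M" "a \<otimes> x \<in> M" if "a \<in> M" "x \<in> carrier L" for a x
  proof -
    show "x \<otimes> a \<in> M" by (rule l[OF that])
    then show "a \<otimes> x \<in> M" using that by (simp add: m_comm M_def)
  qed
  show "subgroup M (add_monoid L)"
  proof
    show "M \<subseteq> carrier (add_monoid L)" by (auto simp: M_def)
    show "\<one>\<^bsub>add_monoid L\<^esub> \<in> M"
      by (rule MI[OF _ P_0 R_1 P_1]) simp_all
    show "x \<otimes>\<^bsub>add_monoid L\<^esub> y \<in> M" if x: "x \<in> M" and y: "y \<in> M" for x y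
    proof -
      obtain a s where a: "a \<in> P" "s \<in> R" "s \<notin> P" "h x = to_fract a / to_fract s" "x \<in> carrier L"
        using x unfolding M_def by blast
      obtain b t where b: "b \<in> P" "t \<in> R" "t \<notin> P" "h y = to_fract b / to_fract t" "y \<in> carrier L"
        using y unfolding M_def by blast
      have "h (x \<oplus> y) = to_fract (t * a + s * b) / to_fract (s * t)"
        using a b by (simp add: h_add field_simps)
      moreover have "t * a + s * b \<in> P" "s * t \<in> R" "s * t \<notin> P"
        using a b by (simp_all add: P_add P_lmult P_sub R_mult notin_mult)
      ultimately show ?thesis using a(5) b(5) by (intro MI) auto
    qed
    show "inv\<^bsub>add_monoid L\<^esub> x \<in> M" if x: "x \<in> M" for x
    proof -
      have "\<ominus> \<one> \<otimes> x \<in> M" using l[OF x] by simp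
      moreover have "\<ominus> \<one> \<otimes> x = inv\<^bsub>add_monoid L\<^esub> x"
        using x by (auto simp: M_def l_minus a_inv_def[symmetric])
      ultimately show ?thesis by simp
    qed
  qed
qed

lemma proper_ideal_sub_M:
  assumes I: "ideal I L" "I \<noteq> carrier L"
  shows "I \<subseteq> M"
proof
  interpret I: ideal I L by fact
  fix x assume x: "x \<in> I"
  have xc: "x \<in> carrier L" using x I.a_subset by blast
  obtain a s where a: "a \<in> R" "s \<in> R" "s \<notin> P" "h x = to_fract a / to_fract s"
    using obtain_frac[OF xc] .
  show "x \<in> M"
  proof (rule ccontr)
    assume "x \<notin> M"
    then have aP: "a \<notin> P" using a xc unfolding M_def by blast
    obtain y where y: "y \<in> carrier L" "h y = to_fract s / to_fract a"
      using obtain_elem[OF a(2,1) aP] .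
    have "y \<otimes> x = \<one>"
      by (rule iffD1[OF h_eq_iff]) (use xc y a aP in \<open>simp_all add: h_mult\<close>)
    then have "\<one> \<in> I" using I.I_l_closed[OF x y(1)] by simp
    then show False using I.one_imp_carrier I(2) by blast
  qed
qed

lemma M_proper: "M \<noteq> carrier L"
  using lift_in_M_iff[OF R_1] P_1 by (auto simp: lift_eqs)

lemma maximalideal_iff: "maximalideal J L \<longleftrightarrow> J = M"
proof
  assume J: "maximalideal J L"
  interpret J: maximalideal J L by fact
  have "J \<subseteq> M" using proper_ideal_sub_M[OF J.ideal_axioms] J.I_notcarr by blast
  moreover have "M \<subseteq> carrier L" by (auto simp: M_def)
  ultimately show "J = M" using J.I_maximal[OF ideal_M] M_proper by blast
next
  show "maximalideal J L" if "J = M"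
    unfolding that
    by (rule maximalidealI[OF ideal_M]) (use M_proper proper_ideal_sub_M in blast)+
qed

lemma contr_prime:
  assumes Q: "primeideal Q L"
  shows "prime_in R (contr Q)" "contr Q \<subseteq> P"
proof -
  interpret Q: primeideal Q L by fact
  have "\<one> \<notin> Q" using Q.one_imp_carrier Q.I_notcarr by blast
  then have "1 \<notin> contr Q" by (simp add: contr_def lift_eqs)
  moreover have "a \<in> contr Q \<or> b \<in> contr Q" if "a \<in> R" "b \<in> R" "a * b \<in> contr Q" for a b
    using that Q.I_prime[of "lift a" "lift b"] by (auto simp: contr_def lift_eqs lift)
  ultimately show "prime_in R (contr Q)"
    unfolding prime_in_def using contr_ideal[OF Q.ideal_axioms] by blast
  show "contr Q \<subseteq> P"
    using proper_ideal_sub_M[OF Q.ideal_axioms] Q.I_notcarr lift_in_M_iff by (auto simp: contr_def)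
qed

lemma contr_strict:
  assumes "ideal I L" "ideal J L" "I \<subset> J"
  shows "contr I \<subset> contr J"
proof -
  obtain x where x: "x \<in> J" "x \<notin> I" using assms(3) by blast
  have xc: "x \<in> carrier L"
    using x additive_subgroup.a_subset[OF ideal.axioms(1)[OF assms(2)]] by blast
  obtain a s where a: "a \<in> R" "s \<in> R" "s \<notin> P" "h x = to_fract a / to_fract s"
    using obtain_frac[OF xc] .
  have "a \<in> contr J" "a \<notin> contr I"
    using mem_ideal_iff[OF assms(1) xc a] mem_ideal_iff[OF assms(2) xc a] x by auto
  then show ?thesis using assms(3) by (auto simp: contr_def)
qed

text \<open>Clearing denominators: the ideal generated in \<open>L\<close> is described inside
  \<open>R\<close> at the price of one multiplier outside \<open>P\<close>. This is why
  \<open>cm_witness\<close> allows such a multiplier.\<close>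

lemma in_Idl_lift_iff:
  assumes xs: "set xs \<subseteq> R" and y: "y \<in> carrier L" "a \<in> R" "s \<in> R" "s \<notin> P" "h y = to_fract a / to_fract s"
  shows "y \<in> Idl (set (map lift xs)) \<longleftrightarrow> (\<exists>c\<in>R - P. c * a \<in> combs R xs)"
proof -
  have xc: "set (map lift xs) \<subseteq> carrier L" using xs lift by auto
  have xsi: "xs ! i \<in> R" if "i < length xs" for i using xs that by auto
  show ?thesis unfolding in_genideal_iff[OF xc y(1)]
  proof
    assume "\<exists>c. (\<forall>i<length (map lift xs). c i \<in> carrier L) \<and>
      h y = (\<Sum>i<length (map lift xs). h (c i) * h (map lift xs ! i))"
    then obtain c where c: "\<And>i. i < length xs \<Longrightarrow> c i \<in> carrier L"
      and hy': "h y = (\<Sum>i<length xs. h (c i) * h (map lift xs ! i))"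
      by auto
    have hy: "h y = (\<Sum>i<length xs. h (c i) * to_fract (xs ! i))"
      unfolding hy' by (rule sum.cong) (simp_all add: lift xsi)
    have "\<forall>i. \<exists>u t. i < length xs \<longrightarrow> u \<in> R \<and> t \<in> R \<and> t \<notin> P \<and> h (c i) = to_fract u / to_fract t"
      using c obtain_frac by metis
    then obtain u t where ut: "\<And>i. i < length xs \<Longrightarrow> u i \<in> R"
      "\<And>i. i < length xs \<Longrightarrow> t i \<in> R - P" "\<And>i. i < length xs \<Longrightarrow> h (c i) = to_fract (u i) / to_fract (t i)"
      by (metis DiffI)
    \<comment> \<open>\<open>T\<close> is a common denominator of the coefficients, and
      \<open>T' i\<close> is the cofactor by which the \<open>i\<close>-th numerator has to be
      multiplied.\<close>
    define T where "T = (\<Prod>i<length xs. t i)"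
    define T' where "T' i = (\<Prod>j\<in>{..<length xs} - {i}. t j)" for i
    have T: "T \<in> R - P" unfolding T_def by (rule prod_notin_P) (use ut in auto)
    have T': "T' i \<in> R" for i unfolding T'_def by (rule R_prod) (use ut in auto)
    have TT: "T = t i * T' i" if "i < length xs" for i
      unfolding T_def T'_def using that by (subst prod.remove[of _ i]) auto
    have "to_fract (T * a) = to_fract s * to_fract T * h y" using y by simp
    also have "\<dots> = (\<Sum>i<length xs. to_fract (s * (T' i * u i) * xs ! i))"
      unfolding hy sum_distrib_left
    proof (rule sum.cong[OF refl])
      fix i assume "i \<in> {..<length xs}"
      then have i: "i < length xs" by simp
      then have "to_fract (t i) \<noteq> 0" using ut(2)[OF i] by simp
      then show "to_fract s * to_fract T * (h (c i) * to_fract (xs ! i)) =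
          to_fract (s * (T' i * u i) * xs ! i)"
        unfolding TT[OF i] ut(3)[OF i] by (simp add: field_simps)
    qed
    finally have "T * a = (\<Sum>i<length xs. s * (T' i * u i) * xs ! i)"
      by (simp only: to_fract_sum[symmetric] to_fract_eq_iff)
    then have "T * a \<in> combs R xs"
      unfolding combs_def using ut T' y(3) by (auto intro!: exI[of _ "\<lambda>i. s * (T' i * u i)"] R_mult)
    then show "\<exists>c\<in>R - P. c * a \<in> combs R xs" using T by blast
  next
    assume "\<exists>c\<in>R - P. c * a \<in> combs R xs"
    then obtain c d where c: "c \<in> R" "c \<notin> P" and d: "\<And>i. i < length xs \<Longrightarrow> d i \<in> R"
      "c * a = (\<Sum>i<length xs. d i * xs ! i)"
      unfolding combs_def by auto
    have cs: "c * s \<in> R" "c * s \<notin> P" using c y by (simp_all add: R_mult notin_mult)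
    obtain v where v: "v \<in> carrier L" "h v = to_fract 1 / to_fract (c * s)"
      using obtain_elem[OF R_1 cs] .
    have "h y = h v * to_fract (c * a)" using y c by (simp add: v)
    also have "\<dots> = (\<Sum>i<length xs. h (v \<otimes> lift (d i)) * h (map lift xs ! i))"
      unfolding d(2) to_fract_sum sum_distrib_left
      by (rule sum.cong) (use d(1) v xsi in \<open>auto simp: h_mult lift\<close>)
    finally show "\<exists>c. (\<forall>i<length (map lift xs). c i \<in> carrier L) \<and>
      h y = (\<Sum>i<length (map lift xs). h (c i) * h (map lift xs ! i))"
      using d(1) v by (intro exI[of _ "\<lambda>i. v \<otimes> lift (d i)"]) (auto simp: lift)
  qed
qed

text \<open>The witness squeezes both numbers: it becomes a regular sequence in \<open>M\<close>, so
  the depth is at least its length; chains of primes contract strictly into \<open>P\<close>, so the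
  dimension is at most its length; and depth never exceeds dimension.\<close>

lemma cohen_macaulay_local:
  assumes noeth: "noetherian_ring L" and wit: "cm_witness R P xs"
  shows "cohen_macaulay_local L"
proof -
  have max: "(THE M. maximalideal M L) = M" "\<exists>!M. maximalideal M L"
    unfolding maximalideal_iff by auto
  have xsP: "set xs \<subseteq> P"
    and reg: "\<And>i z. i < length xs \<Longrightarrow> z \<in> R \<Longrightarrow> xs ! i * z \<in> combs R (take i xs) \<Longrightarrow>
      \<exists>c\<in>R - P. c * z \<in> combs R (take i xs)"
    and ht: "\<And>n Q. (\<forall>i\<le>n. prime_in R (Q i)) \<Longrightarrow> (\<forall>i<n. Q i \<subset> Q (Suc i)) \<Longrightarrow> Q n \<subseteq> P \<Longrightarrow> n \<le> length xs"
    using wit unfolding cm_witness_def by blast+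
  have xsR: "set xs \<subseteq> R" using xsP P_sub by blast
  let ?ys = "map lift xs"
  have ysM: "set ?ys \<subseteq> M" using xsP xsR lift_in_M_iff by auto
  have "regular_sequence L ?ys"
    unfolding regular_sequence_def
  proof (intro conjI allI ballI impI)
    show "set ?ys \<subseteq> carrier L" using xsR lift by auto
    have "Idl (set ?ys) \<subseteq> M" by (rule genideal_minimal[OF ideal_M ysM])
    then show "Idl (set ?ys) \<noteq> carrier L" using M_proper by (auto simp: M_def)
    fix i y assume i: "i < length ?ys" and y: "y \<in> carrier L"
      and mem: "?ys ! i \<otimes> y \<in> Idl (set (take i ?ys))"
    have i': "i < length xs" using i by simp
    have sub: "set (take i xs) \<subseteq> R" using xsR set_take_subset[of i xs] by blast
    obtain a s where a: "a \<in> R" "s \<in> R" "s \<notin> P" "h y = to_fract a / to_fract s"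
      using obtain_frac[OF y] .
    have xi: "xs ! i \<in> R" using i' xsR by auto
    have "h (lift (xs ! i) \<otimes> y) = to_fract (xs ! i * a) / to_fract s"
      using a y xi by (simp add: h_mult lift)
    then have "\<exists>c\<in>R - P. c * (xs ! i * a) \<in> combs R (take i xs)"
      using mem i' a y xi in_Idl_lift_iff[OF sub, of "lift (xs ! i) \<otimes> y" "xs ! i * a" s]
      by (simp add: take_map lift R_mult)
    then obtain c where c: "c \<in> R" "c \<notin> P" "c * (xs ! i * a) \<in> combs R (take i xs)" by blast
    then have "xs ! i * (c * a) \<in> combs R (take i xs)" by (simp add: mult.left_commute)
    then obtain d where d: "d \<in> R - P" "d * (c * a) \<in> combs R (take i xs)"
      using reg[OF i' R_mult[OF c(1) a(1)]] by blast
    then have "d * c * a \<in> combs R (take i xs)" "d * c \<in> R - P"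
      using c by (simp_all add: R_mult notin_mult mult.assoc)
    then show "y \<in> Idl (set (take i ?ys))"
      using in_Idl_lift_iff[OF sub y a] by (auto simp: take_map)
  qed
  then have "enat (length ?ys) \<le> ideal_depth L M"
    unfolding ideal_depth_def using ysM by (intro SUP_upper) blast
  moreover have "krull_dim L \<le> enat (length xs)"
    unfolding krull_dim_def
  proof (rule SUP_least)
    fix n assume "n \<in> {n. \<exists>Q. (\<forall>i\<le>n. primeideal (Q i) L) \<and> (\<forall>i<n. Q i \<subset> Q (Suc i))}"
    then obtain Q where Q: "\<forall>i\<le>n. primeideal (Q i) L" "\<forall>i<n. Q i \<subset> Q (Suc i)" by blast
    have idl: "ideal (Q i) L" if "i \<le> n" for i using Q(1) that primeideal.axioms(1) by blast
    have "n \<le> length xs"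
    proof (rule ht[of n "\<lambda>i. contr (Q i)"])
      show "\<forall>i\<le>n. prime_in R (contr (Q i))" "contr (Q n) \<subseteq> P"
        using Q(1) contr_prime by blast+
      show "\<forall>i<n. contr (Q i) \<subset> contr (Q (Suc i))"
        using Q(2) contr_strict idl by (meson Suc_leI less_imp_le)
    qed
    then show "enat n \<le> enat (length xs)" by simp
  qed
  ultimately have "krull_dim L \<le> ideal_depth L M"
    unfolding length_map by (rule order_trans[rotated])
  then have "ideal_depth L M = krull_dim L"
    by (rule antisym[OF ideal_depth_le_krull_dim])
  then show ?thesis
    unfolding cohen_macaulay_local_def max using is_cring noeth max(2) by simp
qed

end

text \<open>The hypothesis is an integral equation for \<open>a / b\<close> with denominators
  cleared. It rewrites \<open>a ^ n\<close> by lower powers, so \<open>b ^ n\<close> is a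
  denominator for every power of \<open>a / b\<close>.\<close>

lemma integral_imp_almost_integral:
  fixes a b :: "'b::idom"
  assumes eq: "a ^ n + (\<Sum>i<n. c i * a ^ i * b ^ (n - i)) = 0"
  shows "b ^ k dvd b ^ n * a ^ k"
proof (induction k rule: less_induct)
  case (less k)
  show ?case
  proof (cases "k < n")
    case True
    then have "b ^ k dvd b ^ n" by (simp add: le_imp_power_dvd)
    then show ?thesis by (rule dvd_mult2)
  next
    case False
    then have k: "k = (k - n) + n" by simp
    have "a ^ n = - (\<Sum>i<n. c i * a ^ i * b ^ (n - i))"
      using eq by (simp add: eq_neg_iff_add_eq_0)
    then have "b ^ n * a ^ k = - (\<Sum>i<n. b ^ n * a ^ (k - n) * (c i * a ^ i * b ^ (n - i)))"
      by (subst k, simp add: power_add sum_distrib_left mult_ac)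
    moreover have "b ^ k dvd b ^ n * a ^ (k - n) * (c i * a ^ i * b ^ (n - i))" if "i < n" for i
    proof -
      have "b ^ (k - n + i) dvd b ^ n * a ^ (k - n + i)" using less[of "k - n + i"] False that by simp
      then have "b ^ (k - n + i) * b ^ (n - i) dvd (b ^ n * a ^ (k - n + i)) * (c i * b ^ (n - i))"
        by (intro mult_dvd_mono) auto
      moreover have "b ^ (k - n + i) * b ^ (n - i) = b ^ k"
        using that False by (simp flip: power_add)
      moreover have "(b ^ n * a ^ (k - n + i)) * (c i * b ^ (n - i)) =
          b ^ n * a ^ (k - n) * (c i * a ^ i * b ^ (n - i))"
        by (simp add: power_add mult_ac)
      ultimately show ?thesis by (simp only:)
    qed
    ultimately show ?thesis by (auto intro!: dvd_sum)
  qed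
qed

context ring_emb
begin

lemma one_not_zero: "\<one> \<noteq> \<zero>"
proof
  assume "\<one> = \<zero>"
  then have "h \<one> = h \<zero>" by simp
  then show False by simp
qed

end

lemma ring_emb_domain:
  fixes h :: "'a \<Rightarrow> 'f::idom"
  assumes "ring_emb L h"
  shows "domain L"
proof -
  interpret ring_emb L h by fact
  show ?thesis
  proof
    show "\<one>\<^bsub>L\<^esub> \<noteq> \<zero>\<^bsub>L\<^esub>" by (rule one_not_zero)
    fix a b assume ab: "a \<otimes>\<^bsub>L\<^esub> b = \<zero>\<^bsub>L\<^esub>" "a \<in> carrier L" "b \<in> carrier L"
    then have "h a * h b = 0" by (metis h_mult h_zero)
    then have "h a = h \<zero>\<^bsub>L\<^esub> \<or> h b = h \<zero>\<^bsub>L\<^esub>" by simp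
    then show "a = \<zero>\<^bsub>L\<^esub> \<or> b = \<zero>\<^bsub>L\<^esub>" using ab h_eq_iff by blast
  qed
qed

text \<open>An integral element \<open>x = a / b\<close> has coefficients with a common denominator
  \<open>T\<close> outside \<open>P\<close>. Then \<open>T x\<close> is integral over
  \<open>R\<close>, so the hypothesis gives \<open>T * a = b * q\<close> with \<open>q\<close> in
  \<open>R\<close>, and \<open>x = q / T\<close> lies in \<open>L\<close>.\<close>

lemma (in local_emb) integrally_closed:
  assumes almost: "\<And>a b d. a \<in> R \<Longrightarrow> b \<in> R \<Longrightarrow> b \<noteq> 0 \<Longrightarrow> d \<noteq> 0 \<Longrightarrow> (\<And>k. b ^ k dvd d * a ^ k) \<Longrightarrow>
    \<exists>q\<in>R. a = b * q"
  shows "integrally_closed_domain L"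
  unfolding integrally_closed_domain_def
proof (intro conjI ballI impI)
  show dom: "domain L" by (rule ring_emb_domain[OF ring_emb_axioms])
  interpret domain L by (rule dom)
  let ?K = "fraction_field L" and ?\<phi> = "to_fraction_field L"
  obtain g where g: "ring_emb ?K g" "g ` carrier ?K = {h a / h s | a s. a \<in> carrier L \<and> s \<in> carrier L - {\<zero>}}"
    and \<phi>: "\<And>a. a \<in> carrier L \<Longrightarrow> g (?\<phi> a) = h a" "\<And>a. a \<in> carrier L \<Longrightarrow> ?\<phi> a \<in> carrier ?K"
  proof (rule loc_props[OF ring_emb_axioms, of "carrier L - {\<zero>}"])
    fix g assume g: "ring_emb (localization L (carrier L - {\<zero>})) g"
      "g ` carrier (localization L (carrier L - {\<zero>})) = {h a / h s | a s. a \<in> carrier L \<and> s \<in> carrier L - {\<zero>}}"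
      "\<And>a s. a \<in> carrier L \<Longrightarrow> s \<in> carrier L - {\<zero>} \<Longrightarrow> g (loc_frac L (carrier L - {\<zero>}) a s) = h a / h s"
      "\<And>a s. a \<in> carrier L \<Longrightarrow> s \<in> carrier L - {\<zero>} \<Longrightarrow>
        loc_frac L (carrier L - {\<zero>}) a s \<in> carrier (localization L (carrier L - {\<zero>}))"
    show thesis
      by (rule that[of g]) (use g one_not_zero in \<open>simp_all add: fraction_field_def to_fraction_field_def\<close>)
  qed (use integral one_not_zero in auto)
  interpret K: ring_emb ?K g by (rule g(1))
  fix x assume x: "x \<in> carrier ?K" and "integral_element ?K (?\<phi> ` carrier L) x"
  then obtain n :: nat and c where c: "\<And>i. i < n \<Longrightarrow> c i \<in> ?\<phi> ` carrier L"
    and eq: "x [^]\<^bsub>?K\<^esub> n \<oplus>\<^bsub>?K\<^esub> (\<Oplus>\<^bsub>?K\<^esub>i\<in>{..<n}. c i \<otimes>\<^bsub>?K\<^esub> x [^]\<^bsub>?K\<^esub> i) = \<zero>\<^bsub>?K\<^esub>"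
    unfolding integral_element_def by blast
  have cK: "c i \<in> carrier ?K" if "i < n" for i using c[OF that] \<phi>(2) by auto
  have "g (c i) \<in> h ` carrier L" if "i < n" for i using c[OF that] \<phi>(1) by auto
  then have "\<forall>i. \<exists>u t. i < n \<longrightarrow> u \<in> R \<and> t \<in> R - P \<and> g (c i) = to_fract u / to_fract t"
    unfolding img by blast
  then obtain u t where ut: "\<And>i. i < n \<Longrightarrow> u i \<in> R" "\<And>i. i < n \<Longrightarrow> t i \<in> R - P"
    "\<And>i. i < n \<Longrightarrow> g (c i) = to_fract (u i) / to_fract (t i)"
    by metis
  have "g x \<in> {h a / h s | a s. a \<in> carrier L \<and> s \<in> carrier L - {\<zero>}}" using x g(2) by blast
  then obtain y z where yz: "y \<in> carrier L" "z \<in> carrier L" "z \<noteq> \<zero>" "g x = h y / h z" by blast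
  obtain a1 s1 where a1: "a1 \<in> R" "s1 \<in> R" "s1 \<notin> P" "h y = to_fract a1 / to_fract s1"
    using obtain_frac[OF yz(1)] .
  obtain a2 s2 where a2: "a2 \<in> R" "s2 \<in> R" "s2 \<notin> P" "h z = to_fract a2 / to_fract s2"
    using obtain_frac[OF yz(2)] .
  have "h z \<noteq> 0" using yz(2,3) h_eq_iff[of z \<zero>] by auto
  then have "a2 \<noteq> 0" using a2(4) by auto
  define a b where "a = a1 * s2" and "b = a2 * s1"
  have ab: "a \<in> R" "b \<in> R" "b \<noteq> 0" "g x = to_fract a / to_fract b"
    using a1 a2 \<open>a2 \<noteq> 0\<close> by (auto simp: a_def b_def yz(4) R_mult)
  define T where "T = (\<Prod>i<n. t i)"
  define T' where "T' i = (\<Prod>j\<in>{..<n} - {i}. t j)" for i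
  have T: "T \<in> R" "T \<notin> P" using prod_notin_P[of "{..<n}" t] ut(2) by (auto simp: T_def)
  have T': "T' i \<in> R" for i unfolding T'_def by (rule R_prod) (use ut in auto)
  have TT: "T = t i * T' i" if "i < n" for i
    unfolding T_def T'_def using that by (subst prod.remove[of _ i]) auto
  have "g (x [^]\<^bsub>?K\<^esub> n \<oplus>\<^bsub>?K\<^esub> (\<Oplus>\<^bsub>?K\<^esub>i\<in>{..<n}. c i \<otimes>\<^bsub>?K\<^esub> x [^]\<^bsub>?K\<^esub> i)) =
      g x ^ n + (\<Sum>i<n. g (c i) * g x ^ i)"
    using x cK by (simp add: K.h_add K.h_pow K.h_finsum K.h_mult Pi_iff)
  then have e1: "g x ^ n + (\<Sum>i<n. g (c i) * g x ^ i) = 0" unfolding eq by simp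
  \<comment> \<open>Of the \<open>n\<close> factors \<open>T\<close> in the \<open>i\<close>-th
    term, one cancels \<open>t i\<close> and leaves \<open>T' i\<close>, \<open>i\<close> of them
    turn \<open>a ^ i\<close> into \<open>(T * a) ^ i\<close>, and \<open>n - Suc i\<close> remain
    in the coefficient.\<close>
  have e2: "(to_fract T * to_fract b) ^ n * (g x ^ n + (\<Sum>i<n. g (c i) * g x ^ i)) =
      to_fract ((T * a) ^ n + (\<Sum>i<n. (u i * T' i * T ^ (n - Suc i)) * (T * a) ^ i * b ^ (n - i)))"
  proof -
    have "(to_fract T * to_fract b) ^ n * g x ^ n = to_fract ((T * a) ^ n)"
      using ab(3,4) by (simp add: to_fract_power power_mult_distrib power_divide)
    moreover have "(to_fract T * to_fract b) ^ n * (g (c i) * g x ^ i) =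
        to_fract ((u i * T' i * T ^ (n - Suc i)) * (T * a) ^ i * b ^ (n - i))" if i: "i < n" for i
    proof -
      have n: "n = Suc (i + (n - Suc i))" using i by simp
      have ni: "n - i = Suc (n - Suc i)" using i by simp
      have nz: "to_fract (t i) \<noteq> 0" using ut(2)[OF i] by simp
      have b: "to_fract b ^ n * g x ^ i = to_fract a ^ i * to_fract b ^ (n - i)"
        using ab(3,4) i power_add[of "to_fract b" i "n - i"] by (simp add: power_divide)
      have t: "to_fract T ^ n * g (c i) = to_fract (u i * T' i) * (to_fract T ^ i * to_fract T ^ (n - Suc i))"
      proof -
        have "to_fract T ^ n = to_fract T * (to_fract T ^ i * to_fract T ^ (n - Suc i))"
          by (subst n) (simp only: power_Suc power_add)
        then show ?thesis using nz by (simp add: ut(3)[OF i] TT[OF i])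
      qed
      have "(to_fract T * to_fract b) ^ n * (g (c i) * g x ^ i) =
          (to_fract T ^ n * g (c i)) * (to_fract b ^ n * g x ^ i)"
        by (simp add: power_mult_distrib mult_ac)
      also have "\<dots> = to_fract ((u i * T' i * T ^ (n - Suc i)) * (T * a) ^ i * b ^ (n - i))"
        unfolding b t by (simp add: to_fract_power power_mult_distrib mult_ac)
      finally show ?thesis .
    qed
    ultimately show ?thesis
      by (simp add: distrib_left sum_distrib_left to_fract_sum del: to_fract_mult)
  qed
  have "(T * a) ^ n + (\<Sum>i<n. (u i * T' i * T ^ (n - Suc i)) * (T * a) ^ i * b ^ (n - i)) = 0"
    using e2[symmetric] unfolding e1 mult_zero_right to_fract_eq_0_iff .
  then have "b ^ k dvd b ^ n * (T * a) ^ k" for k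
    by (rule integral_imp_almost_integral)
  then obtain q where q: "q \<in> R" "T * a = b * q"
    using almost[of "T * a" b "b ^ n"] ab T R_mult by auto
  have "to_fract T * to_fract a = to_fract b * to_fract q"
    using q(2) by (metis to_fract_mult)
  then have "to_fract T * g x = to_fract q"
    using ab(3) by (simp add: ab(4))
  then have "g x = to_fract q / to_fract T"
    using den_nonzero[OF T(2)] by (simp add: eq_divide_eq mult.commute)
  moreover obtain l where l: "l \<in> carrier L" "h l = to_fract q / to_fract T"
    using obtain_elem[OF q(1) T] .
  ultimately have "g x = g (?\<phi> l)" using \<phi>(1) by simp
  then have "x = ?\<phi> l" using x \<phi>(2)[OF l(1)] K.h_eq_iff by blast
  then show "x \<in> ?\<phi> ` carrier L" using l(1) by blast
qed

section \<open>Passing from a ring embedded in a domain to all its localizations\<close>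

locale subring_emb = ring_emb Q g for Q (structure) and g :: "'a \<Rightarrow> 'b::idom"
begin

lemma subring_image: "subring_set (g ` carrier Q)"
proof
  show "0 \<in> g ` carrier Q" "1 \<in> g ` carrier Q"
    using h_zero h_one by (metis imageI zero_closed, metis imageI one_closed)
  show "a + b \<in> g ` carrier Q" "a * b \<in> g ` carrier Q" if "a \<in> g ` carrier Q" "b \<in> g ` carrier Q" for a b
    using that by (auto simp flip: h_add h_mult)
  show "- a \<in> g ` carrier Q" if "a \<in> g ` carrier Q" for a
    using that by (auto simp flip: h_uminus)
qed

lemma prime_image:
  assumes "primeideal P Q"
  shows "prime_in (g ` carrier Q) (g ` P)"
proof -
  interpret P: primeideal P Q by fact
  have sub: "P \<subseteq> carrier Q" using P.a_subset .
  have mem: "g x \<in> g ` P \<longleftrightarrow> x \<in> P" if "x \<in> carrier Q" for x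
    using that sub h_eq_iff by (auto simp: image_iff)
  have one: "\<one> \<notin> P" using P.one_imp_carrier P.I_notcarr by blast
  show ?thesis unfolding prime_in_def
  proof (intro conjI ballI impI)
    show "g ` P \<subseteq> g ` carrier Q" using sub by blast
    show "0 \<in> g ` P" using mem[of \<zero>] by simp
    show "1 \<notin> g ` P" using mem[of \<one>] one by simp
    show "a + b \<in> g ` P" if "a \<in> g ` P" "b \<in> g ` P" for a b
      using that sub by (auto simp flip: h_add simp: subset_iff)
    show "r * a \<in> g ` P" if "r \<in> g ` carrier Q" "a \<in> g ` P" for r a
      using that sub P.I_l_closed by (auto simp flip: h_mult simp: subset_iff)
    show "a \<in> g ` P \<or> b \<in> g ` P"
      if ab: "a \<in> g ` carrier Q" "b \<in> g ` carrier Q" "a * b \<in> g ` P" for a b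
    proof -
      from ab obtain x y where xy: "x \<in> carrier Q" "y \<in> carrier Q" "a = g x" "b = g y" by blast
      then have "g (x \<otimes> y) \<in> g ` P" using ab(3) by (simp add: h_mult)
      then have "x \<otimes> y \<in> P" using mem xy by simp
      then show ?thesis using P.I_prime xy by blast
    qed
  qed
qed

lemma localization_at_emb:
  assumes "primeideal P Q"
  obtains h where "local_emb (localization_at Q P) h (g ` carrier Q) (g ` P)"
proof -
  interpret P: primeideal P Q by fact
  have sub: "P \<subseteq> carrier Q" using P.a_subset .
  have one: "\<one> \<notin> P" using P.one_imp_carrier P.I_notcarr by blast
  have mem: "g x \<in> g ` P \<longleftrightarrow> x \<in> P" if "x \<in> carrier Q" for x
    using that sub h_eq_iff by (auto simp: image_iff)
  have emb: "ring_emb Q (\<lambda>x. to_fract (g x))"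
    by (rule ring_emb_comp[OF ring_emb_axioms]) (auto intro: injI)
  obtain h where h: "ring_emb (localization Q (carrier Q - P)) h"
    "h ` carrier (localization Q (carrier Q - P)) =
      {to_fract (g a) / to_fract (g s) | a s. a \<in> carrier Q \<and> s \<in> carrier Q - P}"
  proof (rule loc_props[OF emb, of "carrier Q - P"])
    show "x \<otimes> y \<in> carrier Q - P" if "x \<in> carrier Q - P" "y \<in> carrier Q - P" for x y
      using that P.I_prime by auto
  qed (use one that in auto)
  have "h ` carrier (localization_at Q P) = {to_fract a / to_fract s | a s.
      a \<in> g ` carrier Q \<and> s \<in> g ` carrier Q \<and> s \<notin> g ` P}"
    unfolding localization_at_def h(2)
  proof (rule Collect_cong)
    fix x
    show "(\<exists>a s. x = to_fract (g a) / to_fract (g s) \<and> a \<in> carrier Q \<and> s \<in> carrier Q - P) \<longleftrightarrow>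
      (\<exists>a s. x = to_fract a / to_fract s \<and> a \<in> g ` carrier Q \<and> s \<in> g ` carrier Q \<and> s \<notin> g ` P)"
      using mem by (auto; metis imageI)
  qed
  then have "local_emb (localization_at Q P) h (g ` carrier Q) (g ` P)"
    by (intro local_emb.intro local_emb_axioms.intro subring_image prime_image[OF assms])
      (use h(1) in \<open>simp_all add: localization_at_def\<close>)
  then show thesis using that by blast
qed

text \<open>The condition speaks of almost integral elements, with \<open>d\<close> and the
  divisibility taken in the ambient domain. It does not refer to a prime, so it serves all
  localizations at once.\<close>

theorem normal:
  assumes "\<And>a b d. a \<in> g ` carrier Q \<Longrightarrow> b \<in> g ` carrier Q \<Longrightarrow> b \<noteq> 0 \<Longrightarrow> d \<noteq> 0 \<Longrightarrow>
    (\<And>k. b ^ k dvd d * a ^ k) \<Longrightarrow> \<exists>q\<in>g ` carrier Q. a = b * q"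
  shows "normal_ring Q"
  unfolding normal_ring_def
proof (intro conjI allI impI is_cring)
  fix P assume "primeideal P Q"
  then obtain h where "local_emb (localization_at Q P) h (g ` carrier Q) (g ` P)"
    by (rule localization_at_emb)
  then show "integrally_closed_domain (localization_at Q P)"
    by (rule local_emb.integrally_closed) (rule assms)
qed

theorem cohen_macaulay:
  assumes fg: "\<And>I. I \<subseteq> g ` carrier Q \<Longrightarrow> 0 \<in> I \<Longrightarrow> (\<And>f g. f \<in> I \<Longrightarrow> g \<in> I \<Longrightarrow> f + g \<in> I) \<Longrightarrow>
    (\<And>r f. r \<in> g ` carrier Q \<Longrightarrow> f \<in> I \<Longrightarrow> r * f \<in> I) \<Longrightarrow>
    \<exists>G\<subseteq>I. finite G \<and> (\<forall>f\<in>I. \<exists>c. (\<forall>x\<in>G. c x \<in> g ` carrier Q) \<and> f = (\<Sum>x\<in>G. c x * x))"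
    and wit: "\<And>P. prime_in (g ` carrier Q) P \<Longrightarrow> \<exists>xs. cm_witness (g ` carrier Q) P xs"
  shows "cohen_macaulay_ring Q"
  unfolding cohen_macaulay_ring_def
proof (intro conjI allI impI is_cring)
  fix P assume P: "primeideal P Q"
  then obtain h where "local_emb (localization_at Q P) h (g ` carrier Q) (g ` P)"
    by (rule localization_at_emb)
  then interpret L: local_emb "localization_at Q P" h "g ` carrier Q" "g ` P" .
  obtain xs where "cm_witness (g ` carrier Q) (g ` P) xs" using wit[OF prime_image[OF P]] by blast
  moreover have "noetherian_ring (localization_at Q P)"
    by (rule L.noetherian) (rule fg)
  ultimately show "cohen_macaulay_local (localization_at Q P)"
    by (intro L.cohen_macaulay_local)
next
  show "noetherian_ring Q"
  proof (rule noetherian_ringI)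
    fix I assume I: "ideal I Q"
    interpret I: ideal I Q by fact
    have sub: "I \<subseteq> carrier Q" using I.a_subset .
    have "\<exists>G\<subseteq>g ` I. finite G \<and> (\<forall>f\<in>g ` I. \<exists>c. (\<forall>x\<in>G. c x \<in> g ` carrier Q) \<and> f = (\<Sum>x\<in>G. c x * x))"
    proof (rule fg)
      show "g ` I \<subseteq> g ` carrier Q" using sub by blast
      show "0 \<in> g ` I" using h_zero I.zero_closed by (metis imageI)
      show "a + b \<in> g ` I" if "a \<in> g ` I" "b \<in> g ` I" for a b
        using that sub by (auto simp flip: h_add simp: subset_iff)
      show "r * a \<in> g ` I" if "r \<in> g ` carrier Q" "a \<in> g ` I" for r a
        using that sub I.I_l_closed by (auto simp flip: h_mult simp: subset_iff)
    qed
    then obtain G where G: "G \<subseteq> g ` I" "finite G"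
      "\<forall>f\<in>g ` I. \<exists>c. (\<forall>x\<in>G. c x \<in> g ` carrier Q) \<and> f = (\<Sum>x\<in>G. c x * x)" by blast
    obtain A where A: "A \<subseteq> I" "finite A" "G = g ` A" using finite_subset_image[OF G(2,1)] by blast
    have Ac: "A \<subseteq> carrier Q" using A(1) sub by blast
    interpret J: ideal "Idl A" Q by (rule genideal_ideal[OF Ac])
    have "y \<in> Idl A" if y: "y \<in> I" for y
    proof -
      obtain c where c: "\<forall>x\<in>G. c x \<in> g ` carrier Q" "g y = (\<Sum>x\<in>G. c x * x)" using G(3) y by blast
      have "\<exists>z\<in>Idl A. g z = (\<Sum>x\<in>B. c x * x)" if "B \<subseteq> G" for B
        using finite_subset[OF that G(2)] that
      proof (induction B rule: finite_induct)
        case empty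
        show ?case using J.zero_closed by (intro bexI[of _ \<zero>]) auto
      next
        case (insert x B)
        then obtain z where z: "z \<in> Idl A" "g z = (\<Sum>x\<in>B. c x * x)" by auto
        obtain l where l: "l \<in> carrier Q" "c x = g l" using c(1) insert.prems by blast
        obtain a where a: "a \<in> A" "x = g a" using A(3) insert.prems by blast
        have "a \<in> Idl A" using genideal_self[OF Ac] a(1) by blast
        then have "l \<otimes> a \<oplus> z \<in> Idl A" using J.I_l_closed[of a l] l(1) z(1) by simp
        moreover have "g (l \<otimes> a \<oplus> z) = (\<Sum>x\<in>insert x B. c x * x)"
          using insert.hyps l a z Ac J.a_subset by (auto simp: h_add h_mult subset_iff)
        ultimately show ?case by blast
      qed
      then obtain z where "z \<in> Idl A" "g z = g y" using c(2) by auto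
      then show ?thesis using h_eq_iff[of z y] y sub J.a_subset by auto
    qed
    then have "I = Idl A" using genideal_minimal[OF I A(1)] by blast
    then show "\<exists>A\<subseteq>carrier Q. finite A \<and> I = Idl A" using Ac A(2) by blast
  qed
qed

end

section \<open>Rings that are free over a polynomial subring\<close>

text \<open>For \<open>Q = {0}\<close> this is algebraic independence over the coefficients, and for
  a prime of a subring it is that of the residue classes.\<close>

definition alg_indep_mod :: "'x set \<Rightarrow> ('x \<Rightarrow> ('y, 'k::comm_ring_1) mpoly) \<Rightarrow> ('y, 'k) mpoly set \<Rightarrow> bool"
  where "alg_indep_mod K y Q \<longleftrightarrow> (\<forall>f\<in>pv K. f \<noteq> 0 \<longrightarrow> psub y f \<notin> Q)"

lemma expand_diff [simp]: "expand j (f - g) = expand j f - expand j g"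
  by (simp add: expand_def)

lemma combsI:
  "(\<And>i. i < length xs \<Longrightarrow> c i \<in> R) \<Longrightarrow> x = (\<Sum>i<length xs. c i * xs ! i) \<Longrightarrow> x \<in> combs R xs"
  unfolding combs_def by blast

lemma combs_add: "(\<And>a b. a \<in> R \<Longrightarrow> b \<in> R \<Longrightarrow> a + b \<in> R) \<Longrightarrow> x \<in> combs R xs \<Longrightarrow> y \<in> combs R xs \<Longrightarrow> x + y \<in> combs R xs"
proof -
  assume R: "\<And>a b. a \<in> R \<Longrightarrow> b \<in> R \<Longrightarrow> a + b \<in> R" and "x \<in> combs R xs" "y \<in> combs R xs"
  then obtain c d where "\<And>i. i < length xs \<Longrightarrow> c i \<in> R" "x = (\<Sum>i<length xs. c i * xs ! i)"
    "\<And>i. i < length xs \<Longrightarrow> d i \<in> R" "y = (\<Sum>i<length xs. d i * xs ! i)"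
    unfolding combs_def by blast
  then show ?thesis unfolding combs_def
    by (auto simp: sum.distrib distrib_right intro!: R exI[of _ "\<lambda>i. c i + d i"])
qed

lemma combs_mult: "(\<And>a b. a \<in> R \<Longrightarrow> b \<in> R \<Longrightarrow> a * b \<in> R) \<Longrightarrow> r \<in> R \<Longrightarrow> x \<in> combs R xs \<Longrightarrow> r * x \<in> combs R xs"
proof -
  assume R: "\<And>a b. a \<in> R \<Longrightarrow> b \<in> R \<Longrightarrow> a * b \<in> R" "r \<in> R" and "x \<in> combs R xs"
  then obtain c where "\<And>i. i < length xs \<Longrightarrow> c i \<in> R" "x = (\<Sum>i<length xs. c i * xs ! i)"
    unfolding combs_def by blast
  then show ?thesis unfolding combs_def
    by (auto simp: sum_distrib_left mult.assoc intro!: R exI[of _ "\<lambda>i. r * c i"])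
qed

lemma expand_power_series:
  assumes "\<And>l. l \<le> n \<Longrightarrow> c l \<in> pv W" "t \<notin> W"
  shows "expand t (\<Sum>l\<le>n. c l * var t ^ l) = (\<Sum>l\<le>n. monom (c l) l)"
  unfolding expand_sum
proof (rule sum.cong[OF refl])
  fix l assume "l \<in> {..n}"
  then show "expand t (c l * var t ^ l) = monom (c l) l"
    using expand_const[OF assms(1) assms(2)] by (simp add: expand_var monom_altdef)
qed

text \<open>A polynomial whose leading coefficient in \<open>var t\<close> is \<open>c n\<close> becomes a nonzerodivisor modulo
  an ideal generated in the other variables once \<open>c n\<close> is inverted.\<close>

lemma lead_coeff_regular:
  fixes c :: "nat \<Rightarrow> ('x::linorder, 'k::field) mpoly"
  assumes c: "\<And>l. l \<le> n \<Longrightarrow> c l \<in> pv W" "t \<notin> W" "W \<subseteq> U" "t \<in> U" "c n \<noteq> 0"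
    and gs: "set gs \<subseteq> pv W" and z: "z \<in> pv U"
    and f: "(\<Sum>l\<le>n. c l * var t ^ l) * z \<in> combs (pv U) gs"
  shows "\<exists>N. c n ^ N * z \<in> combs (pv U) gs"
proof -
  let ?I = "combs (pv U) gs" and ?f = "\<Sum>l\<le>n. c l * var t ^ l"
  have I_add: "x \<in> ?I \<Longrightarrow> y \<in> ?I \<Longrightarrow> x + y \<in> ?I" for x y
    by (rule combs_add) (auto intro: pv_add)
  have I_mult: "r \<in> pv U \<Longrightarrow> x \<in> ?I \<Longrightarrow> r * x \<in> ?I" for r x
    by (rule combs_mult) (auto intro: pv_mult)
  \<comment> \<open>The generators do not involve \<open>var t\<close>, hence the ideal contains all
    coefficients of each of its elements.\<close>
  have I_coeff: "coeff (expand t x) l \<in> ?I" if x: "x \<in> ?I" for x l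
  proof -
    from x obtain a where a: "\<And>i. i < length gs \<Longrightarrow> a i \<in> pv U" "x = (\<Sum>i<length gs. a i * gs ! i)"
      unfolding combs_def by blast
    have "expand t (gs ! i) = [:gs ! i:]" if "i < length gs" for i
      using gs that by (intro expand_const[OF _ c(2)]) auto
    then have "coeff (expand t x) l = (\<Sum>i<length gs. coeff (expand t (a i)) l * gs ! i)"
      by (simp add: a(2) expand_sum coeff_sum mult.commute)
    moreover have "coeff (expand t (a i)) l \<in> pv U" if "i < length gs" for i
      using coeff_expand_pv[OF a(1)[OF that], of t l] by (rule pv_mono[rotated]) auto
    ultimately show ?thesis by (intro combsI)
  qed
  have cU: "c l \<in> pv U" if "l \<le> n" for l using c(1)[OF that] c(3) by (rule pv_mono[rotated])
  have fU: "?f \<in> pv U" by (intro pv_sum pv_mult pv_power pv_var c(4) cU) auto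
  have ef: "expand t ?f = (\<Sum>l\<le>n. monom (c l) l)" by (rule expand_power_series[OF c(1,2)])
  have cf: "coeff (expand t ?f) n = c n" unfolding ef by (simp add: coeff_sum)
  have df: "degree (expand t ?f) = n"
  proof (rule antisym)
    show "degree (expand t ?f) \<le> n" unfolding ef
      by (intro degree_sum_le order_trans[OF degree_monom_le]) auto
    show "n \<le> degree (expand t ?f)" using cf c(5) by (intro le_degree) simp
  qed
  show ?thesis using z f
  proof (induction "degree (expand t z)" arbitrary: z rule: less_induct)
    case less
    let ?m = "degree (expand t z)"
    define a where "a = coeff (expand t z) ?m"
    \<comment> \<open>\<open>z'\<close> is \<open>c n * z\<close> without its leading term. That
      term is in the ideal, since \<open>c n * a\<close> is the top coefficient of
      \<open>?f * z\<close>; so \<open>z'\<close> satisfies the same hypothesis with smaller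
      degree.\<close>
    define z' where "z' = c n * z - c n * a * var t ^ ?m"
    have aW: "a \<in> pv (U - {t})" unfolding a_def by (rule coeff_expand_pv[OF less.prems(1)])
    have aU: "a \<in> pv U" by (rule pv_mono[OF _ aW]) auto
    have "coeff (expand t (?f * z)) (n + ?m) = c n * a"
      using coeff_mult_degree_sum[of "expand t ?f" "expand t z"] unfolding df cf a_def expand_mult .
    then have ca: "c n * a \<in> ?I" using I_coeff[OF less.prems(2), of "n + ?m"] by simp
    have cav: "c n * a * var t ^ ?m \<in> ?I"
      using I_mult[OF pv_power[OF pv_var[OF c(4)]] ca, of ?m] by (simp add: mult.commute)
    have z'U: "z' \<in> pv U"
      unfolding z'_def by (intro pv_diff pv_mult pv_power pv_var c(4) aU less.prems(1) cU) auto
    have "c n * (?f * z) + (- ?f) * (c n * a * var t ^ ?m) \<in> ?I"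
      by (intro I_add I_mult less.prems(2) cav cU pv_uminus fU) auto
    then have fz': "?f * z' \<in> ?I" by (simp add: z'_def algebra_simps)
    have "expand t (c n) = [:c n:]" "expand t a = [:a:]"
      using expand_const[OF c(1) c(2)] expand_const[OF aW] by auto
    then have ez': "expand t z' = smult (c n) (expand t z) - monom (c n * a) ?m"
      by (simp add: z'_def expand_var monom_altdef mult.commute)
    have "coeff (expand t z') ?m = 0" by (simp add: ez' a_def)
    moreover have "degree (expand t z') \<le> ?m"
      unfolding ez' by (intro degree_diff_le degree_smult_le degree_monom_le)
    ultimately have "expand t z' = 0 \<or> degree (expand t z') < ?m"
      by (intro eq_zero_or_degree_less)
    then have "\<exists>N. c n ^ N * z' \<in> ?I"
    proof
      assume "expand t z' = 0"
      then have "z' = 0" by simp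
      then show ?thesis using fz' by auto
    next
      assume "degree (expand t z') < ?m"
      then show ?thesis using less.hyps z'U fz' by blast
    qed
    then obtain N where N: "c n ^ N * z' \<in> ?I" by blast
    have "c n ^ N * z' + c n ^ N * (c n * a * var t ^ ?m) \<in> ?I"
      by (intro I_add I_mult N cav pv_power cU) auto
    then have "c n ^ Suc N * z \<in> ?I" by (simp add: z'_def algebra_simps)
    then show ?case by blast
  qed
qed

text \<open>Descending from \<open>Q'\<close> to a smaller prime gains the element \<open>u\<close>.
  In a relation modulo \<open>Q\<close>, the constant coefficient in \<open>t\<close> is a relation
  modulo \<open>Q'\<close> and therefore zero; then a factor \<open>u\<close> splits off and is
  cancelled because \<open>u\<close> is outside the prime \<open>Q\<close>, which lowers the
  degree.\<close>

lemma alg_indep_mod_extend: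
  fixes y :: "nat \<Rightarrow> ('y::linorder, 'k::field) mpoly"
  assumes R: "subring_set R" "\<And>c. cst c \<in> R" and y: "\<And>i. i \<in> K \<Longrightarrow> y i \<in> R"
    and Q: "prime_in R Q" "prime_in R Q'" "Q \<subseteq> Q'" and u: "u \<in> Q'" "u \<notin> Q"
    and ind: "alg_indep_mod K y Q'" and t: "t \<notin> K"
  shows "alg_indep_mod (insert t K) (y(t := u)) Q"
proof -
  interpret subring_set R by fact
  have uR: "u \<in> R" using u Q(2) unfolding prime_in_def by blast
  have inR: "psub \<sigma> f \<in> R" if "f \<in> pv A" "\<And>i. i \<in> A \<Longrightarrow> \<sigma> i \<in> R" for \<sigma> and f :: "(nat, 'k) mpoly" and A
    using that by (intro ev_in_subsemiring) (auto intro: R_add R_mult R(2))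
  have Q'_add: "a \<in> Q' \<Longrightarrow> b \<in> Q' \<Longrightarrow> a + b \<in> Q'" and Q'_mult: "r \<in> R \<Longrightarrow> a \<in> Q' \<Longrightarrow> r * a \<in> Q'"
    and Q'_0: "0 \<in> Q'" for a b r
    using Q(2) unfolding prime_in_def by blast+
  have "psub (y(t := u)) f \<notin> Q" if "f \<in> pv (insert t K)" "f \<noteq> 0" for f
    using that
  proof (induction "degree (expand t f)" arbitrary: f rule: less_induct)
    case less
    let ?c = "\<lambda>l. coeff (expand t f) l" and ?n = "degree (expand t f)"
    have cK: "?c l \<in> pv K" for l
      using coeff_expand_pv[OF less.prems(1), of t l] t by simp
    show ?case
    proof
      assume fQ: "psub (y(t := u)) f \<in> Q"
      show False
      proof (cases "?c 0 = 0")
        case False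
        have "psub (y(t := u)) f = psub y (?c 0) + u * (\<Sum>l<?n. psub y (?c (Suc l)) * u ^ l)"
          unfolding cst_hom.ev_upd
          by (subst sum.atMost_shift) (simp add: sum_distrib_left mult_ac)
        then have "psub y (?c 0) = psub (y(t := u)) f + (- (\<Sum>l<?n. psub y (?c (Suc l)) * u ^ l)) * u"
          by (simp add: algebra_simps)
        moreover have "\<dots> \<in> Q'"
          using fQ Q(3) by (intro Q'_add Q'_mult u R_uminus R_sum R_mult R_power uR inR[OF cK y]) auto
        ultimately show False using ind cK False unfolding alg_indep_mod_def by auto
      next
        case True
        define f' where "f' = (\<Sum>l<?n. ?c (Suc l) * var t ^ l)"
        have "f = ?c 0 + var t * f'"
          by (subst mpoly_eq_sum_coeff_expand[of f t], subst sum.atMost_shift)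
            (simp add: f'_def sum_distrib_left mult_ac)
        then have ff: "f = var t * f'" using True by simp
        then have f'0: "f' \<noteq> 0" using less.prems(2) by auto
        have f'K: "f' \<in> pv (insert t K)"
          unfolding f'_def by (intro pv_sum pv_mult pv_power pv_var pv_mono[OF _ cK]) auto
        have "?n = Suc (degree (expand t f'))"
          using f'0 by (subst ff) (simp add: expand_var degree_mult_eq del: mult_pCons_left)
        then have "psub (y(t := u)) f' \<notin> Q" using less.hyps f'K f'0 by simp
        moreover have "u * psub (y(t := u)) f' \<in> Q" using fQ by (subst (asm) ff) simp
        moreover have "psub (y(t := u)) f' \<in> R" by (rule inR[OF f'K]) (use y uR in auto)
        ultimately show False using Q(1) u(2) uR unfolding prime_in_def by blast
      qed
    qed
  qed
  then show ?thesis unfolding alg_indep_mod_def by blast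
qed

text \<open>\<open>R\<close> is free with basis \<open>E\<close> over the polynomial ring in the
  parameters \<theta>. The assumption \<open>trdeg\<close> bounds the transcendence degree of
  \<open>R\<close>, which \<open>prime_chain_bound\<close> turns into a bound for heights.\<close>

locale free_over_parameters = subring_set R for R :: "('y::linorder, 'k::field) mpoly set" +
  fixes \<theta> :: "nat \<Rightarrow> ('y, 'k) mpoly" and d :: nat and E :: "('y, 'k) mpoly set"
  assumes cst_R: "cst k \<in> R"
    and \<theta>_R: "j < d \<Longrightarrow> \<theta> j \<in> R"
    and fin_E: "finite E" and E_R: "E \<subseteq> R"
    and spanning: "x \<in> R \<Longrightarrow> \<exists>c. (\<forall>e\<in>E. c e \<in> pv {..<d}) \<and> x = (\<Sum>e\<in>E. psub \<theta> (c e) * e)"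
    and independent: "(\<And>e. e \<in> E \<Longrightarrow> c e \<in> pv {..<d}) \<Longrightarrow> (\<Sum>e\<in>E. psub \<theta> (c e) * e) = 0 \<Longrightarrow> e \<in> E \<Longrightarrow> c e = 0"
    and trdeg: "finite K \<Longrightarrow> (\<And>i. i \<in> K \<Longrightarrow> y i \<in> R) \<Longrightarrow> alg_indep_mod (K::nat set) y {0} \<Longrightarrow> card K \<le> d"
begin

lemma psub_R:
  fixes f :: "(nat, 'k) mpoly"
  assumes "f \<in> pv A" "\<And>i. i \<in> A \<Longrightarrow> y i \<in> R"
  shows "psub y f \<in> R"
  using assms by (intro ev_in_subsemiring) (auto intro: R_add R_mult cst_R)

lemma \<theta>_psub_R: "f \<in> pv {..<d} \<Longrightarrow> psub \<theta> f \<in> R"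
  by (rule psub_R) (auto simp: \<theta>_R)

text \<open>A family independent modulo \<open>P\<close> is independent modulo the top of the chain.
  Each step down adds one member by \<open>alg_indep_mod_extend\<close>, and at the bottom the
  family is independent modulo zero, where \<open>trdeg\<close> limits its size.\<close>

lemma prime_chain_bound:
  assumes J: "finite J" "\<And>i. i \<in> J \<Longrightarrow> y i \<in> R" "alg_indep_mod (J :: nat set) y P"
    and Q: "\<And>i. i \<le> n \<Longrightarrow> prime_in R (Q i)" "\<And>i. i < n \<Longrightarrow> Q i \<subset> Q (Suc i)" "Q n \<subseteq> P"
  shows "n + card J \<le> d"
proof -
  have "\<exists>K y. finite (K::nat set) \<and> card K = k + card J \<and> (\<forall>i\<in>K. y i \<in> R) \<and> alg_indep_mod K y (Q (n - k))"
    if "k \<le> n" for k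
    using that
  proof (induction k)
    case 0
    have "alg_indep_mod J y (Q n)" using J(3) Q(3) unfolding alg_indep_mod_def by blast
    then show ?case using J by (intro exI[of _ J] exI[of _ y]) auto
  next
    case (Suc k)
    then obtain K y where K: "finite (K::nat set)" "card K = k + card J" "\<forall>i\<in>K. y i \<in> R"
      "alg_indep_mod K y (Q (n - k))" by auto
    define i where "i = n - Suc k"
    have i: "n - k = Suc i" "i < n" using Suc.prems by (auto simp: i_def)
    obtain u where u: "u \<in> Q (Suc i)" "u \<notin> Q i" using Q(2)[OF i(2)] by blast
    obtain t where t: "t \<notin> K" using ex_new_if_finite[OF infinite_UNIV_nat K(1)] by blast
    have "alg_indep_mod (insert t K) (y(t := u)) (Q i)"
    proof (rule alg_indep_mod_extend[OF subring_set_axioms cst_R _ _ _ _ u _ t])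
      show "y j \<in> R" if "j \<in> K" for j using K(3) that by blast
      show "prime_in R (Q i)" "prime_in R (Q (Suc i))" using Q(1) i(2) by simp_all
      show "Q i \<subseteq> Q (Suc i)" using Q(2)[OF i(2)] by blast
      show "alg_indep_mod K y (Q (Suc i))" using K(4) i(1) by simp
    qed
    moreover have "u \<in> R" using u(1) Q(1)[of "Suc i"] i(2) unfolding prime_in_def by auto
    then have "\<forall>j\<in>insert t K. (y(t := u)) j \<in> R" using K(3) t by auto
    moreover have "finite (insert t K)" "card (insert t K) = Suc k + card J" using K t by auto
    ultimately show ?case unfolding i_def by blast
  qed
  from this[of n] obtain K y where K: "finite (K::nat set)" "card K = n + card J" "\<forall>i\<in>K. y i \<in> R"
    "alg_indep_mod K y (Q 0)" by auto
  have "0 \<in> Q 0" using Q(1)[of 0] unfolding prime_in_def by auto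
  then have "alg_indep_mod K y {0}" using K(4) unfolding alg_indep_mod_def by auto
  then show ?thesis using trdeg[of K y] K by auto
qed

end

section \<open>The triangular regular sequence at a prime\<close>

locale free_over_parameters_prime = free_over_parameters +
  fixes P
  assumes prime_P: "prime_in R P"
begin

lemma P_sub: "a \<in> P \<Longrightarrow> a \<in> R" and P_0: "0 \<in> P" and P_add: "a \<in> P \<Longrightarrow> b \<in> P \<Longrightarrow> a + b \<in> P"
  and P_lmult: "r \<in> R \<Longrightarrow> a \<in> P \<Longrightarrow> r * a \<in> P" and P_1: "1 \<notin> P"
  and P_prime: "a \<in> R \<Longrightarrow> b \<in> R \<Longrightarrow> a * b \<in> P \<Longrightarrow> a \<in> P \<or> b \<in> P"
  using prime_P unfolding prime_in_def by auto

definition p where "p = {f \<in> pv {..<d}. psub \<theta> f \<in> P}"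

lemma p_not_mult: "f \<in> pv {..<d} - p \<Longrightarrow> g \<in> pv {..<d} - p \<Longrightarrow> f * g \<in> pv {..<d} - p"
  using P_prime[of "psub \<theta> f" "psub \<theta> g"] by (auto simp: p_def \<theta>_psub_R pv_mult)

lemma p_not_one: "1 \<in> pv {..<d} - p"
  using P_1 by (simp add: p_def)

lemma p_not_power: "f \<in> pv {..<d} - p \<Longrightarrow> f ^ n \<in> pv {..<d} - p"
  by (induction n) (simp_all only: power_0 power_Suc p_not_one p_not_mult)

lemma p_not_prod: "(\<And>a. a \<in> A \<Longrightarrow> f a \<in> pv {..<d} - p) \<Longrightarrow> prod f A \<in> pv {..<d} - p"
proof (induction A rule: infinite_finite_induct)
  case (insert a A)
  then have "prod f A \<in> pv {..<d} - p" "f a \<in> pv {..<d} - p" by blast+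
  then show ?case unfolding prod.insert[OF insert.hyps] by (intro p_not_mult)
qed (use p_not_one in auto)

text \<open>\<open>var j\<close> is algebraic modulo \<open>p\<close> over the earlier variables.
  Keeping the leading coefficient outside \<open>p\<close> prevents the relation from degenerating
  and excludes \<open>n = 0\<close>.\<close>

definition alg :: "nat \<Rightarrow> bool" where
  "alg j \<longleftrightarrow> (\<exists>n c. (\<forall>l\<le>n. c l \<in> pv {..<j}) \<and> c n \<notin> p \<and> (\<Sum>l\<le>n. c l * var j ^ l) \<in> p)"

text \<open>A greedy transcendence basis modulo \<open>p\<close>: scanning the variables in order,
  those not algebraic over their predecessors are kept.\<close>

definition J where "J = {j. j < d \<and> \<not> alg j}"

text \<open>By induction the leading coefficient of \<open>f\<close> in its last variable is outside
  \<open>p\<close>. If \<open>f\<close> were in \<open>p\<close>, it would be a relation making that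
  variable algebraic.\<close>

lemma J_independent:
  "t \<le> d \<Longrightarrow> f \<in> pv (J \<inter> {..<t}) \<Longrightarrow> f \<noteq> 0 \<Longrightarrow> f \<notin> p"
proof (induction t arbitrary: f)
  case 0
  then obtain c where c: "f = cst c" "c \<noteq> 0" using pv_empty by fastforce
  show ?case
  proof
    assume "f \<in> p"
    then have "cst (1 / c) * cst c \<in> P" by (intro P_lmult cst_R) (simp add: c(1) p_def)
    then show False using P_1 c(2) by (simp flip: cst_mult)
  qed
next
  case (Suc t)
  show ?case
  proof (cases "t \<in> J")
    case False
    then have "J \<inter> {..<Suc t} = J \<inter> {..<t}" by (auto simp: less_Suc_eq)
    then show ?thesis using Suc by simp
  next
    case True
    let ?c = "\<lambda>l. coeff (expand t f) l"
    have "J \<inter> {..<Suc t} - {t} = J \<inter> {..<t}" by auto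
    then have cJ: "?c l \<in> pv (J \<inter> {..<t})" for l
      using coeff_expand_pv[OF Suc.prems(2), of t l] by simp
    then have ct: "?c l \<in> pv {..<t}" for l using pv_mono[of "J \<inter> {..<t}" "{..<t}"] by blast
    have "lead_coeff (expand t f) \<noteq> 0" using Suc.prems(3) by simp
    then have lc: "lead_coeff (expand t f) \<notin> p" using Suc.IH[OF _ cJ] Suc.prems(1) by simp
    show ?thesis
    proof
      assume "f \<in> p"
      then have "(\<Sum>l\<le>degree (expand t f). ?c l * var t ^ l) \<in> p"
        using mpoly_eq_sum_coeff_expand[of f t] by (rule subst[rotated])
      then have "alg t" unfolding alg_def using ct lc by blast
      then show False using True by (simp add: J_def)
    qed
  qed
qed

text \<open>Each variable outside \<open>J\<close> contributes its algebraic relation, which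
  involves no later variables. Its leading coefficient is outside \<open>p\<close>, so
  \<open>lead_coeff_regular\<close> makes it a nonzerodivisor modulo the earlier relations up to a
  multiplier outside \<open>p\<close>.\<close>

lemma triangular_sequence:
  "t \<le> d \<Longrightarrow> \<exists>gs. set gs \<subseteq> p \<inter> pv {..<t} \<and> length gs + card (J \<inter> {..<t}) = t \<and>
    (\<forall>i<length gs. \<forall>z\<in>pv {..<d}. gs ! i * z \<in> combs (pv {..<d}) (take i gs) \<longrightarrow>
      (\<exists>c\<in>pv {..<d} - p. c * z \<in> combs (pv {..<d}) (take i gs)))"
proof (induction t)
  case 0
  show ?case by (intro exI[of _ "[]"]) auto
next
  case (Suc t)
  then obtain gs where gs: "set gs \<subseteq> p \<inter> pv {..<t}" "length gs + card (J \<inter> {..<t}) = t"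
    and reg: "\<And>i z. i < length gs \<Longrightarrow> z \<in> pv {..<d} \<Longrightarrow> gs ! i * z \<in> combs (pv {..<d}) (take i gs) \<Longrightarrow>
      \<exists>c\<in>pv {..<d} - p. c * z \<in> combs (pv {..<d}) (take i gs)"
    by auto
  have gs': "set gs \<subseteq> p \<inter> pv {..<Suc t}"
    using gs(1) pv_mono[of "{..<t}" "{..<Suc t}"] by auto
  show ?case
  proof (cases "t \<in> J")
    case True
    then have "J \<inter> {..<Suc t} = insert t (J \<inter> {..<t})" by (auto simp: less_Suc_eq)
    then have "length gs + card (J \<inter> {..<Suc t}) = Suc t" using gs(2) by simp
    then show ?thesis using gs' reg by (intro exI[of _ gs]) auto
  next
    case False
    then have "J \<inter> {..<Suc t} = J \<inter> {..<t}" by (auto simp: less_Suc_eq)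
    then have card: "Suc (length gs) + card (J \<inter> {..<Suc t}) = Suc t" using gs(2) by simp
    have "alg t" using False Suc.prems by (simp add: J_def)
    then obtain n c where c: "\<And>l. l \<le> n \<Longrightarrow> c l \<in> pv {..<t}" "c n \<notin> p" "(\<Sum>l\<le>n. c l * var t ^ l) \<in> p"
      unfolding alg_def by blast
    define f where "f = (\<Sum>l\<le>n. c l * var t ^ l)"
    have c': "c l \<in> pv A" if "l \<le> n" "{..<t} \<subseteq> A" for l A using c(1)[OF that(1)] pv_mono[OF that(2)] by blast
    have f: "f \<in> p \<inter> pv {..<Suc t}"
      using c(3) unfolding f_def by (intro IntI pv_sum pv_mult pv_power pv_var c') auto
    have cn: "c n \<in> pv {..<d} - p" using c' c(2) Suc.prems by auto
    have c0: "c n \<noteq> 0" using c(2) P_0 by (auto simp: p_def)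
    have last: "\<exists>c\<in>pv {..<d} - p. c * z \<in> combs (pv {..<d}) gs"
      if "z \<in> pv {..<d}" "f * z \<in> combs (pv {..<d}) gs" for z
    proof -
      have "\<exists>N. c n ^ N * z \<in> combs (pv {..<d}) gs"
        by (rule lead_coeff_regular[of n c "{..<t}" t]) (use c c0 gs(1) that Suc.prems in \<open>auto simp: f_def\<close>)
      then show ?thesis using p_not_power[OF cn] by blast
    qed
    show ?thesis
    proof (intro exI[of _ "gs @ [f]"] conjI allI impI ballI)
      show "set (gs @ [f]) \<subseteq> p \<inter> pv {..<Suc t}" using gs' f by auto
      show "length (gs @ [f]) + card (J \<inter> {..<Suc t}) = Suc t" using card by simp
      fix i z assume i: "i < length (gs @ [f])" and z: "z \<in> pv {..<d}"
        "(gs @ [f]) ! i * z \<in> combs (pv {..<d}) (take i (gs @ [f]))"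
      show "\<exists>c\<in>pv {..<d} - p. c * z \<in> combs (pv {..<d}) (take i (gs @ [f]))"
      proof (cases "i < length gs")
        case True
        then show ?thesis using reg[of i z] z by (simp add: nth_append)
      next
        case False
        then have "i = length gs" using i by simp
        then show ?thesis using last z by simp
      qed
    qed
  qed
qed

text \<open>By freeness, an equation over \<open>R\<close> splits into one equation over the
  polynomial subring for each element of \<open>E\<close>. Regularity there is applied coordinate by
  coordinate.\<close>

lemma regular_transfer:
  assumes gs: "set gs \<subseteq> pv {..<d}" and i: "i < length gs" and z: "z \<in> R"
    and reg: "\<And>z. z \<in> pv {..<d} \<Longrightarrow> gs ! i * z \<in> combs (pv {..<d}) (take i gs) \<Longrightarrow>
      \<exists>c\<in>pv {..<d} - p. c * z \<in> combs (pv {..<d}) (take i gs)"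
    and mem: "psub \<theta> (gs ! i) * z \<in> combs R (map (psub \<theta>) (take i gs))"
  shows "\<exists>c\<in>R - P. c * z \<in> combs R (map (psub \<theta>) (take i gs))"
proof -
  have len: "length (take i gs) = i" using i by simp
  have gsD: "gs ! l \<in> pv {..<d}" if "l \<le> i" for l using gs i that by auto
  obtain zc where zc: "\<And>e. e \<in> E \<Longrightarrow> zc e \<in> pv {..<d}" "z = (\<Sum>e\<in>E. psub \<theta> (zc e) * e)"
    using spanning[OF z] by blast
  obtain r where r: "\<And>l. l < i \<Longrightarrow> r l \<in> R"
    "psub \<theta> (gs ! i) * z = (\<Sum>l<i. r l * psub \<theta> (gs ! l))"
    using mem i unfolding combs_def by auto
  have "\<forall>l. \<exists>c. l < i \<longrightarrow> (\<forall>e\<in>E. c e \<in> pv {..<d}) \<and> r l = (\<Sum>e\<in>E. psub \<theta> (c e) * e)"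
    using spanning r(1) by blast
  from choice[OF this] obtain rc where
    "\<forall>l. l < i \<longrightarrow> (\<forall>e\<in>E. rc l e \<in> pv {..<d}) \<and> r l = (\<Sum>e\<in>E. psub \<theta> (rc l e) * e)" by (elim exE)
  then have rc: "\<And>l e. l < i \<Longrightarrow> e \<in> E \<Longrightarrow> rc l e \<in> pv {..<d}"
    "\<And>l. l < i \<Longrightarrow> r l = (\<Sum>e\<in>E. psub \<theta> (rc l e) * e)" by simp_all
  have "(\<Sum>l<i. r l * psub \<theta> (gs ! l)) = (\<Sum>l<i. \<Sum>e\<in>E. psub \<theta> (rc l e * gs ! l) * e)"
    by (rule sum.cong) (simp_all add: rc(2) sum_distrib_right sum_distrib_left mult_ac)
  also have "\<dots> = (\<Sum>e\<in>E. psub \<theta> (\<Sum>l<i. rc l e * gs ! l) * e)"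
    by (subst sum.swap) (simp add: cst_hom.ev_sum sum_distrib_right)
  finally have "(\<Sum>e\<in>E. psub \<theta> (gs ! i * zc e) * e) = (\<Sum>e\<in>E. psub \<theta> (\<Sum>l<i. rc l e * gs ! l) * e)"
    using r(2) unfolding zc(2) by (simp add: sum_distrib_left mult_ac)
  then have sum0: "(\<Sum>e\<in>E. psub \<theta> (gs ! i * zc e - (\<Sum>l<i. rc l e * gs ! l)) * e) = 0"
    by (simp add: left_diff_distrib sum_subtractf)
  have eq: "gs ! i * zc e = (\<Sum>l<i. rc l e * gs ! l)" if e: "e \<in> E" for e
  proof -
    have "gs ! i * zc e - (\<Sum>l<i. rc l e * gs ! l) = 0"
    proof (rule independent[OF _ sum0 e])
      show "gs ! i * zc e - (\<Sum>l<i. rc l e * gs ! l) \<in> pv {..<d}" if "e \<in> E" for e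
        using zc(1)[OF that] rc(1)[OF _ that] gsD by (intro pv_diff pv_mult pv_sum) auto
    qed
    then show ?thesis by simp
  qed
  have c_ex: "\<exists>c\<in>pv {..<d} - p. c * zc e \<in> combs (pv {..<d}) (take i gs)" if "e \<in> E" for e
    using that i by (intro reg zc(1) combsI[of _ "\<lambda>l. rc l e"]) (auto simp: eq rc(1))
  have "\<forall>e\<in>E. \<exists>cb. fst cb \<in> pv {..<d} - p \<and> (\<forall>l<i. snd cb l \<in> pv {..<d}) \<and>
      fst cb * zc e = (\<Sum>l<i. snd cb l * gs ! l)"
  proof
    fix e assume "e \<in> E"
    then obtain c where c: "c \<in> pv {..<d} - p" "c * zc e \<in> combs (pv {..<d}) (take i gs)"
      using c_ex by blast
    then obtain b where "\<And>l. l < i \<Longrightarrow> b l \<in> pv {..<d}" "c * zc e = (\<Sum>l<i. b l * take i gs ! l)"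
      unfolding combs_def len by blast
    then show "\<exists>cb. fst cb \<in> pv {..<d} - p \<and> (\<forall>l<i. snd cb l \<in> pv {..<d}) \<and>
        fst cb * zc e = (\<Sum>l<i. snd cb l * gs ! l)"
      using c by (intro exI[of _ "(c, b)"]) simp
  qed
  from bchoice[OF this] obtain Cb where "\<forall>e\<in>E. fst (Cb e) \<in> pv {..<d} - p \<and>
      (\<forall>l<i. snd (Cb e) l \<in> pv {..<d}) \<and> fst (Cb e) * zc e = (\<Sum>l<i. snd (Cb e) l * gs ! l)"
    by (elim exE)
  moreover define C b where "C = (\<lambda>e. fst (Cb e))" and "b = (\<lambda>e. snd (Cb e))"
  ultimately have C: "\<And>e. e \<in> E \<Longrightarrow> C e \<in> pv {..<d} - p"
    and b: "\<And>e l. e \<in> E \<Longrightarrow> l < i \<Longrightarrow> b e l \<in> pv {..<d}"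
      "\<And>e. e \<in> E \<Longrightarrow> C e * zc e = (\<Sum>l<i. b e l * gs ! l)"
    by simp_all
  \<comment> \<open>Every coordinate has its own multiplier; their product works for all coordinates
    and stays outside the prime.\<close>
  define T where "T = prod C E"
  define T' where "T' e = prod C (E - {e})" for e
  have T: "T \<in> pv {..<d} - p" unfolding T_def by (rule p_not_prod) (rule C)
  have T': "T' e \<in> pv {..<d}" for e unfolding T'_def by (rule pv_prod) (use C in auto)
  have TT: "T = T' e * C e" if "e \<in> E" for e
    unfolding T_def T'_def using that fin_E by (simp add: prod.remove mult.commute)
  have "psub \<theta> T * z = (\<Sum>e\<in>E. psub \<theta> (T * zc e) * e)"
    by (simp add: zc(2) sum_distrib_left mult_ac)
  also have "\<dots> = (\<Sum>e\<in>E. \<Sum>l<i. psub \<theta> (T' e * b e l) * e * psub \<theta> (gs ! l))"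
  proof (rule sum.cong[OF refl])
    fix e assume e: "e \<in> E"
    have "T * zc e = (\<Sum>l<i. T' e * b e l * gs ! l)"
      using b(2)[OF e] by (simp add: TT[OF e] mult.assoc sum_distrib_left)
    then show "psub \<theta> (T * zc e) * e = (\<Sum>l<i. psub \<theta> (T' e * b e l) * e * psub \<theta> (gs ! l))"
      by (simp add: cst_hom.ev_sum sum_distrib_right sum_distrib_left mult_ac)
  qed
  also have "\<dots> = (\<Sum>l<i. (\<Sum>e\<in>E. psub \<theta> (T' e * b e l) * e) * psub \<theta> (gs ! l))"
    by (subst sum.swap) (simp add: sum_distrib_right)
  finally have "psub \<theta> T * z \<in> combs R (map (psub \<theta>) (take i gs))"
    using i E_R b(1) T'
    by (intro combsI[of _ "\<lambda>l. \<Sum>e\<in>E. psub \<theta> (T' e * b e l) * e"] R_sum R_mult[of "psub \<theta> _"] \<theta>_psub_R pv_mult)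
      auto
  moreover have "psub \<theta> T \<in> R - P" using T by (auto simp: p_def \<theta>_psub_R)
  ultimately show ?thesis by blast
qed

text \<open>The sequence has length \<open>d - card J\<close>. The parameters indexed by
  \<open>J\<close> are independent modulo \<open>P\<close>, so \<open>prime_chain_bound\<close>
  limits chains inside \<open>P\<close> to exactly this length.\<close>

lemma witness: "\<exists>xs. cm_witness R P xs"
proof -
  have "J \<inter> {..<d} = J" by (auto simp: J_def)
  then obtain gs where gs: "set gs \<subseteq> p" "length gs + card J = d"
    and reg: "\<And>i z. i < length gs \<Longrightarrow> z \<in> pv {..<d} \<Longrightarrow> gs ! i * z \<in> combs (pv {..<d}) (take i gs) \<Longrightarrow>
      \<exists>c\<in>pv {..<d} - p. c * z \<in> combs (pv {..<d}) (take i gs)"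
    using triangular_sequence[of d] by auto
  have gsD: "set gs \<subseteq> pv {..<d}" using gs(1) by (auto simp: p_def)
  have "cm_witness R P (map (psub \<theta>) gs)"
    unfolding cm_witness_def
  proof (intro conjI allI impI ballI)
    show "set (map (psub \<theta>) gs) \<subseteq> P" using gs(1) by (auto simp: p_def)
  next
    fix i z assume "i < length (map (psub \<theta>) gs)" "z \<in> R"
      "map (psub \<theta>) gs ! i * z \<in> combs R (take i (map (psub \<theta>) gs))"
    then show "\<exists>c\<in>R - P. c * z \<in> combs R (take i (map (psub \<theta>) gs))"
      using regular_transfer[OF gsD _ _ reg] by (simp add: take_map)
  next
    fix n Q
    assume Q: "(\<forall>i\<le>n. prime_in R (Q i)) \<and> (\<forall>i<n. Q i \<subset> Q (Suc i)) \<and> Q n \<subseteq> P"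
    have "n + card J \<le> d"
    proof (rule prime_chain_bound[where Q = Q and y = \<theta>])
      show "finite J" by (simp add: J_def)
      show "\<theta> i \<in> R" if "i \<in> J" for i using that by (simp add: J_def \<theta>_R)
      have "J \<subseteq> {..<d}" by (auto simp: J_def)
      then show "alg_indep_mod J \<theta> P"
        unfolding alg_indep_mod_def using J_independent[of d] \<open>J \<inter> {..<d} = J\<close> pv_mono[of J "{..<d}"]
        by (auto simp: p_def)
    qed (use Q in auto)
    then show "n \<le> length (map (psub \<theta>) gs)" using gs(2) by simp
  qed
  then show ?thesis by blast
qed

end

section \<open>Dimension counts\<close>

interpretation mpv: vector_space "\<lambda>c (f :: ('x, 'k::field) mpoly). cst c * f"
  by unfold_locales (simp_all add: cst_add cst_mult algebra_simps)

lemma cst_mult_single_1: "cst c * single m 1 = single m (c :: 'k::comm_ring_1)"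
  by (simp add: cst_mult_single)

lemma independent_monomials:
  assumes "finite A"
  shows "mpv.independent ((\<lambda>m. single m (1::'k::field)) ` A :: ('x, 'k) mpoly set)"
proof
  let ?f = "\<lambda>m. single m (1::'k) :: ('x, 'k) mpoly"
  have inj: "inj_on ?f A"
    by (rule inj_onI) (metis lookup_single_eq lookup_single_not_eq zero_neq_one)
  assume "mpv.dependent (?f ` A)"
  then obtain u m where u: "m \<in> A" "u (?f m) \<noteq> 0" "(\<Sum>v\<in>?f ` A. cst (u v) * v) = 0"
    unfolding mpv.dependent_finite[OF finite_imageI[OF assms]] by blast
  have "0 = (\<Sum>n\<in>A. single n (u (?f n)))"
    using u(3) by (simp add: sum.reindex[OF inj] cst_mult_single_1)
  then have "0 = lookup (\<Sum>n\<in>A. single n (u (?f n))) m" by simp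
  also have "\<dots> = (\<Sum>n\<in>A. if n = m then u (?f n) else 0)"
    unfolding lookup_sum by (rule sum.cong) (auto simp: lookup_single when_def)
  also have "\<dots> = u (?f m)" using assms u(1) by simp
  finally show False using u(2) by simp
qed

lemma card_monomials: "card ((\<lambda>m. single m (1::'k::field)) ` A :: ('x, 'k) mpoly set) = card A"
  by (rule card_image, rule inj_onI) (metis lookup_single_eq lookup_single_not_eq zero_neq_one)

lemma mpoly_in_span_monomials:
  assumes "keys f \<subseteq> A"
  shows "f \<in> mpv.span ((\<lambda>m. single m 1) ` A)"
proof -
  have "(\<Sum>m\<in>keys f. cst (lookup f m) * single m 1) \<in> mpv.span ((\<lambda>m. single m 1) ` A)"
    using assms by (intro mpv.span_sum mpv.span_scale mpv.span_base) auto
  then show ?thesis by (simp add: cst_mult_single_1 mpoly_sum_monomials)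
qed

text \<open>If some member depended on the others, fewer than \<open>card B\<close> elements would
  span the independent set \<open>B\<close>.\<close>

lemma family_independent:
  fixes v :: "'i \<Rightarrow> ('x, 'k::field) mpoly"
  assumes fin: "finite I" and B: "mpv.independent B" "B \<subseteq> mpv.span (v ` I)" "card I \<le> card B"
    and sum: "(\<Sum>i\<in>I. cst (c i) * v i) = 0" and i: "i \<in> I"
  shows "c i = 0"
proof -
  have le: "card B \<le> card (v ` I)"
    using mpv.independent_span_bound[OF finite_imageI[OF fin] B(1,2)] by simp
  then have eq: "card (v ` I) = card I" using B(3) card_image_le[OF fin, of v] by simp
  \<comment> \<open>Equal cardinalities also exclude repetitions, so the indexed family may be
    treated as a set of vectors.\<close>
  then have inj: "inj_on v I" by (rule eq_card_imp_inj_on[OF fin])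
  have indep: "mpv.independent (v ` I)"
  proof
    assume "mpv.dependent (v ` I)"
    then obtain x where x: "x \<in> v ` I" "x \<in> mpv.span (v ` I - {x})"
      unfolding mpv.dependent_def by blast
    have "mpv.span (v ` I) \<subseteq> mpv.span (v ` I - {x})"
    proof (rule mpv.span_minimal)
      show "v ` I \<subseteq> mpv.span (v ` I - {x})"
      proof
        fix y assume "y \<in> v ` I"
        then show "y \<in> mpv.span (v ` I - {x})"
          using x(2) by (cases "y = x") (auto intro: mpv.span_base)
      qed
    qed simp
    then have "card B \<le> card (v ` I - {x})"
      using mpv.independent_span_bound[of "v ` I - {x}" B] fin B by auto
    moreover have "card (v ` I - {x}) < card (v ` I)"
      using fin x(1) by (intro psubset_card_mono) auto
    ultimately show False using eq B(3) by simp
  qed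
  have "(\<Sum>x\<in>v ` I. cst (c (the_inv_into I v x)) * x) = 0"
    using sum by (simp add: sum.reindex[OF inj] the_inv_into_f_f[OF inj])
  then have "c (the_inv_into I v (v i)) = 0"
    by (rule mpv.independentD[OF indep finite_imageI[OF fin] subset_refl _ imageI[OF i],
          where u = "\<lambda>x. c (the_inv_into I v x)"])
  then show ?thesis using the_inv_into_f_f[OF inj i] by simp
qed

section \<open>The transcendence degree of the invariants by counting monomials\<close>

definition expo :: "'x set \<Rightarrow> ('x \<Rightarrow> nat) \<Rightarrow> 'x \<Rightarrow>\<^sub>0 nat"
  where "expo A g = (\<Sum>i\<in>A. single i (g i))"

lemma lookup_expo: "finite A \<Longrightarrow> lookup (expo A g) j = (if j \<in> A then g j else 0)"
  unfolding expo_def lookup_sum by (auto simp: lookup_single when_def)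

lemma keys_expo: "finite A \<Longrightarrow> keys (expo A g) \<subseteq> A"
  by (auto simp: in_keys_iff lookup_expo split: if_splits)

lemma power_growth:
  assumes "\<And>t::nat. (t + 1) ^ a \<le> (C * t + 1) ^ n"
  shows "a \<le> n"
proof (rule ccontr)
  assume "\<not> a \<le> n"
  \<comment> \<open>With this value \<open>((C + 1) * (t + 1)) ^ n\<close> equals
    \<open>(t + 1) ^ n * t\<close>, just below \<open>(t + 1) ^ Suc n\<close>.\<close>
  define t where "t = (C + 1) ^ n"
  have "(t + 1) ^ n * (t + 1) \<le> (t + 1) ^ a"
    using \<open>\<not> a \<le> n\<close> power_increasing[of "Suc n" a "t + 1"] by (simp add: mult.commute)
  also have "\<dots> \<le> (C * t + 1) ^ n" by (rule assms)
  also have "\<dots> \<le> ((C + 1) * (t + 1)) ^ n" by (rule power_mono) (auto simp: algebra_simps)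
  also have "\<dots> = (t + 1) ^ n * t" unfolding power_mult_distrib t_def by (simp only: mult.commute)
  finally show False by simp
qed

definition box :: "'x set \<Rightarrow> ('x \<Rightarrow> int) \<Rightarrow> nat \<Rightarrow> ('x \<Rightarrow>\<^sub>0 nat) set"
  where "box V w D = {m. keys m \<subseteq> V \<and> wt w m = 0 \<and> (\<forall>v. lookup m v \<le> D)}"

text \<open>Since \<open>w v0\<close> is nonzero, weight zero determines the exponent of
  \<open>v0\<close> from the others. This lost degree of freedom is the reason for
  \<open>card V - 1\<close>.\<close>

lemma box_restrict:
  assumes "finite V" "v0 \<in> V" "w v0 \<noteq> (0::int)"
  shows "finite (box V w D) \<and> card (box V w D) \<le> (D + 1) ^ (card V - 1)"
proof -
  let ?W = "V - {v0}" and ?r = "\<lambda>m. restrict (lookup m) (V - {v0})"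
  have inj: "inj_on ?r (box V w D)"
  proof (rule inj_onI)
    fix m n assume m: "m \<in> box V w D" and n: "n \<in> box V w D" and eq: "?r m = ?r n"
    have e: "lookup m v = lookup n v" if "v \<in> ?W" for v
      using fun_cong[OF eq, of v] that by simp
    have wt: "wt w l = w v0 * int (lookup l v0) + (\<Sum>v\<in>?W. w v * int (lookup l v))"
      if "keys l \<subseteq> V" for l
      using that by (simp add: wt_superset[OF assms(1)] sum.remove[OF assms(1,2)])
    have "w v0 * int (lookup m v0) + (\<Sum>v\<in>?W. w v * int (lookup m v)) =
        w v0 * int (lookup n v0) + (\<Sum>v\<in>?W. w v * int (lookup n v))"
      using m n wt[of m] wt[of n] by (simp add: box_def)
    moreover have "(\<Sum>v\<in>?W. w v * int (lookup m v)) = (\<Sum>v\<in>?W. w v * int (lookup n v))"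
      by (rule sum.cong) (simp_all add: e)
    ultimately have e0: "lookup m v0 = lookup n v0" using assms(3) by simp
    show "m = n"
    proof (rule poly_mapping_eqI)
      fix v
      have "v \<notin> V \<Longrightarrow> v \<notin> keys m \<and> v \<notin> keys n" using m n by (auto simp: box_def)
      then show "lookup m v = lookup n v" using e e0 by (cases "v \<in> V"; cases "v = v0") (auto simp: in_keys_iff)
    qed
  qed
  have sub: "?r ` box V w D \<subseteq> ?W \<rightarrow>\<^sub>E {..D}"
    by (intro image_subsetI) (simp add: box_def restrict_PiE_iff)
  have fin: "finite (?W \<rightarrow>\<^sub>E {..D})" using assms(1) by (intro finite_PiE) auto
  have "card (box V w D) \<le> card (?W \<rightarrow>\<^sub>E {..D})"
    using card_inj_on_le[OF inj sub fin] .
  also have "\<dots> = (D + 1) ^ card ?W" using assms(1) by (simp add: card_PiE)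
  finally show ?thesis
    using inj_on_finite[OF inj sub fin] assms(1,2) by simp
qed

lemma box_add: "m \<in> box V w a \<Longrightarrow> n \<in> box V w b \<Longrightarrow> m + n \<in> box V w (a + b)"
  using Poly_Mapping.keys_add[of m n] by (auto simp: box_def wt_add lookup_add add_mono)

text \<open>The \<open>(t + 1) ^ card K\<close> monomials in the \<open>y i\<close> with exponents
  up to \<open>t\<close> are linearly independent, and they lie in a span of weight-zero monomials
  whose exponents grow linearly in \<open>t\<close>. Comparing growth rates compares the
  exponents.\<close>

lemma trdeg_invs:
  fixes y :: "'i \<Rightarrow> ('x::linorder, 'k::field) mpoly"
  assumes V: "finite V" "v0 \<in> V" "w v0 \<noteq> (0::int)"
    and K: "finite K" "\<And>i. i \<in> K \<Longrightarrow> y i \<in> invs V w" "alg_indep_mod K y {0}"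
  shows "card K \<le> card V - 1"
proof -
  let ?Sp = "\<lambda>D. {f :: ('x, 'k) mpoly. keys f \<subseteq> box V w D}"
  \<comment> \<open>A crude common bound for all exponents occurring in the
    \<open>y i\<close>.\<close>
  define \<delta> where "\<delta> = (\<Sum>i\<in>K. \<Sum>m\<in>keys (y i). \<Sum>v\<in>V. lookup m v)"
  have y: "y i \<in> ?Sp \<delta>" if i: "i \<in> K" for i
  proof -
    have "lookup m v \<le> \<delta>" if m: "m \<in> keys (y i)" for m v
    proof (cases "v \<in> V")
      case True
      have "lookup m v \<le> (\<Sum>v\<in>V. lookup m v)" using V(1) True by (intro member_le_sum) auto
      also have "\<dots> \<le> (\<Sum>m\<in>keys (y i). \<Sum>v\<in>V. lookup m v)" using m by (intro member_le_sum) auto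
      also have "\<dots> \<le> \<delta>" unfolding \<delta>_def using i K(1)
        by (intro member_le_sum[of i K "\<lambda>i. \<Sum>m\<in>keys (y i). \<Sum>v\<in>V. lookup m v"]) auto
      finally show ?thesis .
    next
      case False
      then have "v \<notin> keys m" using m K(2)[OF i] by (auto simp: invs_def)
      then show ?thesis by (simp add: in_keys_iff)
    qed
    then show ?thesis using K(2)[OF i] by (auto simp: invs_def box_def)
  qed
  have Sp_mult: "f * g \<in> ?Sp (a + b)" if "f \<in> ?Sp a" "g \<in> ?Sp b" for f g a b
  proof (intro CollectI subsetI)
    fix m assume "m \<in> keys (f * g)"
    then obtain m1 m2 where "m = m1 + m2" "m1 \<in> keys f" "m2 \<in> keys g"
      using keys_mult[of f g] by blast
    then show "m \<in> box V w (a + b)" using that by (auto intro!: box_add)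
  qed
  have Sp_1: "1 \<in> ?Sp 0" by (auto simp: box_def wt_def)
  have Sp_pow: "f ^ n \<in> ?Sp (n * a)" if "f \<in> ?Sp a" for f a n
    by (induction n) (use Sp_1 Sp_mult[OF that] in \<open>auto simp del: mem_Collect_eq\<close>)
  have Sp_prod: "prod h A \<in> ?Sp (\<Sum>i\<in>A. a i)" if "finite A" "\<And>i. i \<in> A \<Longrightarrow> h i \<in> ?Sp (a i)" for h A and a :: "'i \<Rightarrow> nat"
    using that by (induction A rule: finite_induct) (use Sp_1 Sp_mult in \<open>auto simp del: mem_Collect_eq\<close>)
  have bound: "(t + 1) ^ card K \<le> (\<delta> * card K * t + 1) ^ (card V - 1)" for t
  proof -
    let ?G = "K \<rightarrow>\<^sub>E {..t}" and ?D = "\<delta> * card K * t"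
    let ?M = "expo K ` ?G" and ?me = "mon_eval y"
    have finG: "finite ?G" using K(1) by (intro finite_PiE) auto
    have cardM: "card ?M = (t + 1) ^ card K"
    proof -
      have "inj_on (expo K) ?G"
      proof (rule inj_onI)
        fix g h assume g: "g \<in> ?G" and h: "h \<in> ?G" and eq: "expo K g = expo K h"
        have "g i = h i" if "i \<in> K" for i
          using arg_cong[OF eq, of "\<lambda>m. lookup m i"] that K(1) by (simp add: lookup_expo)
        then show "g = h" using g h by (intro PiE_ext) auto
      qed
      then show ?thesis using K(1) by (simp add: card_image card_PiE)
    qed
    have meval: "?me m \<in> ?Sp ?D" if "m \<in> ?M" for m
    proof -
      obtain g where g: "g \<in> ?G" "m = expo K g" using \<open>m \<in> ?M\<close> by blast
      have "?me m = (\<Prod>i\<in>K. y i ^ g i)"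
        using K(1) g by (simp add: mon_eval_superset[OF K(1) keys_expo[OF K(1)]] lookup_expo)
      then have "?me m \<in> ?Sp (\<Sum>i\<in>K. g i * \<delta>)"
        using Sp_prod[OF K(1), of "\<lambda>i. y i ^ g i" "\<lambda>i. g i * \<delta>"] Sp_pow[OF y] by simp
      moreover have "(\<Sum>i\<in>K. g i * \<delta>) \<le> (\<Sum>i\<in>K. t * \<delta>)"
        using g(1) by (intro sum_mono mult_right_mono) auto
      then have "(\<Sum>i\<in>K. g i * \<delta>) \<le> ?D" by (simp add: mult_ac)
      moreover have "a \<le> b \<Longrightarrow> box V w a \<subseteq> box V w b" for a b
        unfolding box_def using order_trans by blast
      ultimately show ?thesis by blast
    qed
    have indep0: "u = (\<lambda>_. 0)" if "(\<Sum>m\<in>?M. cst (u m) * ?me m) = 0" "\<And>m. m \<notin> ?M \<Longrightarrow> u m = 0" for u :: "('i \<Rightarrow>\<^sub>0 nat) \<Rightarrow> 'k"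
    proof -
      let ?f = "\<Sum>m\<in>?M. single m (u m)"
      have "psub y ?f = 0" using that(1) by (simp add: cst_hom.ev_sum)
      moreover have "?f \<in> pv K"
        using keys_expo[OF K(1)] by (intro pv_sum pv_single) blast
      ultimately have "?f = 0" using K(3) unfolding alg_indep_mod_def by blast
      then have "lookup ?f m = 0" for m by simp
      moreover have "lookup ?f m = u m" if "m \<in> ?M" for m
      proof -
        have "lookup ?f m = (\<Sum>n\<in>?M. if n = m then u n else 0)"
          unfolding lookup_sum by (rule sum.cong) (auto simp: lookup_single when_def)
        then show ?thesis using that finG by simp
      qed
      ultimately show ?thesis using that(2) by (intro ext) metis
    qed
    have inj: "inj_on ?me ?M"
    proof (rule inj_onI)
      fix m n assume mn: "m \<in> ?M" "n \<in> ?M" "?me m = ?me n"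
      show "m = n"
      proof (rule ccontr)
        assume ne: "m \<noteq> n"
        define u where "u l = (if l = m then 1 else if l = n then -1 else 0 :: 'k)" for l
        have "(\<Sum>l\<in>?M. cst (u l) * ?me l) = (\<Sum>l\<in>{m, n}. cst (u l) * ?me l)"
          using mn finG by (intro sum.mono_neutral_right) (auto simp: u_def)
        also have "\<dots> = 0" using ne mn(3) by (simp add: u_def cst_uminus)
        finally have "u = (\<lambda>_. 0)" using mn by (intro indep0) (auto simp: u_def)
        then have "u m = 0" by simp
        then show False by (simp add: u_def)
      qed
    qed
    have ind: "mpv.independent (?me ` ?M)"
    proof
      assume "mpv.dependent (?me ` ?M)"
      then obtain u m where u: "m \<in> ?M" "u (?me m) \<noteq> 0" "(\<Sum>v\<in>?me ` ?M. cst (u v) * v) = 0"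
        using finG unfolding mpv.dependent_finite[OF finite_imageI[OF finite_imageI[OF finG]]] by blast
      have "(\<Sum>m\<in>?M. cst (u (?me m)) * ?me m) = 0"
        using u(3) by (simp add: sum.reindex[OF inj])
      then have "(\<Sum>m\<in>?M. cst (if m \<in> ?M then u (?me m) else 0) * ?me m) = 0" by simp
      then have "(\<lambda>m. if m \<in> ?M then u (?me m) else 0) = (\<lambda>_. 0)" by (rule indep0) simp
      then show False using u(1,2) by (metis (mono_tags))
    qed
    have fb: "finite (box V w ?D)" "card (box V w ?D) \<le> (?D + 1) ^ (card V - 1)"
      using box_restrict[of V v0 w, OF V] by auto
    have "?me ` ?M \<subseteq> mpv.span ((\<lambda>m. single m 1) ` box V w ?D)"
    proof (rule image_subsetI)
      fix m assume "m \<in> ?M"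
      then have "keys (?me m) \<subseteq> box V w ?D" using meval by blast
      then show "?me m \<in> mpv.span ((\<lambda>m. single m 1) ` box V w ?D)"
        by (rule mpoly_in_span_monomials)
    qed
    then have "card (?me ` ?M) \<le> card ((\<lambda>m. single m 1 :: ('x, 'k) mpoly) ` box V w ?D)"
      using mpv.independent_span_bound[OF finite_imageI[OF fb(1)] ind] by blast
    then show ?thesis using fb(2) by (simp add: card_image[OF inj] cardM card_monomials)
  qed
  show ?thesis by (rule power_growth[OF bound])
qed

section \<open>Counting monomials by total degree\<close>

definition tdeg :: "('x \<Rightarrow>\<^sub>0 nat) \<Rightarrow> nat"
  where "tdeg m = (\<Sum>i\<in>keys m. lookup m i)"

lemma tdeg_superset: "finite A \<Longrightarrow> keys m \<subseteq> A \<Longrightarrow> tdeg m = (\<Sum>i\<in>A. lookup m i)"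
  unfolding tdeg_def by (rule sum.mono_neutral_left) (auto simp: in_keys_iff)

lemma tdeg_add: "tdeg (m + n) = tdeg m + tdeg n"
proof -
  let ?A = "keys m \<union> keys n"
  have "keys (m + n) \<subseteq> ?A" by (rule Poly_Mapping.keys_add)
  then show ?thesis
    by (simp add: tdeg_superset[of ?A] lookup_add sum.distrib)
qed

lemma tdeg_0 [simp]: "tdeg 0 = 0" and tdeg_single [simp]: "tdeg (single i n) = n"
  by (auto simp: tdeg_def)

definition exps_le :: "'x set \<Rightarrow> nat \<Rightarrow> ('x \<Rightarrow>\<^sub>0 nat) set"
  where "exps_le A n = {m. keys m \<subseteq> A \<and> tdeg m \<le> n}"

definition exps_eq :: "'x set \<Rightarrow> nat \<Rightarrow> ('x \<Rightarrow>\<^sub>0 nat) set"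
  where "exps_eq A n = {m. keys m \<subseteq> A \<and> tdeg m = n}"

lemma lookup_update_0: "lookup (m - single a (lookup m a)) i = (if i = a then 0 else lookup m i)"
  for m :: "'x \<Rightarrow>\<^sub>0 nat"
  by (simp add: lookup_minus lookup_single when_def)

lemma split_off:
  fixes m :: "'x \<Rightarrow>\<^sub>0 nat"
  assumes "keys m \<subseteq> insert a A" "a \<notin> A"
  shows "single a (lookup m a) + (m - single a (lookup m a)) = m" "keys (m - single a (lookup m a)) \<subseteq> A"
proof -
  show "single a (lookup m a) + (m - single a (lookup m a)) = m"
    by (rule poly_mapping_eqI) (simp add: lookup_add lookup_update_0 lookup_single when_def)
  show "keys (m - single a (lookup m a)) \<subseteq> A"
  proof
    fix x assume "x \<in> keys (m - single a (lookup m a))"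
    then have "x \<noteq> a" "x \<in> keys m" by (auto simp: in_keys_iff lookup_update_0 split: if_splits)
    then show "x \<in> A" using assms(1) by blast
  qed
qed

text \<open>Homogenization: the additional variable \<open>a\<close> fills the degree up to exactly
  \<open>n\<close>.\<close>

lemma exps_eq_bij:
  assumes "a \<notin> A"
  shows "bij_betw (\<lambda>m. single a (n - tdeg m) + m) (exps_le A n) (exps_eq (insert a A) n)"
proof (rule bij_betw_byWitness[where f' = "\<lambda>m. m - single a (lookup m a)"])
  have a0: "lookup m a = 0" if "keys m \<subseteq> A" for m :: "'a \<Rightarrow>\<^sub>0 nat" using that assms by (auto simp: in_keys_iff)
  show "\<forall>m\<in>exps_le A n. single a (n - tdeg m) + m - single a (lookup (single a (n - tdeg m) + m) a) = m"
    using a0 by (auto simp: exps_le_def lookup_add lookup_minus lookup_single when_def intro!: poly_mapping_eqI)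
  show "\<forall>m\<in>exps_eq (insert a A) n. single a (n - tdeg (m - single a (lookup m a))) + (m - single a (lookup m a)) = m"
  proof
    fix m assume m: "m \<in> exps_eq (insert a A) n"
    note s = split_off[of m a A, OF _ assms]
    have "tdeg m = lookup m a + tdeg (m - single a (lookup m a))"
      using arg_cong[OF s(1), of tdeg] m by (simp add: exps_eq_def tdeg_add)
    moreover have "tdeg m = n" using m by (simp add: exps_eq_def)
    ultimately have "n - tdeg (m - single a (lookup m a)) = lookup m a" by linarith
    then show "single a (n - tdeg (m - single a (lookup m a))) + (m - single a (lookup m a)) = m"
      using m s(1) by (simp add: exps_eq_def)
  qed
  show "(\<lambda>m. single a (n - tdeg m) + m) ` exps_le A n \<subseteq> exps_eq (insert a A) n"
    using Poly_Mapping.keys_add by (fastforce simp: exps_le_def exps_eq_def tdeg_add split: if_splits)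
  show "(\<lambda>m. m - single a (lookup m a)) ` exps_eq (insert a A) n \<subseteq> exps_le A n"
  proof (intro image_subsetI)
    fix m assume m: "m \<in> exps_eq (insert a A) n"
    note s = split_off[of m a A, OF _ assms]
    have "tdeg m = lookup m a + tdeg (m - single a (lookup m a))"
      using arg_cong[OF s(1), of tdeg] m by (simp add: exps_eq_def tdeg_add)
    then show "m - single a (lookup m a) \<in> exps_le A n"
      using m s(2) by (simp add: exps_eq_def exps_le_def)
  qed
qed

text \<open>Splitting by exact degree and removing one variable with \<open>exps_eq_bij\<close>
  leaves a rising sum of binomial coefficients.\<close>

lemma exps_le_card:
  assumes "finite A"
  shows "finite (exps_le A n) \<and> card (exps_le A n) = (n + card A) choose card A"
  using assms
proof (induction A arbitrary: n rule: finite_induct)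
  case empty
  have "exps_le {} n = {0 :: 'a \<Rightarrow>\<^sub>0 nat}"
    by (auto simp: exps_le_def poly_mapping_eq_iff in_keys_iff fun_eq_iff)
  then show ?case by simp
next
  case (insert a A)
  have eq: "exps_le (insert a A) n = (\<Union>k\<le>n. exps_eq (insert a A) k)"
    by (auto simp: exps_le_def exps_eq_def)
  have c: "finite (exps_eq (insert a A) k)" "card (exps_eq (insert a A) k) = (k + card A) choose card A" for k
    using bij_betw_finite[OF exps_eq_bij[OF insert.hyps(2), of k]]
      bij_betw_same_card[OF exps_eq_bij[OF insert.hyps(2), of k]] insert.IH[of k] by auto
  have "card (exps_le (insert a A) n) = (\<Sum>k\<le>n. (k + card A) choose card A)"
    unfolding eq using c by (subst card_UN_disjoint) (auto simp: exps_eq_def)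
  also have "\<dots> = (n + Suc (card A)) choose Suc (card A)"
    using choose_rising_sum(1)[of "card A" n] by (simp add: add.commute)
  finally show ?case using insert.hyps c unfolding eq by auto
qed

lemma exps_eq_card:
  assumes "finite A"
  shows "finite (exps_eq A n)" "card A = Suc k \<Longrightarrow> card (exps_eq A n) = (n + k) choose k"
proof -
  show "finite (exps_eq A n)"
    using exps_le_card[OF assms, of n] by (auto simp: exps_le_def exps_eq_def elim: rev_finite_subset)
  assume k: "card A = Suc k"
  then obtain a B where "A = insert a B" "a \<notin> B" "card B = k" "finite B"
    using card_Suc_eq_finite by metis
  then show "card (exps_eq A n) = (n + k) choose k"
    using bij_betw_same_card[OF exps_eq_bij, of a B n] exps_le_card[of B n] by auto
qed

section \<open>Graded freeness\<close>

definition free_basis :: "('y, 'k::field) mpoly set \<Rightarrow> (nat \<Rightarrow> ('y, 'k) mpoly) \<Rightarrow> nat \<Rightarrow> ('y, 'k) mpoly set \<Rightarrow> bool"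
  where "free_basis R \<theta> d E \<longleftrightarrow> finite E \<and> E \<subseteq> R \<and> (\<forall>j<d. \<theta> j \<in> R) \<and>
    (\<forall>x\<in>R. \<exists>c. (\<forall>e\<in>E. c e \<in> pv {..<d}) \<and> x = (\<Sum>e\<in>E. psub \<theta> (c e) * e)) \<and>
    (\<forall>c. (\<forall>e\<in>E. c e \<in> pv {..<d}) \<longrightarrow> (\<Sum>e\<in>E. psub \<theta> (c e) * e) = 0 \<longrightarrow> (\<forall>e\<in>E. c e = 0))"

text \<open>The common end of all three cases: it remains to identify the coordinate ring with the
  invariants of suitable weights and to give a free basis. The number of parameters is
  \<open>card V - 1\<close>, the bound of \<open>trdeg_invs\<close>.\<close>

lemma variety_from_free_basis:
  fixes \<tau> :: "'s \<Rightarrow> (nat, 'k::field) mpoly" and \<theta> :: "nat \<Rightarrow> (nat, 'k) mpoly"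
  assumes var: "parametrized_variety S V \<tau> Z" and img: "psub \<tau> ` pv S = invs V w"
    and V: "v0 \<in> V" "w v0 \<noteq> (0::int)"
    and free: "free_basis (invs V w) \<theta> (card V - 1) E"
  shows "irreducible_variety S Z \<and> normal_variety S Z \<and> cohen_macaulay_variety S Z"
proof (intro conjI)
  interpret parametrized_variety S V \<tau> Z by (rule var)
  show "irreducible_variety S Z" by (rule irreducible)
  obtain g where g': "ring_emb (coordinate_ring S Z) g" "g ` carrier (coordinate_ring S Z) = psub \<tau> ` pv S"
    by (rule coordinate_ring_emb)
  note g = g'(1) g'(2)[unfolded img]
  interpret Q: subring_emb "coordinate_ring S Z" g
    by (rule subring_emb.intro[OF g(1)])
  show "normal_variety S Z"
    unfolding normal_variety_def
    by (rule Q.normal) (unfold g(2), rule invs_almost_integral[OF fin])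
  show "cohen_macaulay_variety S Z"
    unfolding cohen_macaulay_variety_def
  proof (rule Q.cohen_macaulay)
    fix I :: "(nat, 'k) mpoly set"
    assume "I \<subseteq> g ` carrier (coordinate_ring S Z)" "0 \<in> I" "\<And>f g. f \<in> I \<Longrightarrow> g \<in> I \<Longrightarrow> f + g \<in> I"
      "\<And>r f. r \<in> g ` carrier (coordinate_ring S Z) \<Longrightarrow> f \<in> I \<Longrightarrow> r * f \<in> I"
    then show "\<exists>G\<subseteq>I. finite G \<and> (\<forall>f\<in>I. \<exists>c. (\<forall>x\<in>G. c x \<in> g ` carrier (coordinate_ring S Z)) \<and> f = (\<Sum>x\<in>G. c x * x))"
      unfolding g(2) by (intro invs_ideal_finitely_generated[OF fin]) auto
  next
    fix P assume P: "prime_in (g ` carrier (coordinate_ring S Z)) P"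
    have sub: "subring_set (invs V w :: (nat, 'k) mpoly set)"
      by standard (auto intro: invs_add invs_mult invs_uminus)
    have "free_over_parameters_prime (invs V w) \<theta> (card V - 1) E P"
    proof (intro free_over_parameters_prime.intro free_over_parameters.intro sub
        free_over_parameters_axioms.intro free_over_parameters_prime_axioms.intro)
      show "prime_in (invs V w) P" using P unfolding g(2) .
      show "\<exists>c. (\<forall>e\<in>E. c e \<in> pv {..<card V - 1}) \<and> x = (\<Sum>e\<in>E. psub \<theta> (c e) * e)"
        if "x \<in> invs V w" for x using free that unfolding free_basis_def by blast
      show "c e = 0" if "\<And>e. e \<in> E \<Longrightarrow> c e \<in> pv {..<card V - 1}"
        "(\<Sum>e\<in>E. psub \<theta> (c e) * e) = 0" "e \<in> E" for c e
        using free that unfolding free_basis_def by blast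
      show "card K \<le> card V - 1" if "finite K" "\<And>i. i \<in> K \<Longrightarrow> y i \<in> invs V w" "alg_indep_mod K y {0}"
        for K :: "nat set" and y :: "nat \<Rightarrow> (nat, 'k) mpoly"
        using trdeg_invs[of V v0 w K y] fin V that by blast
    qed (use free in \<open>auto simp: free_basis_def\<close>)
    then show "\<exists>xs. cm_witness (g ` carrier (coordinate_ring S Z)) P xs"
      unfolding g(2) by (rule free_over_parameters_prime.witness)
  qed
qed

text \<open>A filtration of the module generated by \<open>E\<close>: a parameter counts
  \<open>1\<close> and a basis element \<open>e\<close> counts \<open>dg e\<close>. Tracking degrees
  while spanning makes a finite dimension count possible in each step.\<close>

definition span_le ::
  "(nat \<Rightarrow> ('y, 'k::field) mpoly) \<Rightarrow> nat \<Rightarrow> ('y, 'k) mpoly set \<Rightarrow> (('y, 'k) mpoly \<Rightarrow> nat) \<Rightarrow> nat \<Rightarrow> ('y, 'k) mpoly set"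
  where "span_le \<theta> d E dg k =
    mpv.span {mon_eval \<theta> \<mu> * e | \<mu> e. e \<in> E \<and> keys \<mu> \<subseteq> {..<d} \<and> tdeg \<mu> + dg e \<le> k}"

lemma span_le_zero [simp]: "0 \<in> span_le \<theta> d E dg k"
  and span_le_add: "f \<in> span_le \<theta> d E dg k \<Longrightarrow> g \<in> span_le \<theta> d E dg k \<Longrightarrow> f + g \<in> span_le \<theta> d E dg k"
  and span_le_diff: "f \<in> span_le \<theta> d E dg k \<Longrightarrow> g \<in> span_le \<theta> d E dg k \<Longrightarrow> f - g \<in> span_le \<theta> d E dg k"
  and span_le_uminus: "f \<in> span_le \<theta> d E dg k \<Longrightarrow> - f \<in> span_le \<theta> d E dg k"
  and span_le_scale: "f \<in> span_le \<theta> d E dg k \<Longrightarrow> cst c * f \<in> span_le \<theta> d E dg k"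
  unfolding span_le_def by (auto intro: mpv.span_add mpv.span_diff mpv.span_neg mpv.span_scale mpv.span_zero)

lemma span_le_mono: "k \<le> l \<Longrightarrow> span_le \<theta> d E dg k \<subseteq> span_le \<theta> d E dg l"
  unfolding span_le_def by (intro mpv.span_mono) fastforce

lemma span_le_base: "e \<in> E \<Longrightarrow> dg e \<le> k \<Longrightarrow> e \<in> span_le \<theta> d E dg k"
  unfolding span_le_def by (intro mpv.span_base CollectI exI[of _ 0] exI[of _ e]) auto

lemma span_le_induct [consumes 1, case_names zero step]:
  assumes "f \<in> span_le \<theta> d E dg k" "P 0"
    "\<And>c \<mu> e g. e \<in> E \<Longrightarrow> keys \<mu> \<subseteq> {..<d} \<Longrightarrow> tdeg \<mu> + dg e \<le> k \<Longrightarrow> P g \<Longrightarrow> P (cst c * (mon_eval \<theta> \<mu> * e) + g)"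
  shows "P f"
  using assms(1) unfolding span_le_def
  by (induction rule: mpv.span_induct_alt) (use assms(2,3) in auto)

lemma span_le_mon_eval:
  assumes "f \<in> span_le \<theta> d E dg k" "keys \<nu> \<subseteq> {..<d}"
  shows "mon_eval \<theta> \<nu> * f \<in> span_le \<theta> d E dg (tdeg \<nu> + k)"
  using assms(1)
proof (induction rule: span_le_induct)
  case (step c \<mu> e g)
  have "keys (\<nu> + \<mu>) \<subseteq> {..<d}" using Poly_Mapping.keys_add[of \<nu> \<mu>] assms(2) step by blast
  then have "mon_eval \<theta> (\<nu> + \<mu>) * e \<in> span_le \<theta> d E dg (tdeg \<nu> + k)"
    using step.hyps unfolding span_le_def
    by (intro mpv.span_base CollectI exI[of _ "\<nu> + \<mu>"] exI[of _ e]) (simp add: tdeg_add)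
  then have "cst c * (mon_eval \<theta> (\<nu> + \<mu>) * e) + mon_eval \<theta> \<nu> * g \<in> span_le \<theta> d E dg (tdeg \<nu> + k)"
    using step.IH by (intro span_le_add span_le_scale)
  then show ?case by (simp add: mon_eval_add algebra_simps)
qed simp

lemma span_le_param:
  assumes "f \<in> span_le \<theta> d E dg k" "j < d"
  shows "\<theta> j * f \<in> span_le \<theta> d E dg (Suc k)"
  using span_le_mon_eval[OF assms(1), of "single j 1"] assms(2) by simp

text \<open>Multiplication by \<open>q\<close> commutes with the parameters, so its effect on the
  filtration is decided on the basis elements.\<close>

lemma span_le_mult:
  assumes "f \<in> span_le \<theta> d E dg k" "\<And>e. e \<in> E \<Longrightarrow> q * e \<in> span_le \<theta> d E dg (Suc (dg e))"
  shows "q * f \<in> span_le \<theta> d E dg (Suc k)"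
  using assms(1)
proof (induction rule: span_le_induct)
  case (step c \<mu> e g)
  have "mon_eval \<theta> \<mu> * (q * e) \<in> span_le \<theta> d E dg (tdeg \<mu> + Suc (dg e))"
    by (rule span_le_mon_eval[OF assms(2)[OF step.hyps(1)] step.hyps(2)])
  then have "mon_eval \<theta> \<mu> * (q * e) \<in> span_le \<theta> d E dg (Suc k)"
    using span_le_mono[of "tdeg \<mu> + Suc (dg e)" "Suc k"] step.hyps(3) by fastforce
  then have "cst c * (mon_eval \<theta> \<mu> * (q * e)) + q * g \<in> span_le \<theta> d E dg (Suc k)"
    using step.IH by (intro span_le_add span_le_scale)
  then show ?case by (simp add: algebra_simps)
qed simp

definition param_combs :: "(nat \<Rightarrow> ('y, 'k::field) mpoly) \<Rightarrow> nat \<Rightarrow> ('y, 'k) mpoly set \<Rightarrow> ('y, 'k) mpoly set"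
  where "param_combs \<theta> d E = {x. \<exists>c. (\<forall>e\<in>E. c e \<in> pv {..<d}) \<and> x = (\<Sum>e\<in>E. psub \<theta> (c e) * e)}"

lemma param_combsI:
  "(\<And>e. e \<in> E \<Longrightarrow> c e \<in> pv {..<d}) \<Longrightarrow> x = (\<Sum>e\<in>E. psub \<theta> (c e) * e) \<Longrightarrow> x \<in> param_combs \<theta> d E"
  unfolding param_combs_def by blast

lemma param_combs_zero: "0 \<in> param_combs \<theta> d E"
  by (rule param_combsI[of _ "\<lambda>_. 0"]) auto

lemma param_combs_add:
  assumes "x \<in> param_combs \<theta> d E" "y \<in> param_combs \<theta> d E"
  shows "x + y \<in> param_combs \<theta> d E"
proof -
  obtain a b where "\<And>e. e \<in> E \<Longrightarrow> a e \<in> pv {..<d}" "x = (\<Sum>e\<in>E. psub \<theta> (a e) * e)"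
    "\<And>e. e \<in> E \<Longrightarrow> b e \<in> pv {..<d}" "y = (\<Sum>e\<in>E. psub \<theta> (b e) * e)"
    using assms unfolding param_combs_def by blast
  then show ?thesis
    by (intro param_combsI[of _ "\<lambda>e. a e + b e"]) (auto simp: pv_add sum.distrib distrib_right)
qed

lemma param_combs_mult:
  assumes "x \<in> param_combs \<theta> d E" "f \<in> pv {..<d}"
  shows "psub \<theta> f * x \<in> param_combs \<theta> d E"
proof -
  obtain a where "\<And>e. e \<in> E \<Longrightarrow> a e \<in> pv {..<d}" "x = (\<Sum>e\<in>E. psub \<theta> (a e) * e)"
    using assms unfolding param_combs_def by blast
  then show ?thesis
    using assms(2) by (intro param_combsI[of _ "\<lambda>e. f * a e"]) (auto simp: pv_mult sum_distrib_left mult.assoc)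
qed

lemma param_combs_base:
  assumes "finite E" "e \<in> E"
  shows "e \<in> param_combs \<theta> d E"
proof (rule param_combsI[of _ "\<lambda>e'. if e' = e then 1 else 0"])
  have "(\<Sum>e'\<in>E. psub \<theta> (if e' = e then 1 else 0) * e') = (\<Sum>e'\<in>E. if e' = e then e' else 0)"
    by (rule sum.cong) auto
  then show "e = (\<Sum>e'\<in>E. psub \<theta> (if e' = e then 1 else 0) * e')" using assms by simp
qed auto

lemma span_le_sub_param_combs:
  assumes "finite E" "f \<in> span_le \<theta> d E dg k"
  shows "f \<in> param_combs \<theta> d E"
  using assms(2)
proof (induction rule: span_le_induct)
  case (step c \<mu> e g)
  have "psub \<theta> (single \<mu> c) * e \<in> param_combs \<theta> d E"
    by (intro param_combs_mult param_combs_base assms(1) step pv_single)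
  then have "psub \<theta> (single \<mu> c) * e + g \<in> param_combs \<theta> d E"
    using step.IH by (rule param_combs_add)
  then show ?case by (simp add: mult.assoc)
qed (rule param_combs_zero)

text \<open>A spanning family with at most as many members as the dimension is a basis; this is applied to
  each filtration step \<open>B k\<close>.\<close>

lemma graded_independent:
  fixes \<theta> :: "nat \<Rightarrow> ('y::linorder, 'k::field) mpoly" and B :: "nat \<Rightarrow> ('y \<Rightarrow>\<^sub>0 nat) set"
  assumes E: "finite E" and B: "\<And>k. finite (B k)"
    "\<And>k m. m \<in> B k \<Longrightarrow> single m 1 \<in> span_le \<theta> d E dg k"
    and count: "\<And>k. (\<Sum>e\<in>E. card {\<mu>. keys \<mu> \<subseteq> {..<d} \<and> tdeg \<mu> + dg e \<le> k}) \<le> card (B k)"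
    and c: "\<forall>e\<in>E. c e \<in> pv {..<d}" "(\<Sum>e\<in>E. psub \<theta> (c e) * e) = 0" and e0: "e0 \<in> E"
  shows "c e0 = 0"
proof -
  \<comment> \<open>Large enough for filtration step \<open>k\<close> to contain every term of the
    given relation.\<close>
  define k where "k = (\<Sum>e\<in>E. dg e + (\<Sum>\<mu>\<in>keys (c e). tdeg \<mu>))"
  have k: "tdeg \<mu> + dg e \<le> k" if e: "e \<in> E" "\<mu> \<in> keys (c e)" for e \<mu>
  proof -
    have "tdeg \<mu> \<le> (\<Sum>\<mu>\<in>keys (c e). tdeg \<mu>)" using e(2) by (intro member_le_sum) auto
    then have "tdeg \<mu> + dg e \<le> dg e + (\<Sum>\<mu>\<in>keys (c e). tdeg \<mu>)" by simp
    also have "\<dots> \<le> k" unfolding k_def using e(1) E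
      by (intro member_le_sum[of e E "\<lambda>e. dg e + (\<Sum>\<mu>\<in>keys (c e). tdeg \<mu>)"]) auto
    finally show ?thesis .
  qed
  let ?A = "\<lambda>e. {\<mu>. keys \<mu> \<subseteq> {..<d} \<and> tdeg \<mu> + dg e \<le> k}"
  let ?I = "Sigma E ?A" and ?v = "\<lambda>(e, \<mu>). mon_eval \<theta> \<mu> * e"
  have finA: "finite (?A e)" for e
    by (rule finite_subset[OF _ conjunct1[OF exps_le_card[of "{..<d}" k]]]) (auto simp: exps_le_def)
  have finI: "finite ?I" using E finA by blast
  let ?M = "(\<lambda>m. single m (1::'k)) ` B k"
  have "?v ` ?I = {mon_eval \<theta> \<mu> * e | \<mu> e. e \<in> E \<and> keys \<mu> \<subseteq> {..<d} \<and> tdeg \<mu> + dg e \<le> k}"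
    by (auto simp: image_iff)
  then have span: "?M \<subseteq> mpv.span (?v ` ?I)"
    using B(2) unfolding span_le_def by auto
  have "card ?I \<le> card ?M"
    using count[of k] E finA by (simp add: card_SigmaI card_monomials)
  moreover have "mpv.independent ?M" by (rule independent_monomials[OF B(1)])
  moreover have "(\<Sum>i\<in>?I. cst (case i of (e, \<mu>) \<Rightarrow> lookup (c e) \<mu>) * ?v i) = 0"
  proof -
    have "(\<Sum>i\<in>?I. cst (case i of (e, \<mu>) \<Rightarrow> lookup (c e) \<mu>) * ?v i) =
        (\<Sum>e\<in>E. \<Sum>\<mu>\<in>?A e. cst (lookup (c e) \<mu>) * (mon_eval \<theta> \<mu> * e))"
      by (subst sum.Sigma) (use E finA in \<open>auto simp: case_prod_unfold\<close>)
    also have "\<dots> = (\<Sum>e\<in>E. psub \<theta> (c e) * e)"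
    proof (rule sum.cong[OF refl])
      fix e assume e: "e \<in> E"
      have sub: "keys (c e) \<subseteq> ?A e" using k[OF e] c(1) e by (auto simp: pv_def)
      have "(\<Sum>\<mu>\<in>?A e. cst (lookup (c e) \<mu>) * (mon_eval \<theta> \<mu> * e)) =
          (\<Sum>\<mu>\<in>keys (c e). cst (lookup (c e) \<mu>) * (mon_eval \<theta> \<mu> * e))"
        by (rule sum.mono_neutral_right[OF finA sub]) (auto simp: in_keys_iff)
      then show "(\<Sum>\<mu>\<in>?A e. cst (lookup (c e) \<mu>) * (mon_eval \<theta> \<mu> * e)) = psub \<theta> (c e) * e"
        by (simp add: ev_def sum_distrib_right mult.assoc)
    qed
    finally show ?thesis using c(2) by simp
  qed
  ultimately have z: "(case i of (e, \<mu>) \<Rightarrow> lookup (c e) \<mu>) = 0" if "i \<in> ?I" for i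
    using family_independent[OF finI _ span] that by blast
  show ?thesis
  proof (rule poly_mapping_eqI)
    fix \<mu>
    show "lookup (c e0) \<mu> = lookup 0 \<mu>"
    proof (cases "\<mu> \<in> keys (c e0)")
      case True
      then have "(e0, \<mu>) \<in> ?I" using k[OF e0 True] c(1) e0 by (auto simp: pv_def)
      then show ?thesis using z[of "(e0, \<mu>)"] by simp
    qed (simp add: in_keys_iff)
  qed
qed

lemma invs_in_subspace:
  assumes "\<And>m. keys m \<subseteq> V \<Longrightarrow> wt w m = 0 \<Longrightarrow> single m 1 \<in> A" "0 \<in> A"
    "\<And>x y. x \<in> A \<Longrightarrow> y \<in> A \<Longrightarrow> x + y \<in> A" "\<And>c x. x \<in> A \<Longrightarrow> cst c * x \<in> A"
    "(f :: ('y, 'k::field) mpoly) \<in> invs V w"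
  shows "f \<in> A"
proof -
  have "(\<Sum>m\<in>M. cst (lookup f m) * single m 1) \<in> A" if "finite M" "M \<subseteq> keys f" for M
    using that
  proof (induction M rule: finite_induct)
    case (insert m M)
    have "single m 1 \<in> A" using insert.prems assms(1,5) by (auto simp: invs_def)
    then show ?case using insert by (simp add: assms(3,4))
  qed (simp add: assms(2))
  from this[of "keys f"] show ?thesis by (simp add: cst_mult_single_1 mpoly_sum_monomials)
qed

text \<open>The variables \<zeta> are stripped off one at a time; as they have weight zero, the
  remaining monomial keeps its weight and ends up in \<open>V\<close>.\<close>

lemma adjoin_monomial:
  fixes w :: "'y \<Rightarrow> int" and \<zeta> :: "nat \<Rightarrow> 'y"
  assumes \<zeta>: "inj_on \<zeta> {..<q}" "\<And>i. i < q \<Longrightarrow> \<zeta> i \<notin> V" "\<And>i. i < q \<Longrightarrow> w (\<zeta> i) = 0"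
    and base: "\<And>m. keys m \<subseteq> V \<Longrightarrow> wt w m = 0 \<Longrightarrow> single m 1 \<in> A"
    and A_var: "\<And>x i. x \<in> A \<Longrightarrow> i < q \<Longrightarrow> var (\<zeta> i) * x \<in> A"
    and u: "keys u \<subseteq> V \<union> \<zeta> ` {..<q}" "wt w u = 0"
  shows "(single u 1 :: ('y, 'k::field) mpoly) \<in> A"
proof -
  have "\<exists>m0. keys m0 \<subseteq> V \<and> wt w m0 = wt w m \<and> (single m0 1 \<in> A \<longrightarrow> single m 1 \<in> A)"
    if "l \<le> q" "keys m \<subseteq> V \<union> \<zeta> ` {..<l}" for l and m :: "'y \<Rightarrow>\<^sub>0 nat"
    using that
  proof (induction l arbitrary: m)
    case 0
    then show ?case by (intro exI[of _ m]) auto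
  next
    case (Suc l)
    define n m' where "n = lookup m (\<zeta> l)" and "m' = m - single (\<zeta> l) n"
    have notin: "\<zeta> l \<notin> V \<union> \<zeta> ` {..<l}"
      using \<zeta>(1,2) Suc.prems(1) by (auto dest: inj_onD)
    have "keys m \<subseteq> insert (\<zeta> l) (V \<union> \<zeta> ` {..<l})"
      using Suc.prems(2) by (auto simp: lessThan_Suc)
    note s = split_off[OF this notin, folded n_def, folded m'_def]
    have "wt w (single (\<zeta> l) n) = 0" using \<zeta>(3)[of l] Suc.prems(1) by (cases "n = 0") (auto simp: wt_def)
    then have wt: "wt w m' = wt w m" using s(1) wt_add[of w "single (\<zeta> l) n" m'] by simp
    obtain m0 where m0: "keys m0 \<subseteq> V" "wt w m0 = wt w m'" "single m0 1 \<in> A \<longrightarrow> single m' 1 \<in> A"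
      using Suc.IH[OF _ s(2)] Suc.prems(1) by auto
    have pw: "single m' 1 \<in> A \<Longrightarrow> var (\<zeta> l) ^ i * single m' 1 \<in> A" for i
      by (induction i) (use A_var Suc.prems(1) in \<open>auto simp: mult.assoc\<close>)
    have eq: "var (\<zeta> l) ^ n * single m' 1 = (single m 1 :: ('y, 'k) mpoly)"
      unfolding s(1)[symmetric] mon_eval_var[symmetric] mon_eval_add by simp
    have "single m' 1 \<in> A \<Longrightarrow> single m 1 \<in> A" using pw[of n] unfolding eq .
    then show ?case using m0 wt by (intro exI[of _ m0]) auto
  qed
  from this[OF order_refl u(1)] obtain m0 where
    "keys m0 \<subseteq> V" "wt w m0 = 0" "single m0 1 \<in> A \<longrightarrow> single u 1 \<in> A" using u(2) by auto
  then show ?thesis using base by blast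
qed

text \<open>A relation specializes to relations over the old parameters at every value of the adjoined
  weight-zero variables \<open>\<zeta>\<close>.\<close>

lemma free_basis_adjoin:
  fixes \<theta> :: "nat \<Rightarrow> ('y::linorder, 'k::field) mpoly"
  assumes inf: "infinite (UNIV :: 'k set)" and V: "finite V"
    and \<zeta>: "inj_on \<zeta> {..<q}" "\<And>i. i < q \<Longrightarrow> \<zeta> i \<notin> V" "\<And>i. i < q \<Longrightarrow> w (\<zeta> i) = (0::int)"
    and free: "free_basis (invs V w) \<theta> d E"
  shows "free_basis (invs (V \<union> \<zeta> ` {..<q}) w) (\<lambda>j. if j < d then \<theta> j else var (\<zeta> (j - d))) (d + q) E"
proof -
  let ?V = "V \<union> \<zeta> ` {..<q}" and ?\<theta> = "\<lambda>j. if j < d then \<theta> j else var (\<zeta> (j - d))"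
  let ?C = "param_combs ?\<theta> (d + q) E"
  have E: "finite E" "E \<subseteq> invs V w" and \<theta>: "\<And>j. j < d \<Longrightarrow> \<theta> j \<in> invs V w"
    and sp: "\<And>x. x \<in> invs V w \<Longrightarrow> \<exists>c. (\<forall>e\<in>E. c e \<in> pv {..<d}) \<and> x = (\<Sum>e\<in>E. psub \<theta> (c e) * e)"
    and ind: "\<And>c e. \<forall>e\<in>E. c e \<in> pv {..<d} \<Longrightarrow> (\<Sum>e\<in>E. psub \<theta> (c e) * e) = 0 \<Longrightarrow> e \<in> E \<Longrightarrow> c e = 0"
    using free unfolding free_basis_def by auto
  have sub: "invs V w \<subseteq> (invs ?V w :: ('y, 'k) mpoly set)" by (auto simp: invs_def)
  have var_\<zeta>: "var (\<zeta> i) \<in> (invs ?V w :: ('y, 'k) mpoly set)" if "i < q" for i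
    using that \<zeta>(3) by (auto simp: invs_def var_def wt_def)
  have base: "x \<in> ?C" if x: "x \<in> invs V w" for x
  proof -
    obtain c where c: "\<forall>e\<in>E. c e \<in> pv {..<d}" "x = (\<Sum>e\<in>E. psub \<theta> (c e) * e)" using sp[OF x] by blast
    have "psub ?\<theta> (c e) = psub \<theta> (c e)" if "e \<in> E" for e
      by (rule ev_cong[of _ "{..<d}"]) (use c that in auto)
    then show ?thesis
      using c pv_mono[of "{..<d}" "{..<d + q}"] by (intro param_combsI[of _ c]) auto
  qed
  have C_var: "var (\<zeta> i) * x \<in> ?C" if "x \<in> ?C" "i < q" for x i
    using param_combs_mult[OF that(1) pv_var[of "d + i"]] that(2) by simp
  have mono: "single m 1 \<in> ?C" if m: "keys m \<subseteq> ?V" "wt w m = 0" for m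
  proof (rule adjoin_monomial[OF \<zeta> _ C_var m])
    show "single m 1 \<in> ?C" if "keys m \<subseteq> V" "wt w m = 0" for m
      using that by (intro base) (auto simp: invs_def)
  qed
  have sp': "x \<in> ?C" if "x \<in> invs ?V w" for x
    by (rule invs_in_subspace[OF mono _ _ _ that])
      (use param_combs_zero param_combs_add param_combs_mult[OF _ pv_cst, of _ ?\<theta>] in \<open>auto simp: cst_hom.ev_cst\<close>)
  have ind': "c e0 = 0" if c: "\<forall>e\<in>E. c e \<in> pv {..<d + q}" "(\<Sum>e\<in>E. psub ?\<theta> (c e) * e) = 0" and e0: "e0 \<in> E" for c e0
  proof (rule mpoly_eq_0_of_eval[OF inf finite_lessThan])
    show "c e0 \<in> pv {..<d + q}" using c e0 by blast
    fix b :: "nat \<Rightarrow> 'k"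
    \<comment> \<open>\<open>H\<close> inserts the values of \<open>b\<close> for the adjoined
      variables and fixes the old parameters and \<open>E\<close>; \<open>c'\<close> inserts the
      same values in the coefficients. The old basis then kills \<open>c'\<close>, whose value at
      \<open>b\<close> is that of the original coefficient.\<close>
    define H where "H = psub (\<lambda>v. if v \<in> \<zeta> ` {..<q} then cst (b (d + the_inv_into {..<q} \<zeta> v)) else var v :: ('y, 'k) mpoly)"
    define c' where "c' e = psub (\<lambda>j. if j < d then var j else cst (b j)) (c e)" for e
    have H: "H f = f" if "f \<in> invs V w" for f
    proof -
      have "H f = psub var f" unfolding H_def
        by (rule ev_cong[OF invs_pv[OF that]]) (use \<zeta>(2) in auto)
      then show ?thesis by simp
    qed
    have "H (\<Sum>e\<in>E. psub ?\<theta> (c e) * e) = (\<Sum>e\<in>E. psub \<theta> (c' e) * e)"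
    proof -
      have "H (psub ?\<theta> (c e)) = psub \<theta> (c' e)" if e: "e \<in> E" for e
      proof -
        have "H (psub ?\<theta> (c e)) = psub (\<lambda>j. H (?\<theta> j)) (c e)"
          unfolding H_def by (rule cst_hom.ev_ev)
        also have "\<dots> = psub (\<lambda>j. psub \<theta> (if j < d then var j else cst (b j))) (c e)"
        proof (rule ev_cong[of _ "{..<d + q}"])
          fix j assume j: "j \<in> {..<d + q}"
          show "H (?\<theta> j) = psub \<theta> (if j < d then var j else cst (b j))"
          proof (cases "j < d")
            case False
            then have "j - d < q" using j by auto
            then show ?thesis using False by (simp add: H_def the_inv_into_f_f[OF \<zeta>(1)])
          qed (simp add: H \<theta>)
        qed (use c e in auto)
        also have "\<dots> = psub \<theta> (c' e)" unfolding c'_def by (rule cst_hom.ev_ev[symmetric])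
        finally show ?thesis .
      qed
      moreover have "H e = e" if "e \<in> E" for e using H E(2) that by blast
      moreover have "H (\<Sum>e\<in>E. psub ?\<theta> (c e) * e) = (\<Sum>e\<in>E. H (psub ?\<theta> (c e)) * H e)"
        unfolding H_def by (simp add: cst_hom.ev_sum)
      ultimately show ?thesis by simp
    qed
    moreover have "H 0 = 0" by (simp add: H_def)
    ultimately have "(\<Sum>e\<in>E. psub \<theta> (c' e) * e) = 0" using c(2) by simp
    moreover have "\<forall>e\<in>E. c' e \<in> pv {..<d}"
      unfolding c'_def by (intro ballI pv_psub[of _ "{..<d + q}"]) (use c(1) in \<open>auto intro: pv_var\<close>)
    ultimately have "c' e0 = 0" using ind e0 by blast
    then have "ev (\<lambda>c. c) b (c' e0) = 0" by simp
    also have "ev (\<lambda>c. c) b (c' e0) = ev (\<lambda>c. c) b (c e0)"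
      unfolding c'_def id_hom.ev_ev by (rule ev_cong[of _ UNIV]) auto
    finally show "ev (\<lambda>c. c) b (c e0) = 0" .
  qed
  show ?thesis
    unfolding free_basis_def
    using E sub \<theta> var_\<zeta> sp' ind' unfolding param_combs_def by auto
qed

section \<open>Segre-type weights\<close>

text \<open>For \<open>c = 3\<close>, \<open>b = 1\<close> the invariants in the first
  \<open>c + r\<close> variables are generated by the entries of a matrix of rank at most one with
  \<open>3\<close> rows; for \<open>c = 2\<close>, \<open>b = 2\<close> by the products of a binary
  quadratic monomial with some \<open>y\<close>.\<close>

definition wgt :: "nat \<Rightarrow> nat \<Rightarrow> nat \<Rightarrow> nat \<Rightarrow> int"
  where "wgt c r b v = (if v < c then 1 else if v < c + r then - int b else 0)"

text \<open>The grading in which the generators, a monomial of degree \<open>b\<close> in the first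
  variables times one \<open>y\<close>, all have degree one.\<close>

definition ydeg :: "nat \<Rightarrow> nat \<Rightarrow> (nat \<Rightarrow>\<^sub>0 nat) \<Rightarrow> nat"
  where "ydeg c r m = (\<Sum>v\<in>{c..<c + r}. lookup m v)"

lemma wt_wgt:
  assumes "keys m \<subseteq> {..<c + r}"
  shows "wt (wgt c r b) m = int (\<Sum>v<c. lookup m v) - int b * int (ydeg c r m)"
proof -
  have un: "{..<c + r} = {..<c} \<union> {c..<c + r}" by auto
  have "wt (wgt c r b) m = (\<Sum>v<c. wgt c r b v * int (lookup m v)) + (\<Sum>v\<in>{c..<c + r}. wgt c r b v * int (lookup m v))"
    unfolding wt_superset[OF finite_lessThan assms] un by (rule sum.union_disjoint) auto
  also have "(\<Sum>v<c. wgt c r b v * int (lookup m v)) = int (\<Sum>v<c. lookup m v)"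
    by (simp add: wgt_def)
  also have "(\<Sum>v\<in>{c..<c + r}. wgt c r b v * int (lookup m v)) = (\<Sum>v\<in>{c..<c + r}. - (int b * int (lookup m v)))"
    by (rule sum.cong) (auto simp: wgt_def)
  also have "\<dots> = - (int b * int (ydeg c r m))"
    by (simp add: ydeg_def sum_negf sum_distrib_left)
  finally show ?thesis by simp
qed

lemma wt_wgt_0_iff:
  assumes "keys m \<subseteq> {..<c + r}"
  shows "wt (wgt c r b) m = 0 \<longleftrightarrow> (\<Sum>v<c. lookup m v) = b * ydeg c r m"
proof -
  have "wt (wgt c r b) m = 0 \<longleftrightarrow> int (\<Sum>v<c. lookup m v) = int (b * ydeg c r m)"
    unfolding wt_wgt[OF assms] by simp
  then show ?thesis by (simp only: of_nat_eq_iff)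
qed

lemma ydeg_add: "ydeg c r (m + n) = ydeg c r m + ydeg c r n"
  by (simp add: ydeg_def lookup_add sum.distrib)

lemma ydeg_single: "ydeg c r (single v n) = (if c \<le> v \<and> v < c + r then n else 0)"
  by (auto simp: ydeg_def lookup_single when_def)

lemma exists_submonomial:
  assumes "b \<le> (\<Sum>v<c. lookup m v)"
  shows "\<exists>\<alpha>\<in>exps_eq {..<c} b. mdvd \<alpha> (m :: nat \<Rightarrow>\<^sub>0 nat)"
  using assms
proof (induction b)
  case 0
  show ?case by (intro bexI[of _ 0]) (auto simp: mdvd_def exps_eq_def)
next
  case (Suc b)
  then obtain \<alpha> where \<alpha>: "\<alpha> \<in> exps_eq {..<c} b" "mdvd \<alpha> m" by auto
  have "(\<Sum>v<c. lookup \<alpha> v) = b" using \<alpha>(1) by (auto simp: exps_eq_def tdeg_superset[of "{..<c}"])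
  then have "\<not> (\<forall>v<c. lookup m v \<le> lookup \<alpha> v)"
    using Suc.prems sum_mono[of "{..<c}" "lookup m" "lookup \<alpha>"] by auto
  then obtain v where v: "v < c" "lookup \<alpha> v < lookup m v" by (auto simp: not_le)
  have "single v 1 + \<alpha> \<in> exps_eq {..<c} (Suc b)"
    using \<alpha>(1) v(1) Poly_Mapping.keys_add[of "single v 1" \<alpha>] by (auto simp: exps_eq_def tdeg_add)
  moreover have "mdvd (single v 1 + \<alpha>) m"
    using \<alpha>(2) v(2) by (auto simp: mdvd_def lookup_add lookup_single when_def Suc_le_eq)
  ultimately show ?case by blast
qed

text \<open>Weight zero leaves \<open>b\<close> factors among the first variables for each factor
  \<open>y\<close>, so a generator can be split off as long as the degree is positive. The family
  \<open>A\<close> may be a filtration, or constant when only generation of a ring matters.\<close>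

lemma wgt_monomial_induct:
  assumes one: "1 \<in> A 0"
    and step: "\<And>n \<alpha> i f. \<alpha> \<in> exps_eq {..<c} b \<Longrightarrow> i < r \<Longrightarrow> f \<in> A n \<Longrightarrow>
      single \<alpha> 1 * var (c + i) * f \<in> A (Suc n)"
    and m: "keys m \<subseteq> {..<c + r}" "wt (wgt c r b) m = 0"
  shows "(single m 1 :: (nat, 'k::field) mpoly) \<in> A (ydeg c r m)"
  using m
proof (induction "ydeg c r m" arbitrary: m)
  case 0
  have "lookup m v = 0" for v
  proof -
    have "(\<Sum>v<c. lookup m v) = 0" "ydeg c r m = 0"
      using 0 wt_wgt_0_iff[OF 0(2), of b] by auto
    then have "v < c \<Longrightarrow> lookup m v = 0" "c \<le> v \<Longrightarrow> v < c + r \<Longrightarrow> lookup m v = 0"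
      by (auto simp: ydeg_def)
    moreover have "\<not> v < c + r \<Longrightarrow> lookup m v = 0" using 0(2) by (auto simp: in_keys_iff subset_iff)
    ultimately show ?thesis by linarith
  qed
  then have "m = 0" by (intro poly_mapping_eqI) simp
  then show ?case using one by (simp add: ydeg_def)
next
  case (Suc n)
  have "(\<Sum>v<c. lookup m v) = b * Suc n" using wt_wgt_0_iff[OF Suc(3), of b] Suc(2,4) by simp
  then obtain \<alpha> where \<alpha>: "\<alpha> \<in> exps_eq {..<c} b" "mdvd \<alpha> m"
    using exists_submonomial[where b = b and c = c and m = m] by auto
  have "\<exists>v\<in>{c..<c + r}. lookup m v \<noteq> 0"
  proof (rule ccontr)
    assume "\<not> ?thesis"
    then have "ydeg c r m = 0" by (simp add: ydeg_def)
    then show False using Suc(2) by simp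
  qed
  then obtain v where "c \<le> v" "v < c + r" "lookup m v \<noteq> 0" by auto
  then obtain i where i: "i < r" "lookup m (c + i) \<noteq> 0"
    by (metis add_diff_inverse_nat less_diff_conv2 add.commute not_le)
  have \<alpha>0: "lookup \<alpha> (c + i) = 0" using \<alpha>(1) by (auto simp: exps_eq_def in_keys_iff subset_iff)
  define \<beta> where "\<beta> = \<alpha> + single (c + i) 1"
  have "mdvd \<beta> m"
    using \<alpha>(2) i(2) \<alpha>0 by (auto simp: \<beta>_def mdvd_def lookup_add lookup_single when_def)
  then have eq: "\<beta> + (m - \<beta>) = m" by (rule mdvd_add_diff)
  have "keys \<beta> \<subseteq> keys \<alpha> \<union> {c + i}"
    using Poly_Mapping.keys_add[of \<alpha> "single (c + i) 1"] by (simp add: \<beta>_def)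
  also have "\<dots> \<subseteq> {..<c + r}"
    using \<alpha>(1) i(1) by (auto simp: exps_eq_def subset_iff intro: trans_less_add1)
  finally have \<beta>k: "keys \<beta> \<subseteq> {..<c + r}" .
  have m'k: "keys (m - \<beta>) \<subseteq> {..<c + r}"
    using Suc(3) by (auto simp: in_keys_iff lookup_minus subset_iff)
  have "ydeg c r \<alpha> = 0"
    unfolding ydeg_def using \<alpha>(1) by (auto simp: exps_eq_def in_keys_iff subset_iff)
  then have y\<beta>: "ydeg c r \<beta> = 1" using i(1) by (simp add: \<beta>_def ydeg_add ydeg_single)
  have "(\<Sum>v<c. lookup \<beta> v) = b"
    using \<alpha>(1) by (auto simp: \<beta>_def lookup_add lookup_single exps_eq_def tdeg_superset[of "{..<c}"])
  then have "wt (wgt c r b) \<beta> = 0" using wt_wgt_0_iff[OF \<beta>k, of b] y\<beta> by simp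
  then have wt': "wt (wgt c r b) (m - \<beta>) = 0" using eq Suc(4) wt_add[of _ \<beta> "m - \<beta>"] by simp
  have "ydeg c r m = 1 + ydeg c r (m - \<beta>)" using eq y\<beta> ydeg_add[of c r \<beta> "m - \<beta>"] by simp
  then have yn: "n = ydeg c r (m - \<beta>)" using Suc(2) by simp
  have "single (m - \<beta>) 1 \<in> A n" using Suc(1)[OF yn m'k wt'] yn by simp
  then have "single \<alpha> 1 * var (c + i) * single (m - \<beta>) 1 \<in> A (Suc n)" by (rule step[OF \<alpha>(1) i(1)])
  moreover have "single \<alpha> 1 * var (c + i) * single (m - \<beta>) 1 = (single m 1 :: (nat, 'k) mpoly)"
    using eq by (simp add: var_def mult_single \<beta>_def)
  ultimately show ?case using Suc(2) by simp
qed

definition wgt_exps :: "nat \<Rightarrow> nat \<Rightarrow> nat \<Rightarrow> nat \<Rightarrow> (nat \<Rightarrow>\<^sub>0 nat) set"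
  where "wgt_exps c r b k = {m. keys m \<subseteq> {..<c + r} \<and> wt (wgt c r b) m = 0 \<and> ydeg c r m \<le> k}"

text \<open>Weight zero forces the total degree to be \<open>b + 1\<close> times
  \<open>ydeg\<close>, so a bound on \<open>ydeg\<close> bounds all exponents.\<close>

lemma finite_wgt_exps: "finite (wgt_exps c r b k)"
proof (rule finite_subset)
  show "finite (exps_le {..<c + r} ((b + 1) * k))" using exps_le_card[of "{..<c + r}"] by blast
  show "wgt_exps c r b k \<subseteq> exps_le {..<c + r} ((b + 1) * k)"
  proof
    fix m assume m: "m \<in> wgt_exps c r b k"
    then have mk: "keys m \<subseteq> {..<c + r}" "ydeg c r m \<le> k" "(\<Sum>v<c. lookup m v) = b * ydeg c r m"
      using wt_wgt_0_iff[of m c r b] by (auto simp: wgt_exps_def)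
    have "{..<c + r} = {..<c} \<union> {c..<c + r}" by auto
    then have "tdeg m = (\<Sum>v\<in>{..<c} \<union> {c..<c + r}. lookup m v)"
      using tdeg_superset[OF finite_lessThan mk(1)] by simp
    also have "\<dots> = (\<Sum>v<c. lookup m v) + ydeg c r m"
      unfolding ydeg_def by (rule sum.union_disjoint) auto
    also have "\<dots> = (b + 1) * ydeg c r m" by (simp add: mk(3))
    also have "\<dots> \<le> (b + 1) * k" using mk(2) by (rule mult_le_mono2)
    finally show "m \<in> exps_le {..<c + r} ((b + 1) * k)" using mk(1) by (simp add: exps_le_def)
  qed
qed

text \<open>In degree \<open>n\<close>, any monomial of degree \<open>b * n\<close> in the first
  \<open>Suc c\<close> variables may be combined with any of degree \<open>n\<close> in the other
  \<open>Suc s\<close>. The lower bound is the direction that \<open>graded_independent\<close>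
  uses.\<close>

lemma card_wgt_exps:
  "(\<Sum>n\<le>k. ((b * n + c) choose c) * ((n + s) choose s)) \<le> card (wgt_exps (Suc c) (Suc s) b k)"
proof -
  let ?A = "{..<Suc c}" and ?B = "{Suc c..<Suc c + Suc s}"
  let ?P = "\<lambda>n. exps_eq ?A (b * n) \<times> exps_eq ?B n" and ?f = "\<lambda>(\<alpha>, \<beta>). \<alpha> + \<beta>"
  have lk: "lookup \<alpha> v = 0" if "\<alpha> \<in> exps_eq S n" "v \<notin> S" for \<alpha> S n v
    using that by (auto simp: exps_eq_def in_keys_iff)
  have inj: "inj_on ?f (?P n)" for n
  proof (rule inj_onI)
    fix p p' assume p: "p \<in> ?P n" "p' \<in> ?P n" "?f p = ?f p'"
    obtain \<alpha> \<beta> \<alpha>' \<beta>' where pp: "p = (\<alpha>, \<beta>)" "p' = (\<alpha>', \<beta>')" by (cases p, cases p')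
    then have m: "\<alpha> \<in> exps_eq ?A (b * n)" "\<beta> \<in> exps_eq ?B n" "\<alpha>' \<in> exps_eq ?A (b * n)" "\<beta>' \<in> exps_eq ?B n"
      and eq: "\<alpha> + \<beta> = \<alpha>' + \<beta>'"
      using p by auto
    have l: "lookup \<alpha> v + lookup \<beta> v = lookup \<alpha>' v + lookup \<beta>' v" for v
      using arg_cong[OF eq, of "\<lambda>m. lookup m v"] by (simp add: lookup_add)
    have "lookup \<alpha> v = lookup \<alpha>' v \<and> lookup \<beta> v = lookup \<beta>' v" for v
      using l[of v] lk[OF m(1), of v] lk[OF m(2), of v] lk[OF m(3), of v] lk[OF m(4), of v]
      by (cases "v < Suc c") auto
    then show "p = p'" unfolding pp by (auto intro: poly_mapping_eqI)
  qed
  have yd: "ydeg (Suc c) (Suc s) (?f p) = n" if pP: "p \<in> ?P n" for p n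
  proof -
    obtain \<alpha> \<beta> where p: "p = (\<alpha>, \<beta>)" "\<alpha> \<in> exps_eq ?A (b * n)" "\<beta> \<in> exps_eq ?B n" using pP by auto
    have "ydeg (Suc c) (Suc s) \<alpha> = 0" unfolding ydeg_def using lk[OF p(2)] by simp
    moreover have "ydeg (Suc c) (Suc s) \<beta> = n"
      using p(3) unfolding ydeg_def by (auto simp: exps_eq_def tdeg_superset[of ?B])
    ultimately show ?thesis by (simp add: p ydeg_add)
  qed
  have sub: "?f ` ?P n \<subseteq> wgt_exps (Suc c) (Suc s) b k" if "n \<le> k" for n
  proof (rule image_subsetI)
    fix p assume pP: "p \<in> ?P n"
    then obtain \<alpha> \<beta> where p: "p = (\<alpha>, \<beta>)" "\<alpha> \<in> exps_eq ?A (b * n)" "\<beta> \<in> exps_eq ?B n" by auto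
    have k: "keys (\<alpha> + \<beta>) \<subseteq> {..<Suc c + Suc s}"
      using p Poly_Mapping.keys_add[of \<alpha> \<beta>] by (fastforce simp: exps_eq_def)
    have "(\<Sum>v<Suc c. lookup (\<alpha> + \<beta>) v) = (\<Sum>v<Suc c. lookup \<alpha> v)"
      by (rule sum.cong) (auto simp: lookup_add lk[OF p(3)])
    also have "\<dots> = b * n" using p(2) by (auto simp: exps_eq_def tdeg_superset[of ?A])
    finally show "?f p \<in> wgt_exps (Suc c) (Suc s) b k"
      using k yd[OF pP] that wt_wgt_0_iff[OF k, of b] by (simp add: wgt_exps_def p(1))
  qed
  have finP: "finite (?P n)" for n using exps_eq_card(1)[of ?A] exps_eq_card(1)[of ?B] by blast
  have "card (?f ` ?P n) = ((b * n + c) choose c) * ((n + s) choose s)" for n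
    unfolding card_image[OF inj] card_cartesian_product
    using exps_eq_card(2)[of ?A c "b * n"] exps_eq_card(2)[of ?B s n] by simp
  then have "(\<Sum>n\<le>k. ((b * n + c) choose c) * ((n + s) choose s)) = (\<Sum>n\<le>k. card (?f ` ?P n))" by simp
  also have "\<dots> = card (\<Union>n\<le>k. ?f ` ?P n)"
  proof (rule card_UN_disjoint[symmetric])
    show "\<forall>i\<in>{..k}. \<forall>j\<in>{..k}. i \<noteq> j \<longrightarrow> ?f ` ?P i \<inter> ?f ` ?P j = {}"
    proof (intro ballI impI, rule ccontr)
      fix i j assume "i \<noteq> j" "?f ` ?P i \<inter> ?f ` ?P j \<noteq> {}"
      then obtain a a' where "a \<in> ?P i" "a' \<in> ?P j" "?f a = ?f a'" by blast
      then show False using yd[of a i] yd[of a' j] \<open>i \<noteq> j\<close> by simp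
    qed
  qed (use finP in auto)
  also have "\<dots> \<le> card (wgt_exps (Suc c) (Suc s) b k)"
    using sub by (intro card_mono finite_wgt_exps) blast
  finally show ?thesis .
qed

text \<open>For \<open>c > k\<close> there are no such exponents; by \<open>c \<le> d\<close> the
  truncated difference \<open>k + d - c\<close> is then below \<open>d\<close>, so the binomial
  coefficient is zero too.\<close>

lemma card_shifted_exps:
  assumes "c \<le> d"
  shows "card {\<mu>. keys \<mu> \<subseteq> {..<d} \<and> tdeg \<mu> + c \<le> k} = (k + d - c) choose d"
proof (cases "c \<le> k")
  case True
  then have "{\<mu>. keys \<mu> \<subseteq> {..<d} \<and> tdeg \<mu> + c \<le> k} = exps_le {..<d} (k - c)"
    by (auto simp: exps_le_def)
  then show ?thesis using True exps_le_card[of "{..<d}" "k - c"] by simp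
next
  case False
  then have "{\<mu>. keys \<mu> \<subseteq> {..<d} \<and> tdeg \<mu> + c \<le> k} = {}" by auto
  then show ?thesis using False assms by (simp add: binomial_eq_0)
qed

text \<open>Freeness becomes two checks: multiplication by a generator raises the filtration by at
  most one, which gives spanning, and a comparison of Hilbert functions, which gives
  independence.\<close>

lemma free_basis_wgt:
  fixes \<theta> :: "nat \<Rightarrow> (nat, 'k::field) mpoly"
  assumes E: "finite E" "E \<subseteq> invs {..<Suc c + Suc s} (wgt (Suc c) (Suc s) b)"
    and \<theta>: "\<And>j. j < d \<Longrightarrow> \<theta> j \<in> invs {..<Suc c + Suc s} (wgt (Suc c) (Suc s) b)"
    and one: "1 \<in> span_le \<theta> d E dg 0"
    and step: "\<And>n \<alpha> i f. \<alpha> \<in> exps_eq {..<Suc c} b \<Longrightarrow> i < Suc s \<Longrightarrow> f \<in> span_le \<theta> d E dg n \<Longrightarrow>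
      single \<alpha> 1 * var (Suc c + i) * f \<in> span_le \<theta> d E dg (Suc n)"
    and dg: "\<And>e. e \<in> E \<Longrightarrow> dg e \<le> d"
    and count: "\<And>k. (\<Sum>e\<in>E. (k + d - dg e) choose d) \<le> (\<Sum>n\<le>k. ((b * n + c) choose c) * ((n + s) choose s))"
  shows "free_basis (invs {..<Suc c + Suc s} (wgt (Suc c) (Suc s) b)) \<theta> d E"
proof -
  let ?V = "{..<Suc c + Suc s}" and ?w = "wgt (Suc c) (Suc s) b"
  have mono: "single m 1 \<in> span_le \<theta> d E dg (ydeg (Suc c) (Suc s) m)"
    if "keys m \<subseteq> ?V" "wt ?w m = 0" for m
    by (rule wgt_monomial_induct[OF one step that])
  have span: "x \<in> param_combs \<theta> d E" if "x \<in> invs ?V ?w" for x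
    by (rule invs_in_subspace[OF _ _ _ _ that])
      (use span_le_sub_param_combs[OF E(1) mono] param_combs_zero param_combs_add
        param_combs_mult[OF _ pv_cst, of _ \<theta>] in auto)
  have indep: "c' e0 = 0" if "\<forall>e\<in>E. c' e \<in> pv {..<d}" "(\<Sum>e\<in>E. psub \<theta> (c' e) * e) = 0" "e0 \<in> E" for c' e0
  proof (rule graded_independent[where B = "wgt_exps (Suc c) (Suc s) b", OF E(1) finite_wgt_exps _ _ that])
    show "single m 1 \<in> span_le \<theta> d E dg k" if "m \<in> wgt_exps (Suc c) (Suc s) b k" for k m
      by (rule subsetD[OF span_le_mono mono]) (use that in \<open>auto simp: wgt_exps_def\<close>)
    show "(\<Sum>e\<in>E. card {\<mu>. keys \<mu> \<subseteq> {..<d} \<and> tdeg \<mu> + dg e \<le> k}) \<le> card (wgt_exps (Suc c) (Suc s) b k)" for k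
      using order_trans[OF count card_wgt_exps, of k] by (simp add: card_shifted_exps dg)
  qed
  show ?thesis unfolding free_basis_def
    using E \<theta> span indep unfolding param_combs_def by auto
qed

text \<open>Modulo \<open>A\<close> the value depends only on \<open>i + j\<close>; moving units
  from \<open>j\<close> to \<open>i\<close> until \<open>j\<close> is negative puts it into
  \<open>A\<close>.\<close>

lemma shift_invariant:
  fixes f :: "int \<Rightarrow> int \<Rightarrow> 'a::ab_group_add"
  assumes "\<And>x y. x \<in> A \<Longrightarrow> y \<in> A \<Longrightarrow> x + y \<in> A"
    and "\<And>i j. f i j - f (i + 1) (j - 1) \<in> A" and "\<And>i j. j < 0 \<Longrightarrow> f i j \<in> A"
  shows "f i j \<in> A"
proof -
  have "f i (int n - 1) \<in> A" for n i
  proof (induction n arbitrary: i)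
    case (Suc n)
    have "(f i (int n) - f (i + 1) (int n - 1)) + f (i + 1) (int n - 1) \<in> A"
      by (intro assms(1,2) Suc)
    then show ?case by simp
  qed (simp add: assms(3))
  from this[of i "nat j + 1"] show ?thesis using assms(3)[of j i] by (cases "j < 0") auto
qed

section \<open>Parameters for matrices of rank at most one\<close>

text \<open>\<open>Y\<close> is extended by zero to all integers, so shifted relations have no
  boundary cases.\<close>

locale rank_one_params =
  fixes x0 x1 x2 :: "('y, 'k::field) mpoly" and Y :: "int \<Rightarrow> ('y, 'k) mpoly" and r :: nat
  assumes r: "0 < r" and Y_0: "i < 0 \<or> int r \<le> i \<Longrightarrow> Y i = 0"
begin

text \<open>The coefficient of \<open>T ^ l\<close> in the product of
  \<open>x0 + x1 T + x2 T^2\<close> with the generating polynomial of \<open>Y\<close>. It can be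
  nonzero only for \<open>0 \<le> l \<le> r + 1\<close>, whence \<open>r + 2\<close>
  parameters.\<close>

definition "\<Theta> l = x0 * Y l + x1 * Y (l - 1) + x2 * Y (l - 2)"

text \<open>Among the \<open>3 * r\<close> generators the parameters account for
  \<open>r + 2\<close>, namely all \<open>x0 * Y i\<close> and the last \<open>x1 * Y i\<close> and
  \<open>x2 * Y i\<close>; these \<open>2 * (r - 1)\<close> are left.\<close>

definition "E1 = (\<lambda>i. x1 * Y (int i)) ` {..<r - 1} \<union> (\<lambda>i. x2 * Y (int i)) ` {..<r - 1}"

text \<open>Index pairs \<open>i \<le> j < r - 2\<close>, so at most \<open>(r - 1) choose 2\<close>
  elements, the last entry of the h-vector.\<close>

definition "E2 = (\<lambda>(i, j). x2 * x2 * Y (int i) * Y (int j)) ` (SIGMA j:{..<r - 2}. {..j})"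

definition "E = {1} \<union> E1 \<union> E2"

text \<open>\<open>E\<close> is a set of polynomials, so the degree is read off the element; if the
  three parts overlap, an element counts once, in the lowest degree.\<close>

definition dg :: "('y, 'k) mpoly \<Rightarrow> nat" where "dg e = (if e = 1 then 0 else if e \<in> E1 then 1 else 2)"

abbreviation "M \<equiv> span_le (\<lambda>j. \<Theta> (int j)) (r + 2) E dg"

lemma \<Theta>_mult: "f \<in> M k \<Longrightarrow> \<Theta> l * f \<in> M (Suc k)"
proof (cases "0 \<le> l \<and> l < int (r + 2)")
  case True
  assume "f \<in> M k"
  moreover have "nat l < r + 2" using True by linarith
  ultimately show ?thesis
    using span_le_param[where \<theta> = "\<lambda>j. \<Theta> (int j)" and j = "nat l" and d = "r + 2"] True by simp
next
  case False
  then have "\<Theta> l = 0" by (auto simp: \<Theta>_def Y_0)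
  then show ?thesis by simp
qed

lemma one: "1 \<in> M 0"
  by (rule span_le_base) (auto simp: E_def dg_def)

lemma \<Theta>_M1: "\<Theta> l \<in> M 1"
  using \<Theta>_mult[OF one, of l] by simp

text \<open>The top parameter \<open>\<Theta> (r + 1)\<close> is \<open>x2 * Y (r - 1)\<close>.
  Next, \<open>\<Theta> r\<close> supplies \<open>x1 * Y (r - 1)\<close>, and then
  \<open>\<Theta> i\<close> supplies \<open>x0 * Y i\<close>; hence the order of these three
  lemmas.\<close>

lemma deg1_x2: "x2 * Y i \<in> M 1"
proof -
  consider "i < 0 \<or> int r \<le> i" | "i = int r - 1" | "0 \<le> i" "i < int r - 1" by linarith
  then show ?thesis
  proof cases
    case 2
    then have "x2 * Y i = \<Theta> (int r + 1)" by (simp add: \<Theta>_def Y_0)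
    then show ?thesis using \<Theta>_M1 by simp
  next
    case 3
    then have "x2 * Y i \<in> E1"
      unfolding E1_def by (intro UnI2 image_eqI[of _ _ "nat i"]) auto
    then show ?thesis by (intro span_le_base) (auto simp: E_def dg_def)
  qed (simp add: Y_0)
qed

lemma deg1_x1: "x1 * Y i \<in> M 1"
proof -
  consider "i < 0 \<or> int r \<le> i" | "i = int r - 1" | "0 \<le> i" "i < int r - 1" by linarith
  then show ?thesis
  proof cases
    case 2
    then have "x1 * Y i = \<Theta> (int r) - x2 * Y (int r - 2)" by (simp add: \<Theta>_def Y_0)
    then show ?thesis using \<Theta>_M1 deg1_x2 by (simp add: span_le_diff)
  next
    case 3
    then have "x1 * Y i \<in> E1"
      unfolding E1_def by (intro UnI1 image_eqI[of _ _ "nat i"]) auto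
    then show ?thesis by (intro span_le_base) (auto simp: E_def dg_def)
  qed (simp add: Y_0)
qed

lemma deg1_x0: "x0 * Y i \<in> M 1"
proof -
  have "\<Theta> i - x1 * Y (i - 1) - x2 * Y (i - 2) \<in> M 1"
    by (intro span_le_diff \<Theta>_M1 deg1_x1 deg1_x2)
  then show ?thesis by (simp add: \<Theta>_def)
qed

lemma \<Theta>_M2: "f \<in> M 1 \<Longrightarrow> \<Theta> l * f \<in> M 2"
  using \<Theta>_mult[of f 1 l] by (simp add: numeral_2_eq_2)

text \<open>The difference of the relations \<open>\<Theta> l * x2 * Y m\<close> and \<open>\<Theta> m * x2 * Y l\<close> is a shift of this
  expression, which therefore vanishes modulo the parameters.\<close>

lemma deg2_relation: "x1 * x2 * Y i * Y j + x2 * x2 * Y (i - 1) * Y j + x2 * x2 * Y i * Y (j - 1) \<in> M 2"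
proof (rule shift_invariant[where f = "\<lambda>i j. x1 * x2 * Y i * Y j + x2 * x2 * Y (i - 1) * Y j + x2 * x2 * Y i * Y (j - 1)"])
  fix i j :: int
  have "\<Theta> (i + 1) * (x2 * Y j) - \<Theta> j * (x2 * Y (i + 1)) \<in> M 2"
    by (intro span_le_diff \<Theta>_M2 deg1_x2)
  then show "x1 * x2 * Y i * Y j + x2 * x2 * Y (i - 1) * Y j + x2 * x2 * Y i * Y (j - 1) -
      (x1 * x2 * Y (i + 1) * Y (j - 1) + x2 * x2 * Y (i + 1 - 1) * Y (j - 1) + x2 * x2 * Y (i + 1) * Y (j - 1 - 1)) \<in> M 2"
    by (simp add: \<Theta>_def algebra_simps)
qed (auto simp: Y_0 span_le_add)

text \<open>Products with \<open>Y (r - 1)\<close> contain the top parameter. The relation at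
  \<open>j = r - 1\<close> then disposes of \<open>Y (r - 2)\<close>, and what is left belongs to
  \<open>E2\<close>.\<close>

lemma deg2_x2_x2: "x2 * x2 * Y i * Y j \<in> M 2"
proof -
  have last: "f * Y (int r - 1) * x2 \<in> M 2" if "f \<in> M 1" for f
  proof -
    have "\<Theta> (int r + 1) * f \<in> M 2" by (rule \<Theta>_M2[OF that])
    then show ?thesis by (simp add: \<Theta>_def Y_0 mult_ac)
  qed
  have l1: "x2 * x2 * Y i * Y (int r - 1) \<in> M 2" and l1': "x1 * x2 * Y i * Y (int r - 1) \<in> M 2" for i
    using last[OF deg1_x2[of i]] last[OF deg1_x1[of i]] by (simp_all add: mult_ac)
  have l2: "x2 * x2 * Y i * Y (int r - 2) \<in> M 2" for i
  proof -
    have "(x1 * x2 * Y i * Y (int r - 1) + x2 * x2 * Y (i - 1) * Y (int r - 1) + x2 * x2 * Y i * Y (int r - 1 - 1))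
        - x1 * x2 * Y i * Y (int r - 1) - x2 * x2 * Y (i - 1) * Y (int r - 1) \<in> M 2"
      by (intro span_le_diff deg2_relation l1 l1')
    then show ?thesis by simp
  qed
  have main: "x2 * x2 * Y i * Y j \<in> M 2" if "i \<le> j" for i j
  proof -
    consider "i < 0 \<or> int r \<le> j" | "j = int r - 1" | "j = int r - 2" | "0 \<le> i" "j < int r - 2" by linarith
    then show ?thesis
    proof cases
      case 4
      then have "x2 * x2 * Y i * Y j \<in> E2"
        unfolding E2_def using that by (intro image_eqI[of _ _ "(nat j, nat i)"]) (auto simp: mult_ac)
      then show ?thesis by (intro span_le_base) (auto simp: E_def dg_def)
    next
      case 2
      then show ?thesis using l1[of i] by simp
    next
      case 3
      then show ?thesis using l2[of i] by simp
    qed (auto simp: Y_0)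
  qed
  show ?thesis
    using main[of i j] main[of j i] by (cases "i \<le> j") (auto simp: mult_ac)
qed

lemma deg2_x1_x2: "x1 * x2 * Y i * Y j \<in> M 2"
proof -
  have "(x1 * x2 * Y i * Y j + x2 * x2 * Y (i - 1) * Y j + x2 * x2 * Y i * Y (j - 1))
      - x2 * x2 * Y (i - 1) * Y j - x2 * x2 * Y i * Y (j - 1) \<in> M 2"
    by (intro span_le_diff deg2_relation deg2_x2_x2)
  then show ?thesis by simp
qed

text \<open>In the antisymmetric combination of two parameters the \<open>x0 * x1\<close> terms
  cancel; up to \<open>x1 * x2\<close> terms already treated, a shift difference remains.\<close>

lemma deg2_x1_x1: "x1 * x1 * Y i * Y j \<in> M 2"
proof (rule shift_invariant[where f = "\<lambda>i j. x1 * x1 * Y i * Y j"])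
  fix i j :: int
  have "\<Theta> (i + 1) * (x1 * Y j) - \<Theta> j * (x1 * Y (i + 1)) - x1 * x2 * Y (i - 1) * Y j
      + x1 * x2 * Y (i + 1) * Y (j - 2) \<in> M 2"
    by (intro span_le_add span_le_diff \<Theta>_M2 deg1_x1 deg2_x1_x2)
  then show "x1 * x1 * Y i * Y j - x1 * x1 * Y (i + 1) * Y (j - 1) \<in> M 2"
    by (simp add: \<Theta>_def algebra_simps)
qed (auto simp: Y_0 span_le_add)

lemma deg2_x0_x2: "x0 * x2 * Y i * Y j \<in> M 2"
proof -
  have "\<Theta> i * (x2 * Y j) - x1 * x2 * Y (i - 1) * Y j - x2 * x2 * Y (i - 2) * Y j \<in> M 2"
    by (intro span_le_diff \<Theta>_M2 deg1_x2 deg2_x1_x2 deg2_x2_x2)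
  then show ?thesis by (simp add: \<Theta>_def algebra_simps)
qed

lemma deg2_x0_x1: "x0 * x1 * Y i * Y j \<in> M 2"
proof -
  have "\<Theta> i * (x1 * Y j) - x1 * x1 * Y (i - 1) * Y j - x1 * x2 * Y (i - 2) * Y j \<in> M 2"
    by (intro span_le_diff \<Theta>_M2 deg1_x1 deg2_x1_x2 deg2_x1_x1)
  then show ?thesis by (simp add: \<Theta>_def algebra_simps)
qed

lemma \<Theta>_M3: "\<Theta> l * (x2 * x2 * Y i * Y j) \<in> M 3"
  using \<Theta>_mult[OF deg2_x2_x2] by (simp add: numeral_3_eq_3 numeral_2_eq_2)

text \<open>The argument for \<open>deg2_relation\<close> with an additional factor
  \<open>x2 * Y n\<close>. There are no basis elements of degree three, so everything of that degree
  must come from parameters times lower degrees.\<close>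

lemma deg3_relation:
  "x1 * x2 * x2 * Y i * Y j * Y n + x2 * x2 * x2 * Y (i - 1) * Y j * Y n + x2 * x2 * x2 * Y i * Y (j - 1) * Y n \<in> M 3"
proof (rule shift_invariant[where f = "\<lambda>i j. x1 * x2 * x2 * Y i * Y j * Y n +
    x2 * x2 * x2 * Y (i - 1) * Y j * Y n + x2 * x2 * x2 * Y i * Y (j - 1) * Y n"])
  fix i j :: int
  have "\<Theta> (i + 1) * (x2 * x2 * Y j * Y n) - \<Theta> j * (x2 * x2 * Y (i + 1) * Y n) \<in> M 3"
    by (intro span_le_diff \<Theta>_M3)
  then show "x1 * x2 * x2 * Y i * Y j * Y n + x2 * x2 * x2 * Y (i - 1) * Y j * Y n + x2 * x2 * x2 * Y i * Y (j - 1) * Y n -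
      (x1 * x2 * x2 * Y (i + 1) * Y (j - 1) * Y n + x2 * x2 * x2 * Y (i + 1 - 1) * Y (j - 1) * Y n +
        x2 * x2 * x2 * Y (i + 1) * Y (j - 1 - 1) * Y n) \<in> M 3"
    by (simp add: \<Theta>_def algebra_simps)
qed (auto simp: Y_0 span_le_add)

text \<open>Exchanging two indices in \<open>deg3_relation\<close> cancels the \<open>x1\<close>
  term, which is symmetric, and leaves a shift difference of pure \<open>x2\<close> terms.\<close>

lemma deg3_x2: "x2 * x2 * x2 * Y i * Y j * Y n \<in> M 3"
proof (rule shift_invariant[where f = "\<lambda>j n. x2 * x2 * x2 * Y i * Y j * Y n"])
  fix j n :: int
  have "(x1 * x2 * x2 * Y i * Y (j + 1) * Y n + x2 * x2 * x2 * Y (i - 1) * Y (j + 1) * Y n + x2 * x2 * x2 * Y i * Y (j + 1 - 1) * Y n) -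
      (x1 * x2 * x2 * Y i * Y n * Y (j + 1) + x2 * x2 * x2 * Y (i - 1) * Y n * Y (j + 1) + x2 * x2 * x2 * Y i * Y (n - 1) * Y (j + 1)) \<in> M 3"
    by (intro span_le_diff deg3_relation)
  then show "x2 * x2 * x2 * Y i * Y j * Y n - x2 * x2 * x2 * Y i * Y (j + 1) * Y (n - 1) \<in> M 3"
    by (simp add: algebra_simps)
qed (auto simp: Y_0 span_le_add)

lemma deg3_x1: "x1 * x2 * x2 * Y i * Y j * Y n \<in> M 3"
proof -
  have "(x1 * x2 * x2 * Y i * Y j * Y n + x2 * x2 * x2 * Y (i - 1) * Y j * Y n + x2 * x2 * x2 * Y i * Y (j - 1) * Y n)
      - x2 * x2 * x2 * Y (i - 1) * Y j * Y n - x2 * x2 * x2 * Y i * Y (j - 1) * Y n \<in> M 3"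
    by (intro span_le_diff deg3_relation deg3_x2)
  then show ?thesis by simp
qed

lemma deg3_x0: "x0 * x2 * x2 * Y i * Y j * Y n \<in> M 3"
proof -
  have "\<Theta> i * (x2 * x2 * Y j * Y n) - x1 * x2 * x2 * Y (i - 1) * Y j * Y n - x2 * x2 * x2 * Y (i - 2) * Y j * Y n \<in> M 3"
    by (intro span_le_diff \<Theta>_M3 deg3_x1 deg3_x2)
  then show ?thesis by (simp add: \<Theta>_def algebra_simps)
qed

lemma generator_mult:
  assumes q: "q \<in> {x0, x1, x2}" and f: "f \<in> M k"
  shows "q * Y i * f \<in> M (Suc k)"
proof (rule span_le_mult[OF f])
  fix e assume e: "e \<in> E"
  consider "e = 1" | "e \<noteq> 1" "e \<in> E1" | "e \<noteq> 1" "e \<notin> E1" "e \<in> E2" using e unfolding E_def by blast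
  then show "q * Y i * e \<in> M (Suc (dg e))"
  proof cases
    case 1
    then show ?thesis using q deg1_x0 deg1_x1 deg1_x2 by (auto simp: dg_def)
  next
    case 2
    then have "dg e = 1" by (simp add: dg_def)
    moreover obtain j q' where "e = q' * Y j" "q' \<in> {x1, x2}" using 2(2) unfolding E1_def by auto
    then have "q * Y i * e \<in> M 2"
      using q deg2_x0_x1[of i j] deg2_x0_x2[of i j] deg2_x1_x1[of i j] deg2_x1_x2[of i j] deg2_x2_x2[of i j]
      by (auto simp: mult_ac)
    ultimately show ?thesis by (simp add: numeral_2_eq_2)
  next
    case 3
    then have "dg e = 2" by (simp add: dg_def)
    moreover obtain j n where "e = x2 * x2 * Y j * Y n" using 3(3) unfolding E2_def by auto
    then have "q * Y i * e \<in> M 3"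
      using q deg3_x0[of i j n] deg3_x1[of i j n] deg3_x2[of i j n] by (auto simp: mult_ac)
    ultimately show ?thesis by (simp add: numeral_3_eq_3)
  qed
qed

lemma finite_E: "finite E"
  by (simp add: E_def E1_def E2_def)

lemma card_E1: "card E1 \<le> 2 * (r - 1)"
proof -
  have "card E1 \<le> card ((\<lambda>i. x1 * Y (int i)) ` {..<r - 1}) + card ((\<lambda>i. x2 * Y (int i)) ` {..<r - 1})"
    unfolding E1_def by (rule card_Un_le)
  also have "\<dots> \<le> (r - 1) + (r - 1)"
    using card_image_le[of "{..<r - 1}"] by (intro add_mono) auto
  finally show ?thesis by simp
qed

lemma card_E2: "card E2 \<le> (r - 1) choose 2"
proof -
  have "card E2 \<le> card (SIGMA j:{..<r - 2}. {..j})"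
    unfolding E2_def by (rule card_image_le) auto
  also have "\<dots> = (\<Sum>j<r - 2. Suc j choose 1)" by (simp add: card_SigmaI)
  also have "\<dots> = (r - 1) choose 2"
  proof (cases "r - 2")
    case 0
    then have "r - 1 < 2" by simp
    then show ?thesis using 0 by (simp add: binomial_eq_0)
  next
    case (Suc n)
    then have "r - 1 = Suc (Suc n)" by simp
    moreover have "(\<Sum>j<Suc n. Suc j choose 1) = Suc (Suc n) choose 2" for n
      by (induction n) (simp_all add: numeral_2_eq_2)
    ultimately show ?thesis using Suc by simp
  qed
  finally show ?thesis .
qed

lemma sum_dg:
  "(\<Sum>e\<in>E. (k + d - dg e) choose d) \<le>
    (k + d choose d) + 2 * (r - 1) * (k + d - 1 choose d) + (r - 1 choose 2) * (k + d - 2 choose d)"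
proof -
  let ?g = "\<lambda>e. (k + d - dg e) choose d"
  have fin: "finite E1" "finite E2" using finite_E by (auto simp: E_def)
  have "E = {1} \<union> ((E1 - {1}) \<union> (E2 - E1 - {1}))" by (auto simp: E_def)
  then have "sum ?g E = sum ?g {1} + (sum ?g (E1 - {1}) + sum ?g (E2 - E1 - {1}))"
    using fin by (simp only:) (subst sum.union_disjoint; (subst sum.union_disjoint)?; auto)
  also have "sum ?g {1} = (k + d choose d)" by (simp add: dg_def)
  also have "sum ?g (E1 - {1}) = card (E1 - {1}) * (k + d - 1 choose d)"
    by (simp add: dg_def)
  also have "sum ?g (E2 - E1 - {1}) = card (E2 - E1 - {1}) * (k + d - 2 choose d)"
    by (simp add: dg_def)
  also have "(k + d choose d) + (card (E1 - {1}) * (k + d - 1 choose d) + card (E2 - E1 - {1}) * (k + d - 2 choose d))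
      \<le> (k + d choose d) + (2 * (r - 1) * (k + d - 1 choose d) + (r - 1 choose 2) * (k + d - 2 choose d))"
  proof (intro add_mono mult_right_mono order_refl)
    show "card (E1 - {1}) \<le> 2 * (r - 1)"
      by (rule order_trans[OF card_mono[OF fin(1)] card_E1]) auto
    show "card (E2 - E1 - {1}) \<le> (r - 1) choose 2"
      by (rule order_trans[OF card_mono[OF fin(2)] card_E2]) auto
  qed auto
  finally show ?thesis by simp
qed

end

section \<open>Binomial identities for the rank-one cone\<close>

lemma Suc_choose_eq: "Suc s * ((n + s) choose Suc s) = n * ((n + s) choose s)"
proof -
  have "Suc s * (Suc (n + s) choose Suc s) = Suc (n + s) * ((n + s) choose s)"
    by (rule Suc_times_binomial)
  then show ?thesis by (simp add: algebra_simps)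
qed

lemma pascal: "N = Suc M \<Longrightarrow> M' = M \<Longrightarrow> M'' = M \<Longrightarrow> j = Suc i \<Longrightarrow> N choose j = (M' choose j) + (M'' choose i)"
  by simp

text \<open>On the left, the number of monomials of degree \<open>n\<close> in \<open>3\<close> and
  in \<open>s + 1\<close> variables; on the right, the Hilbert function of a graded module free over
  \<open>s + 3\<close> parameters with h-vector \<open>1\<close>, \<open>2 * s\<close>,
  \<open>s choose 2\<close>.\<close>

lemma segre_hilbert_step:
  "((n + 2) choose 2) * ((n + s) choose s) =
    ((n + s + 2) choose (s + 2)) + 2 * s * ((n + s + 1) choose (s + 2)) + (s choose 2) * ((n + s) choose (s + 2))"
proof -
  let ?X = "(n + s) choose s"
  have two: "2 * (m choose 2) = m * (m - 1)" for m :: nat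
    using binomial_absorption[of 1 m] by (simp add: numeral_2_eq_2)
  have a: "Suc s * ((n + s) choose Suc s) = n * ?X" by (rule Suc_choose_eq)
  have b: "Suc s * ((n + s + 1) choose Suc s) = (n + s + 1) * ?X"
    using Suc_times_binomial[of s "n + s"] by simp
  have c1: "Suc (Suc s) * ((n + s + 2) choose (s + 2)) = (n + s + 2) * ((n + s + 1) choose Suc s)"
    using Suc_times_binomial[of "Suc s" "n + s + 1"] by simp
  have c2: "Suc (Suc s) * ((n + s + 1) choose (s + 2)) = n * ((n + s + 1) choose Suc s)"
    using Suc_choose_eq[of "Suc s" n] by simp
  have c3: "Suc (Suc s) * ((n + s) choose (s + 2)) = (n - 1) * ((n + s) choose Suc s)"
  proof (cases n)
    case (Suc n')
    then show ?thesis using Suc_choose_eq[of "Suc s" n'] by simp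
  qed (simp add: binomial_eq_0)
  \<comment> \<open>This factor clears denominators: after multiplication each term is a polynomial
    in \<open>n\<close> and \<open>s\<close> times \<open>?X\<close>.\<close>
  let ?N = "2 * Suc (Suc s) * Suc s"
  have l: "?N * (((n + 2) choose 2) * ?X) = Suc (Suc s) * Suc s * ((n + 2) * (n + 1)) * ?X"
  proof -
    have "?N * (((n + 2) choose 2) * ?X) = Suc (Suc s) * Suc s * (2 * ((n + 2) choose 2)) * ?X"
      by (simp only: mult_ac)
    also have "2 * ((n + 2) choose 2) = (n + 2) * (n + 1)" unfolding two by simp
    finally show ?thesis .
  qed
  have r1: "?N * ((n + s + 2) choose (s + 2)) = 2 * (n + s + 2) * (n + s + 1) * ?X"
  proof -
    have "?N * ((n + s + 2) choose (s + 2)) = 2 * Suc s * (Suc (Suc s) * ((n + s + 2) choose (s + 2)))"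
      by (simp only: mult_ac)
    also have "\<dots> = 2 * (n + s + 2) * (Suc s * ((n + s + 1) choose Suc s))"
      unfolding c1 by (simp only: mult_ac)
    finally show ?thesis unfolding b by (simp only: mult_ac)
  qed
  have r2: "?N * ((n + s + 1) choose (s + 2)) = 2 * n * (n + s + 1) * ?X"
  proof -
    have "?N * ((n + s + 1) choose (s + 2)) = 2 * Suc s * (Suc (Suc s) * ((n + s + 1) choose (s + 2)))"
      by (simp only: mult_ac)
    also have "\<dots> = 2 * n * (Suc s * ((n + s + 1) choose Suc s))"
      unfolding c2 by (simp only: mult_ac)
    finally show ?thesis unfolding b by (simp only: mult_ac)
  qed
  have r3: "?N * ((s choose 2) * ((n + s) choose (s + 2))) = s * (s - 1) * (n * (n - 1)) * ?X"
  proof -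
    have "?N * ((s choose 2) * ((n + s) choose (s + 2))) =
        (2 * (s choose 2)) * Suc s * (Suc (Suc s) * ((n + s) choose (s + 2)))"
      by (simp only: mult_ac)
    also have "\<dots> = (s * (s - 1)) * (n - 1) * (Suc s * ((n + s) choose Suc s))"
      unfolding c3 two by (simp only: mult_ac)
    finally show ?thesis unfolding a by (simp only: mult_ac)
  qed
  \<comment> \<open>The case split removes the truncated differences \<open>s - 1\<close> and
    \<open>n - 1\<close>.\<close>
  have id: "Suc (Suc s) * Suc s * ((n + 2) * (n + 1)) =
      2 * (n + s + 2) * (n + s + 1) + 2 * s * (2 * n * (n + s + 1)) + s * (s - 1) * (n * (n - 1))"
  proof (cases s; cases n)
    fix s' n' assume "s = Suc s'" "n = Suc n'"
    then show ?thesis by (simp add: algebra_simps)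
  qed (simp_all add: algebra_simps)
  have "?N * (((n + s + 2) choose (s + 2)) + 2 * s * ((n + s + 1) choose (s + 2)) + (s choose 2) * ((n + s) choose (s + 2)))
      = ?N * ((n + s + 2) choose (s + 2)) + 2 * s * (?N * ((n + s + 1) choose (s + 2)))
        + ?N * ((s choose 2) * ((n + s) choose (s + 2)))"
    by (simp only: distrib_left mult_ac)
  also have "\<dots> = (2 * (n + s + 2) * (n + s + 1) + 2 * s * (2 * n * (n + s + 1)) + s * (s - 1) * (n * (n - 1))) * ?X"
    unfolding r1 r2 r3 by (simp only: distrib_right mult.assoc)
  also have "\<dots> = ?N * (((n + 2) choose 2) * ?X)" unfolding l id ..
  finally show ?thesis by (metis mult_cancel1 mult_eq_0_iff nat.distinct(1) zero_neq_numeral)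
qed

text \<open>Summation over degrees raises the lower binomial entries by one; each increment is an
  instance of Pascal's rule.\<close>

lemma segre_hilbert:
  "(\<Sum>n\<le>k. ((n + 2) choose 2) * ((n + s) choose s)) =
    (k + (s + 3) choose (s + 3)) + 2 * s * (k + (s + 3) - 1 choose (s + 3)) + (s choose 2) * (k + (s + 3) - 2 choose (s + 3))"
proof (induction k)
  case 0
  have "((0::nat) + 2) choose 2 = 1" by (simp add: numeral_2_eq_2)
  moreover have "(0 + (s + 3) - 1) choose (s + 3) = 0" "(0 + (s + 3) - 2) choose (s + 3) = 0"
    by (rule binomial_eq_0; simp)+
  ultimately show ?case by simp
next
  case (Suc k)
  have e: "(Suc k + (s + 3) choose (s + 3)) = (k + (s + 3) choose (s + 3)) + (Suc k + s + 2 choose (s + 2))"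
    "(Suc k + (s + 3) - 1 choose (s + 3)) = (k + (s + 3) - 1 choose (s + 3)) + (Suc k + s + 1 choose (s + 2))"
    "(Suc k + (s + 3) - 2 choose (s + 3)) = (k + (s + 3) - 2 choose (s + 3)) + (Suc k + s choose (s + 2))"
    by (rule pascal; simp)+
  have lin: "(A + t * B + q * C) + (a + t * b + q * c) = (A + a) + t * (B + b) + q * (C + c)"
    for A B C a b c q t :: nat by (simp add: algebra_simps)
  show ?case
    by (simp only: sum.atMost_Suc Suc.IH segre_hilbert_step[of "Suc k"] e) (rule lin)
qed

section \<open>Parameters for the nilpotent cone\<close>

locale nilpotent_params =
  fixes s t :: "('y, 'k::field) mpoly" and Y :: "int \<Rightarrow> ('y, 'k) mpoly" and r :: nat
  assumes r: "0 < r" and Y_0: "i < 0 \<or> int r \<le> i \<Longrightarrow> Y i = 0"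
begin

text \<open>The coefficient of \<open>T ^ l\<close> in the product of \<open>s^2 - t^2 T\<close>
  with the generating polynomial of \<open>Y\<close>, which can be nonzero only for
  \<open>0 \<le> l \<le> r\<close>.\<close>

definition "\<Theta> l = s * s * Y l - t * t * Y (l - 1)"

text \<open>The parameters express \<open>s * s * Y 0\<close> and trade each
  \<open>t * t * Y i\<close> for \<open>s * s * Y (i + 1)\<close>; these \<open>2 * r - 1\<close>
  generators are left.\<close>

definition "E1 = (\<lambda>i. s * s * Y (int i)) ` {1..<r} \<union> (\<lambda>i. s * t * Y (int i)) ` {..<r}"

definition "E = {1} \<union> E1"

definition dg :: "('y, 'k) mpoly \<Rightarrow> nat" where "dg e = (if e = 1 then 0 else 1)"

abbreviation "M \<equiv> span_le (\<lambda>j. \<Theta> (int j)) (r + 1) E dg"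

lemma \<Theta>_mult: "f \<in> M k \<Longrightarrow> \<Theta> l * f \<in> M (Suc k)"
proof (cases "0 \<le> l \<and> l < int (r + 1)")
  case True
  assume "f \<in> M k"
  moreover have "nat l < r + 1" using True by linarith
  ultimately show ?thesis
    using span_le_param[where \<theta> = "\<lambda>j. \<Theta> (int j)" and j = "nat l" and d = "r + 1"] True by simp
next
  case False
  then have "\<Theta> l = 0" by (auto simp: \<Theta>_def Y_0)
  then show ?thesis by simp
qed

lemma one: "1 \<in> M 0"
  by (rule span_le_base) (auto simp: E_def dg_def)

lemma \<Theta>_M1: "\<Theta> l \<in> M 1"
  using \<Theta>_mult[OF one, of l] by simp

lemma \<Theta>_M2: "f \<in> M 1 \<Longrightarrow> \<Theta> l * f \<in> M 2"
  using \<Theta>_mult[of f 1 l] by (simp add: numeral_2_eq_2)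

lemma deg1_ss: "s * s * Y i \<in> M 1"
proof -
  consider "i < 0 \<or> int r \<le> i" | "i = 0" | "1 \<le> i" "i < int r" by linarith
  then show ?thesis
  proof cases
    case 2
    then have "s * s * Y i = \<Theta> 0" by (simp add: \<Theta>_def Y_0)
    then show ?thesis using \<Theta>_M1 by simp
  next
    case 3
    then have "s * s * Y i \<in> E1"
      unfolding E1_def by (intro UnI1 image_eqI[of _ _ "nat i"]) auto
    then show ?thesis by (intro span_le_base) (auto simp: E_def dg_def)
  qed (simp add: Y_0)
qed

lemma deg1_st: "s * t * Y i \<in> M 1"
proof (cases "0 \<le> i \<and> i < int r")
  case True
  then have "s * t * Y i \<in> E1"
    unfolding E1_def by (intro UnI2 image_eqI[of _ _ "nat i"]) auto
  then show ?thesis by (intro span_le_base) (auto simp: E_def dg_def)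
next
  case False
  then have "Y i = 0" using Y_0 by auto
  then show ?thesis by simp
qed

lemma deg1_tt: "t * t * Y i \<in> M 1"
proof -
  have "s * s * Y (i + 1) - \<Theta> (i + 1) \<in> M 1" by (intro span_le_diff deg1_ss \<Theta>_M1)
  then show ?thesis by (simp add: \<Theta>_def)
qed

text \<open>The terms with \<open>s\<close> to the fourth power cancel in the antisymmetric
  combination, leaving a shift difference.\<close>

lemma deg2_sstt: "s * s * t * t * Y i * Y j \<in> M 2"
proof (rule shift_invariant[where f = "\<lambda>i j. s * s * t * t * Y i * Y j"])
  fix i j :: int
  have "\<Theta> j * (s * s * Y (i + 1)) - \<Theta> (i + 1) * (s * s * Y j) \<in> M 2"
    by (intro span_le_diff \<Theta>_M2 deg1_ss)
  then show "s * s * t * t * Y i * Y j - s * s * t * t * Y (i + 1) * Y (j - 1) \<in> M 2"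
    by (simp add: \<Theta>_def algebra_simps)
qed (auto simp: Y_0 span_le_add)

lemma deg2_ssss: "s * s * s * s * Y i * Y j \<in> M 2"
proof -
  have "\<Theta> i * (s * s * Y j) + s * s * t * t * Y (i - 1) * Y j \<in> M 2"
    by (intro span_le_add \<Theta>_M2 deg1_ss deg2_sstt)
  then show ?thesis by (simp add: \<Theta>_def algebra_simps)
qed

lemma deg2_sttt: "s * t * t * t * Y i * Y j \<in> M 2"
proof (rule shift_invariant[where f = "\<lambda>i j. s * t * t * t * Y i * Y j"])
  fix i j :: int
  have "\<Theta> j * (s * t * Y (i + 1)) - \<Theta> (i + 1) * (s * t * Y j) \<in> M 2"
    by (intro span_le_diff \<Theta>_M2 deg1_st)
  then show "s * t * t * t * Y i * Y j - s * t * t * t * Y (i + 1) * Y (j - 1) \<in> M 2"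
    by (simp add: \<Theta>_def algebra_simps)
qed (auto simp: Y_0 span_le_add)

lemma deg2_ssst: "s * s * s * t * Y i * Y j \<in> M 2"
proof -
  have "\<Theta> i * (s * t * Y j) + s * t * t * t * Y (i - 1) * Y j \<in> M 2"
    by (intro span_le_add \<Theta>_M2 deg1_st deg2_sttt)
  then show ?thesis by (simp add: \<Theta>_def algebra_simps)
qed

text \<open>Since \<open>E1\<close> has no elements \<open>t * t * Y i\<close>, a product of a
  generator with a basis element always contains a factor \<open>s\<close>, and the four degree-two
  lemmas cover all cases.\<close>

lemma generator_mult:
  assumes q: "q \<in> {s * s, s * t, t * t}" and f: "f \<in> M k"
  shows "q * Y i * f \<in> M (Suc k)"
proof (rule span_le_mult[OF f])
  fix e assume e: "e \<in> E"
  show "q * Y i * e \<in> M (Suc (dg e))"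
  proof (cases "e = 1")
    case True
    then show ?thesis using q deg1_ss deg1_st deg1_tt by (auto simp: dg_def)
  next
    case False
    then have "dg e = 1" by (simp add: dg_def)
    moreover obtain j q' where "e = q' * Y j" "q' \<in> {s * s, s * t}" using e False unfolding E_def E1_def by auto
    then have "q * Y i * e \<in> M 2"
      using q deg2_ssss[of i j] deg2_ssst[of i j] deg2_sstt[of i j] deg2_sttt[of i j]
      by (auto simp: mult_ac)
    ultimately show ?thesis by (simp add: numeral_2_eq_2)
  qed
qed

lemma finite_E: "finite E"
  by (simp add: E_def E1_def)

lemma sum_dg:
  "(\<Sum>e\<in>E. (k + d - dg e) choose d) \<le> (k + d choose d) + (2 * r - 1) * (k + d - 1 choose d)"
proof -
  let ?g = "\<lambda>e. (k + d - dg e) choose d"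
  have fin: "finite E1" by (simp add: E1_def)
  have "card E1 \<le> card ((\<lambda>i. s * s * Y (int i)) ` {1..<r}) + card ((\<lambda>i. s * t * Y (int i)) ` {..<r})"
    unfolding E1_def by (rule card_Un_le)
  also have "\<dots> \<le> (r - 1) + r"
    using card_image_le[of "{1..<r}"] card_image_le[of "{..<r}"] by (intro add_mono) force+
  finally have c: "card E1 \<le> 2 * r - 1" using r by simp
  have "E = {1} \<union> (E1 - {1})" by (auto simp: E_def)
  then have "sum ?g E = sum ?g {1} + sum ?g (E1 - {1})"
    using fin by (simp only:) (subst sum.union_disjoint; auto)
  also have "sum ?g {1} = (k + d choose d)" by (simp add: dg_def)
  also have "sum ?g (E1 - {1}) = card (E1 - {1}) * (k + d - 1 choose d)"
    by (simp add: dg_def)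
  also have "(k + d choose d) + card (E1 - {1}) * (k + d - 1 choose d) \<le> (k + d choose d) + (2 * r - 1) * (k + d - 1 choose d)"
    using card_mono[OF fin, of "E1 - {1}"] c by (intro add_mono mult_right_mono order_refl) auto
  finally show ?thesis .
qed

end

text \<open>The Hilbert function for the h-vector \<open>1\<close>, \<open>2 * s + 1\<close> over
  \<open>s + 2\<close> parameters; \<open>2 * n + 1\<close> counts the binary monomials of degree
  \<open>2 * n\<close>.\<close>

lemma nilpotent_hilbert:
  "(\<Sum>n\<le>k. ((2 * n + 1) choose 1) * ((n + s) choose s)) =
    (k + (s + 2) choose (s + 2)) + (2 * s + 1) * (k + (s + 2) - 1 choose (s + 2))"
proof (induction k)
  case 0
  have "(0 + (s + 2) - 1) choose (s + 2) = 0" by (rule binomial_eq_0) simp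
  then show ?case by simp
next
  case (Suc k)
  let ?n = "Suc k"
  have "Suc s * ((?n + s) choose Suc s) = ?n * ((?n + s) choose s)" by (rule Suc_choose_eq)
  moreover have "(?n + s + 1) choose Suc s = ((?n + s) choose Suc s) + ((?n + s) choose s)"
    by (rule pascal) simp_all
  ultimately have st: "((2 * ?n + 1) choose 1) * ((?n + s) choose s) =
      ((?n + s + 1) choose Suc s) + (2 * s + 1) * ((?n + s) choose Suc s)"
    by (simp add: algebra_simps)
  have e: "(?n + (s + 2) choose (s + 2)) = (k + (s + 2) choose (s + 2)) + (?n + s + 1 choose Suc s)"
    "(?n + (s + 2) - 1 choose (s + 2)) = (k + (s + 2) - 1 choose (s + 2)) + (?n + s choose Suc s)"
    by (rule pascal; simp)+
  have lin: "(A + t * B) + (a + t * b) = (A + a) + t * (B + b)" for A B a b t :: nat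
    by (simp add: algebra_simps)
  show ?case
    by (simp only: sum.atMost_Suc Suc.IH st e) (rule lin)
qed

section \<open>Bases for the three varieties\<close>

definition yvar :: "nat \<Rightarrow> nat \<Rightarrow> int \<Rightarrow> (nat, 'k::field) mpoly"
  where "yvar c r i = (if 0 \<le> i \<and> i < int r then var (c + nat i) else 0)"

lemma wt_single: "wt w (single v n) = w v * int n"
  by (cases "n = 0") (auto simp: wt_def)

lemma var_mult_var_invs:
  assumes "u \<in> V" "v \<in> V" "w u + w v = 0"
  shows "var u * var v \<in> (invs V w :: ('x, 'k::field) mpoly set)"
proof -
  have "keys (single u 1 + single v (1::nat)) \<subseteq> V"
    using assms(1,2) Poly_Mapping.keys_add[of "single u 1" "single v (1::nat)"] by auto
  then show ?thesis
    using assms(3) by (auto simp: var_def mult_single invs_def wt_add wt_single)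
qed

lemma var_mult_var_var_invs:
  assumes "t \<in> V" "u \<in> V" "v \<in> V" "w t + w u + w v = 0"
  shows "var t * var u * var v \<in> (invs V w :: ('x, 'k::field) mpoly set)"
proof -
  have "keys (single t 1 + single u 1 + single v (1::nat)) \<subseteq> V"
    using assms(1-3) Poly_Mapping.keys_add[of "single t 1" "single u (1::nat)"]
      Poly_Mapping.keys_add[of "single t 1 + single u 1" "single v (1::nat)"] by auto
  then show ?thesis
    using assms(4) by (auto simp: var_def mult_single invs_def wt_add wt_single)
qed

lemma exps_eq_3_1:
  assumes "\<alpha> \<in> exps_eq {..<Suc 2} 1"
  shows "single \<alpha> 1 \<in> ({var 0, var 1, var 2} :: (nat, 'k::field) mpoly set)"
proof -
  have k: "keys \<alpha> \<subseteq> {..<Suc 2}" and d: "tdeg \<alpha> = 1" using assms by (auto simp: exps_eq_def)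
  have eq: "single \<alpha> 1 = (\<Prod>i<Suc 2. var i ^ lookup \<alpha> i :: (nat, 'k) mpoly)"
    by (rule single_eq_prod_var[OF finite_lessThan k])
  have "lookup \<alpha> 0 + lookup \<alpha> 1 + lookup \<alpha> 2 = 1"
    using d unfolding tdeg_superset[OF finite_lessThan k] by (simp add: numeral_2_eq_2)
  then consider "lookup \<alpha> 0 = 1" "lookup \<alpha> 1 = 0" "lookup \<alpha> 2 = 0"
    | "lookup \<alpha> 0 = 0" "lookup \<alpha> 1 = 1" "lookup \<alpha> 2 = 0"
    | "lookup \<alpha> 0 = 0" "lookup \<alpha> 1 = 0" "lookup \<alpha> 2 = 1" by linarith
  then show ?thesis unfolding eq by cases (simp_all add: numeral_2_eq_2)
qed

lemma exps_eq_2_2: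
  assumes "\<alpha> \<in> exps_eq {..<Suc 1} 2"
  shows "single \<alpha> 1 \<in> ({var 0 * var 0, var 0 * var 1, var 1 * var 1} :: (nat, 'k::field) mpoly set)"
proof -
  have k: "keys \<alpha> \<subseteq> {..<Suc 1}" and d: "tdeg \<alpha> = 2" using assms by (auto simp: exps_eq_def)
  have eq: "single \<alpha> 1 = (\<Prod>i<Suc 1. var i ^ lookup \<alpha> i :: (nat, 'k) mpoly)"
    by (rule single_eq_prod_var[OF finite_lessThan k])
  have "lookup \<alpha> 0 + lookup \<alpha> 1 = 2"
    using d unfolding tdeg_superset[OF finite_lessThan k] by simp
  then consider "lookup \<alpha> 0 = 2" "lookup \<alpha> 1 = 0" | "lookup \<alpha> 0 = 1" "lookup \<alpha> 1 = 1"
    | "lookup \<alpha> 0 = 0" "lookup \<alpha> 1 = 2" by linarith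
  then show ?thesis unfolding eq by cases (simp_all add: power2_eq_square)
qed

lemma segre_free_basis:
  assumes "0 < r"
  obtains \<theta> and E :: "(nat, 'k::field) mpoly set"
  where "free_basis (invs {..<3 + r} (wgt 3 r 1)) \<theta> (r + 2) E"
proof -
  obtain s where s: "r = Suc s" using assms by (cases r) auto
  let ?Y = "yvar 3 r :: int \<Rightarrow> (nat, 'k) mpoly"
  interpret rank_one_params "var 0" "var 1" "var 2" ?Y r
    by unfold_locales (use assms in \<open>auto simp: yvar_def\<close>)
  let ?R = "invs {..<Suc 2 + Suc s} (wgt (Suc 2) (Suc s) 1) :: (nat, 'k) mpoly set"
  have gen: "var a * ?Y i \<in> ?R" if "a < 3" for a i
  proof (cases "0 \<le> i \<and> i < int r")
    case True
    then have "nat i < r" by auto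
    then show ?thesis using True that
      by (auto simp: yvar_def s wgt_def intro!: var_mult_var_invs)
  qed (auto simp: yvar_def)
  have "free_basis ?R (\<lambda>j. \<Theta> (int j)) (r + 2) E"
  proof (rule free_basis_wgt[OF finite_E])
    have E1: "E1 \<subseteq> ?R" unfolding E1_def using gen[of 1] gen[of 2] by auto
    have E2: "E2 \<subseteq> ?R"
    proof
      fix e assume "e \<in> E2"
      then obtain i j :: nat where "e = (var 2 * ?Y (int i)) * (var 2 * ?Y (int j))" unfolding E2_def by (auto simp: mult_ac)
      then show "e \<in> ?R" using invs_mult[OF gen[of 2 "int i"] gen[of 2 "int j"]] by simp
    qed
    show "E \<subseteq> ?R" unfolding E_def using E1 E2 by auto
    show "\<Theta> (int j) \<in> ?R" for j
      unfolding \<Theta>_def by (intro invs_add gen) auto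
    show "1 \<in> M 0" by (rule one)
    show "dg e \<le> r + 2" for e unfolding dg_def by simp
    show "single \<alpha> 1 * var (Suc 2 + i) * f \<in> M (Suc n)"
      if "\<alpha> \<in> exps_eq {..<Suc 2} 1" "i < Suc s" "f \<in> M n" for n \<alpha> i f
    proof -
      have "?Y (int i) = var (Suc 2 + i)" using that(2) by (simp add: yvar_def s)
      then show ?thesis using generator_mult[OF exps_eq_3_1[OF that(1)] that(3), of "int i"] by (simp only:)
    qed
    show "(\<Sum>e\<in>E. (k + (r + 2) - dg e) choose (r + 2)) \<le> (\<Sum>n\<le>k. ((1 * n + 2) choose 2) * ((n + s) choose s))" for k
    proof -
      have "r + 2 = s + 3" "r - 1 = s" using s by simp_all
      then show ?thesis using sum_dg[of k "r + 2"] segre_hilbert[where k = k and s = s] by (simp only: mult_1_left)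
    qed
  qed
  moreover have "Suc 2 = (3::nat)" by simp
  ultimately have "free_basis (invs {..<3 + r} (wgt 3 r 1)) (\<lambda>j. \<Theta> (int j)) (r + 2) E"
    by (simp only: s)
  then show thesis by (rule that)
qed

lemma nilpotent_free_basis:
  assumes "0 < r"
  obtains \<theta> and E :: "(nat, 'k::field) mpoly set"
  where "free_basis (invs {..<2 + r} (wgt 2 r 2)) \<theta> (r + 1) E"
proof -
  obtain s where s: "r = Suc s" using assms by (cases r) auto
  let ?Y = "yvar 2 r :: int \<Rightarrow> (nat, 'k) mpoly"
  interpret nilpotent_params "var 0" "var 1" ?Y r
    by unfold_locales (use assms in \<open>auto simp: yvar_def\<close>)
  let ?R = "invs {..<Suc 1 + Suc s} (wgt (Suc 1) (Suc s) 2) :: (nat, 'k) mpoly set"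
  have gen: "var a * var b * ?Y i \<in> ?R" if "a < 2" "b < 2" for a b i
  proof (cases "0 \<le> i \<and> i < int r")
    case True
    then have "nat i < r" by auto
    then show ?thesis using True that
      by (auto simp: yvar_def s wgt_def intro!: var_mult_var_var_invs)
  qed (auto simp: yvar_def)
  have "free_basis ?R (\<lambda>j. \<Theta> (int j)) (r + 1) E"
  proof (rule free_basis_wgt[OF finite_E])
    show "E \<subseteq> ?R" unfolding E_def E1_def using gen[of 0 0] gen[of 0 1] by auto
    show "\<Theta> (int j) \<in> ?R" for j
      unfolding \<Theta>_def by (intro invs_diff gen) auto
    show "1 \<in> M 0" by (rule one)
    show "dg e \<le> r + 1" for e unfolding dg_def by simp
    show "single \<alpha> 1 * var (Suc 1 + i) * f \<in> M (Suc n)"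
      if "\<alpha> \<in> exps_eq {..<Suc 1} 2" "i < Suc s" "f \<in> M n" for n \<alpha> i f
    proof -
      have "?Y (int i) = var (Suc 1 + i)" using that(2) by (simp add: yvar_def s)
      then show ?thesis using generator_mult[OF exps_eq_2_2[OF that(1)] that(3), of "int i"] by (simp only:)
    qed
    show "(\<Sum>e\<in>E. (k + (r + 1) - dg e) choose (r + 1)) \<le> (\<Sum>n\<le>k. ((2 * n + 1) choose 1) * ((n + s) choose s))" for k
    proof -
      have "r + 1 = s + 2" "2 * r - 1 = 2 * s + 1" using s by simp_all
      then show ?thesis using sum_dg[of k "r + 1"] nilpotent_hilbert[where k = k and s = s] by (simp only:)
    qed
  qed
  moreover have "Suc 1 = (2::nat)" by simp
  ultimately have "free_basis (invs {..<2 + r} (wgt 2 r 2)) (\<lambda>j. \<Theta> (int j)) (r + 1) E"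
    by (simp only: s)
  then show thesis by (rule that)
qed

lemma psub_image_add: "f \<in> psub \<tau> ` pv S \<Longrightarrow> g \<in> psub \<tau> ` pv S \<Longrightarrow> f + g \<in> psub \<tau> ` pv S"
  and psub_image_mult: "f \<in> psub \<tau> ` pv S \<Longrightarrow> g \<in> psub \<tau> ` pv S \<Longrightarrow> f * g \<in> psub \<tau> ` pv S"
  and psub_image_cst: "cst c \<in> psub \<tau> ` pv S"
  and psub_image_var: "s \<in> S \<Longrightarrow> \<tau> s \<in> psub \<tau> ` pv S"
  for \<tau> :: "'s \<Rightarrow> ('y, 'k::field) mpoly"
proof -
  show "f + g \<in> psub \<tau> ` pv S" if "f \<in> psub \<tau> ` pv S" "g \<in> psub \<tau> ` pv S"
    using that by (auto simp flip: cst_hom.ev_add intro: pv_add)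
  show "f * g \<in> psub \<tau> ` pv S" if "f \<in> psub \<tau> ` pv S" "g \<in> psub \<tau> ` pv S"
    using that by (auto simp flip: cst_hom.ev_mult intro: pv_mult)
  show "cst c \<in> psub \<tau> ` pv S" by (rule image_eqI[of _ _ "cst c"]) simp_all
  show "\<tau> s \<in> psub \<tau> ` pv S" if "s \<in> S" by (rule image_eqI[of _ _ "var s"]) (simp_all add: pv_var that)
qed

lemma psub_image_eq_invs:
  fixes \<tau> :: "'s \<Rightarrow> ('y, 'k::field) mpoly"
  assumes "\<And>s. s \<in> S \<Longrightarrow> \<tau> s \<in> invs V w"
    and "\<And>m. keys m \<subseteq> V \<Longrightarrow> wt w m = 0 \<Longrightarrow> single m 1 \<in> psub \<tau> ` pv S"
  shows "psub \<tau> ` pv S = invs V w"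
proof
  show "psub \<tau> ` pv S \<subseteq> invs V w"
    using assms(1) by (intro image_subsetI ev_in_subsemiring) (auto intro: invs_add invs_mult)
  show "invs V w \<subseteq> psub \<tau> ` pv S"
  proof
    fix f :: "('y, 'k) mpoly" assume f: "f \<in> invs V w"
    show "f \<in> psub \<tau> ` pv S"
    proof (rule invs_in_subspace[OF assms(2) _ _ _ f])
      show "0 \<in> psub \<tau> ` pv S" using psub_image_cst[of 0 \<tau> S] by simp
      show "x + y \<in> psub \<tau> ` pv S" if "x \<in> psub \<tau> ` pv S" "y \<in> psub \<tau> ` pv S" for x y
        by (rule psub_image_add[OF that])
      show "cst c * x \<in> psub \<tau> ` pv S" if "x \<in> psub \<tau> ` pv S" for c x
        by (rule psub_image_mult[OF psub_image_cst that])
    qed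
  qed
qed

lemma psub_image_wgt_monomial:
  fixes \<tau> :: "'s \<Rightarrow> (nat, 'k::field) mpoly"
  assumes "\<And>\<alpha> i. \<alpha> \<in> exps_eq {..<c} b \<Longrightarrow> i < r \<Longrightarrow> single \<alpha> 1 * var (c + i) \<in> psub \<tau> ` pv S"
    and "keys m \<subseteq> {..<c + r}" "wt (wgt c r b) m = 0"
  shows "single m 1 \<in> psub \<tau> ` pv S"
  by (rule wgt_monomial_induct[where A = "\<lambda>_. psub \<tau> ` pv S", OF _ _ assms(2,3)])
    (use psub_image_cst[of 1 \<tau> S] psub_image_mult[OF assms(1)] in auto)

section \<open>Commuting tuples of 2 by 2 matrices\<close>

abbreviation ent :: "'k^2^2 \<Rightarrow> 2 \<Rightarrow> 2 \<Rightarrow> 'k"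
  where "ent A i j \<equiv> A $ i $ j"

text \<open>The three equations are the minors of the two rows formed by upper entry, difference of
  the diagonal entries, and lower entry: matrices commute when their traceless parts are
  proportional.\<close>

lemma lie_bracket_2:
  fixes A B :: "'k::field^2^2"
  shows "lie_bracket A B = 0 \<longleftrightarrow> ent A 1 2 * ent B 2 1 = ent B 1 2 * ent A 2 1 \<and>
    (ent A 1 1 - ent A 2 2) * ent B 1 2 = (ent B 1 1 - ent B 2 2) * ent A 1 2 \<and>
    (ent A 1 1 - ent A 2 2) * ent B 2 1 = (ent B 1 1 - ent B 2 2) * ent A 2 1"
proof -
  let ?a = "ent A 1 1" and ?b = "ent A 1 2" and ?c = "ent A 2 1" and ?d = "ent A 2 2"
  let ?a' = "ent B 1 1" and ?b' = "ent B 1 2" and ?c' = "ent B 2 1" and ?d' = "ent B 2 2"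
  have entry: "ent (M ** N) i j = ent M i 1 * ent N 1 j + ent M i 2 * ent N 2 j" for M N :: "'k^2^2" and i j
    by (simp add: matrix_matrix_mult_def sum_2)
  have "lie_bracket A B = 0 \<longleftrightarrow>
      (?a * ?a' + ?b * ?c') - (?a' * ?a + ?b' * ?c) = 0 \<and> (?a * ?b' + ?b * ?d') - (?a' * ?b + ?b' * ?d) = 0 \<and>
      (?c * ?a' + ?d * ?c') - (?c' * ?a + ?d' * ?c) = 0 \<and> (?c * ?b' + ?d * ?d') - (?c' * ?b + ?d' * ?d) = 0"
    unfolding lie_bracket_def vec_eq_iff forall_2 by (simp only: vector_minus_component entry zero_index conj_assoc)
  also have "(?a * ?a' + ?b * ?c') - (?a' * ?a + ?b' * ?c) = ?b * ?c' - ?b' * ?c"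
    by (simp add: algebra_simps)
  also have "(?a * ?b' + ?b * ?d') - (?a' * ?b + ?b' * ?d) = (?a - ?d) * ?b' - (?a' - ?d') * ?b"
    by (simp add: algebra_simps)
  also have "(?c * ?a' + ?d * ?c') - (?c' * ?a + ?d' * ?c) = - ((?a - ?d) * ?c' - (?a' - ?d') * ?c)"
    by (simp add: algebra_simps)
  also have "(?c * ?b' + ?d * ?d') - (?c' * ?b + ?d' * ?d) = - (?b * ?c' - ?b' * ?c)"
    by (simp add: algebra_simps)
  finally show ?thesis
    unfolding neg_equal_0_iff_equal right_minus_eq by blast
qed

text \<open>Any nonzero vector of the family serves as the common direction, and a nonzero
  coordinate of it gives the factors \<open>y i\<close>.\<close>

lemma rank_one_tuple:
  fixes b h c :: "nat \<Rightarrow> 'k::field"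
  assumes "\<And>i j. i < r \<Longrightarrow> j < r \<Longrightarrow> b i * c j = b j * c i \<and> h i * b j = h j * b i \<and> h i * c j = h j * c i"
  shows "\<exists>x0 x1 x2 y. \<forall>i<r. b i = x0 * y i \<and> h i = x1 * y i \<and> c i = x2 * y i"
proof (cases "\<forall>i<r. b i = 0 \<and> h i = 0 \<and> c i = 0")
  case True
  then show ?thesis by (intro exI[of _ 0]) auto
next
  case False
  then obtain j where j: "j < r" "b j \<noteq> 0 \<or> h j \<noteq> 0 \<or> c j \<noteq> 0" by blast
  then consider "b j \<noteq> 0" | "h j \<noteq> 0" | "c j \<noteq> 0" by blast
  then show ?thesis
  proof cases
    case 1
    have "\<forall>i<r. b i = b j * (b i / b j) \<and> h i = h j * (b i / b j) \<and> c i = c j * (b i / b j)"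
      using assms[OF _ j(1)] 1 by (simp add: nonzero_eq_divide_eq mult_ac)
    then show ?thesis
      by (intro exI[of _ "b j"] exI[of _ "h j"] exI[of _ "c j"] exI[of _ "\<lambda>i. b i / b j"])
  next
    case 2
    have "\<forall>i<r. b i = b j * (h i / h j) \<and> h i = h j * (h i / h j) \<and> c i = c j * (h i / h j)"
      using assms[OF _ j(1)] 2 by (simp add: nonzero_eq_divide_eq mult_ac)
    then show ?thesis
      by (intro exI[of _ "b j"] exI[of _ "h j"] exI[of _ "c j"] exI[of _ "\<lambda>i. h i / h j"])
  next
    case 3
    have "\<forall>i<r. b i = b j * (c i / c j) \<and> h i = h j * (c i / c j) \<and> c i = c j * (c i / c j)"
      using assms[OF _ j(1)] 3 by (simp add: nonzero_eq_divide_eq mult_ac)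
    then show ?thesis
      by (intro exI[of _ "b j"] exI[of _ "h j"] exI[of _ "c j"] exI[of _ "\<lambda>i. c i / c j"])
  qed
qed

text \<open>For trace zero the condition says \<open>det A = 0\<close>. Determinants are
  multiplicative, so nilpotent matrices satisfy it; conversely \<open>A ** A\<close> is the scalar
  matrix of \<open>- det A\<close>.\<close>

lemma nilpotent_matrix_2:
  fixes A :: "'k::field^2^2"
  assumes "trace A = 0"
  shows "nilpotent_matrix A \<longleftrightarrow> ent A 1 1 * ent A 1 1 + ent A 1 2 * ent A 2 1 = 0"
proof -
  have tr: "ent A 2 2 = - ent A 1 1"
    using assms by (simp add: trace_def sum_2 eq_neg_iff_add_eq_0 add.commute)
  have dt: "det A = 0 \<longleftrightarrow> ent A 1 1 * ent A 1 1 + ent A 1 2 * ent A 2 1 = 0"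
  proof -
    have "det A = - (ent A 1 1 * ent A 1 1 + ent A 1 2 * ent A 2 1)" by (simp add: det_2 tr)
    then show ?thesis by (simp only: neg_equal_0_iff_equal)
  qed
  have pow: "det ((((**) A) ^^ m) (mat 1)) = det A ^ m" for m
    by (induction m) (simp_all add: det_mul)
  have "det A = 0" if nil: "nilpotent_matrix A"
  proof -
    obtain m where m: "(((**) A) ^^ m) (mat 1) = 0" using nil unfolding nilpotent_matrix_def by blast
    have "det A ^ m = 0" unfolding pow[symmetric] m by (simp add: det_2)
    then show ?thesis by simp
  qed
  moreover have "nilpotent_matrix A" if "ent A 1 1 * ent A 1 1 + ent A 1 2 * ent A 2 1 = 0"
  proof -
    have bc: "ent A 1 2 * ent A 2 1 = - (ent A 1 1 * ent A 1 1)"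
      using that by (simp add: eq_neg_iff_add_eq_0 add.commute)
    have "A ** A = 0"
      using bc bc[unfolded mult.commute[of "ent A 1 2"]]
      by (simp add: vec_eq_iff forall_2 matrix_matrix_mult_def sum_2 tr mult.commute)
    then have "(((**) A) ^^ 2) (mat 1) = 0" by (simp add: numeral_2_eq_2)
    then show ?thesis unfolding nilpotent_matrix_def ..
  qed
  ultimately show ?thesis using dt by blast
qed

definition coord_param ::
  "(nat \<Rightarrow> 'a) \<Rightarrow> (nat \<Rightarrow> 'a) \<Rightarrow> (nat \<Rightarrow> 'a) \<Rightarrow> (nat \<Rightarrow> 'a) \<Rightarrow> nat \<times> 2 \<times> 2 \<Rightarrow> 'a"
  where "coord_param a b c d = (\<lambda>(i, j, l).
    if j = 1 then if l = 1 then a i else b i else if l = 1 then c i else d i)"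

lemma coord_param_simps [simp]:
  "coord_param a b c d (i, 1, 1) = a i" "coord_param a b c d (i, 1, 2) = b i"
  "coord_param a b c d (i, 2, 1) = c i" "coord_param a b c d (i, 2, 2) = d i"
  by (simp_all add: coord_param_def)

text \<open>Separates the bookkeeping of tuples and entry functions from the matrix algebra. The
  hypotheses use all pairs of indices; the symmetry of the commutation equations bridges to
  \<open>i \<le> j\<close>.\<close>

lemma commuting_variety_parametrized:
  fixes W :: "('k::field^2^2) set" and a b c d :: "nat \<Rightarrow> (nat, 'k) mpoly"
  assumes inf: "infinite (UNIV :: 'k set)" and fin: "finite V"
    and pv: "\<And>i. i < r \<Longrightarrow> a i \<in> pv V \<and> b i \<in> pv V \<and> c i \<in> pv V \<and> d i \<in> pv V"
    and sound: "\<And>x v. (\<And>i. i < r \<Longrightarrow> ent (v i) 1 1 = poly_eval x (a i) \<and> ent (v i) 1 2 = poly_eval x (b i) \<and>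
      ent (v i) 2 1 = poly_eval x (c i) \<and> ent (v i) 2 2 = poly_eval x (d i)) \<Longrightarrow>
      (\<forall>i<r. v i \<in> W) \<and> (\<forall>i<r. \<forall>j<r. lie_bracket (v i) (v j) = 0)"
    and complete: "\<And>v. (\<forall>i<r. v i \<in> W) \<Longrightarrow> (\<forall>i<r. \<forall>j<r. lie_bracket (v i) (v j) = 0) \<Longrightarrow>
      \<exists>x. \<forall>i<r. ent (v i) 1 1 = poly_eval x (a i) \<and> ent (v i) 1 2 = poly_eval x (b i) \<and>
        ent (v i) 2 1 = poly_eval x (c i) \<and> ent (v i) 2 2 = poly_eval x (d i)"
  shows "parametrized_variety (entry_vars r) V (coord_param a b c d) (commuting_variety r W)"
proof
  show "infinite (UNIV :: 'k set)" "finite V" by (rule inf, rule fin)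
  fix s :: "nat \<times> 2 \<times> 2" assume "s \<in> entry_vars r"
  then show "coord_param a b c d s \<in> pv V"
    using pv by (auto simp: entry_vars_def coord_param_def)
next
  have ext: "(\<lambda>s\<in>entry_vars r. poly_eval x (coord_param a b c d s)) = entries r v"
    if "\<And>i. i < r \<Longrightarrow> ent (v i) 1 1 = poly_eval x (a i) \<and> ent (v i) 1 2 = poly_eval x (b i) \<and>
      ent (v i) 2 1 = poly_eval x (c i) \<and> ent (v i) 2 2 = poly_eval x (d i)" for x and v :: "nat \<Rightarrow> 'k^2^2"
  proof (rule ext)
    fix s :: "nat \<times> 2 \<times> 2"
    obtain i j l where s: "s = (i, j, l)" by (cases s)
    show "(\<lambda>s\<in>entry_vars r. poly_eval x (coord_param a b c d s)) s = entries r v s"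
      using that[of i] exhaust_2[of j] exhaust_2[of l]
      by (auto simp: s entries_def entry_vars_def)
  qed
  show "commuting_variety r W = range (\<lambda>x. \<lambda>s\<in>entry_vars r. poly_eval x (coord_param a b c d s))"
  proof (intro equalityI subsetI)
    fix z assume "z \<in> commuting_variety r W"
    then obtain v where v: "z = entries r v" "v \<in> {..<r} \<rightarrow>\<^sub>E W"
      "\<And>i j. i \<le> j \<Longrightarrow> j < r \<Longrightarrow> lie_bracket (v i) (v j) = 0"
      unfolding commuting_variety_def commuting_tuples_def by blast
    have "lie_bracket (v i) (v j) = 0" if "i < r" "j < r" for i j
      using v(3)[of i j] v(3)[of j i] that lie_bracket_2[of "v i" "v j"] lie_bracket_2[of "v j" "v i"]
      by (cases "i \<le> j") auto
    then obtain x where xv: "\<forall>i<r. ent (v i) 1 1 = poly_eval x (a i) \<and> ent (v i) 1 2 = poly_eval x (b i) \<and>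
        ent (v i) 2 1 = poly_eval x (c i) \<and> ent (v i) 2 2 = poly_eval x (d i)"
      using complete[of v] v(2) by blast
    have "(\<lambda>s\<in>entry_vars r. poly_eval x (coord_param a b c d s)) = entries r v"
      by (rule ext) (use xv in blast)
    then show "z \<in> range (\<lambda>x. \<lambda>s\<in>entry_vars r. poly_eval x (coord_param a b c d s))"
      unfolding v(1) by (intro range_eqI[of _ _ x]) (rule sym)
  next
    fix z assume "z \<in> range (\<lambda>x. \<lambda>s\<in>entry_vars r. poly_eval x (coord_param a b c d s))"
    then obtain x where x: "z = (\<lambda>s\<in>entry_vars r. poly_eval x (coord_param a b c d s))" by blast
    \<comment> \<open>The value \<open>undefined\<close> outside the index range makes
      \<open>v\<close> extensional, as \<open>commuting_tuples\<close> demands.\<close>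
    define v :: "nat \<Rightarrow> 'k^2^2" where "v i = (if i < r then \<chi> j l. poly_eval x (coord_param a b c d (i, j, l)) else undefined)" for i
    have e: "ent (v i) 1 1 = poly_eval x (a i) \<and> ent (v i) 1 2 = poly_eval x (b i) \<and>
      ent (v i) 2 1 = poly_eval x (c i) \<and> ent (v i) 2 2 = poly_eval x (d i)" if "i < r" for i
      using that by (simp add: v_def)
    have "v \<in> commuting_tuples r W"
    proof -
      have "(\<forall>i<r. v i \<in> W) \<and> (\<forall>i<r. \<forall>j<r. lie_bracket (v i) (v j) = 0)"
        by (rule sound) (rule e)
      moreover have "v i = undefined" if "\<not> i < r" for i using that by (simp add: v_def)
      ultimately show ?thesis
        unfolding commuting_tuples_def PiE_iff extensional_def by (auto intro: le_less_trans)
    qed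
    moreover have "z = entries r v" unfolding x by (rule ext) (rule e)
    ultimately show "z \<in> commuting_variety r W"
      unfolding commuting_variety_def by blast
  qed
qed

section \<open>The three varieties\<close>

context
  fixes r :: nat
  assumes two: "(2 :: 'k::alg_closed_field) \<noteq> 0" and r: "0 < r"
begin

lemma sum_zero_matrix_iff: "trace (A :: 'k^2^2) = 0 \<longleftrightarrow> ent A 2 2 = - ent A 1 1"
  by (simp add: trace_def sum_2 eq_neg_iff_add_eq_0 add.commute)

text \<open>Half the difference of the diagonal entries is the diagonal entry of the traceless
  part.\<close>

lemma commuting_rank_one:
  fixes v :: "nat \<Rightarrow> 'k^2^2"
  assumes "\<forall>i<r. \<forall>j<r. lie_bracket (v i) (v j) = 0"
  shows "\<exists>x0 x1 x2 y. \<forall>i<r. ent (v i) 1 2 = x0 * y i \<and>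
    (ent (v i) 1 1 - ent (v i) 2 2) / 2 = x1 * y i \<and> ent (v i) 2 1 = x2 * y i"
proof (rule rank_one_tuple)
  fix i j assume "i < r" "j < r"
  then have "lie_bracket (v i) (v j) = 0" using assms by blast
  then show "ent (v i) 1 2 * ent (v j) 2 1 = ent (v j) 1 2 * ent (v i) 2 1 \<and>
    (ent (v i) 1 1 - ent (v i) 2 2) / 2 * ent (v j) 1 2 = (ent (v j) 1 1 - ent (v j) 2 2) / 2 * ent (v i) 1 2 \<and>
    (ent (v i) 1 1 - ent (v i) 2 2) / 2 * ent (v j) 2 1 = (ent (v j) 1 1 - ent (v j) 2 2) / 2 * ent (v i) 2 1"
    unfolding lie_bracket_2 by (simp add: times_divide_eq_left)
qed

lemma lie_bracket_0_of_rank_one: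
  fixes A B :: "'k^2^2"
  assumes "ent A 1 2 = p * s" "ent A 1 1 - ent A 2 2 = q * s" "ent A 2 1 = u * s"
    and "ent B 1 2 = p * t" "ent B 1 1 - ent B 2 2 = q * t" "ent B 2 1 = u * t"
  shows "lie_bracket A B = 0"
  unfolding lie_bracket_2 assms by (simp add: mult_ac)

lemma halves: "(x + y) / 2 + (x - y) / 2 = (x :: 'k)" "(x + y) / 2 - (x - y) / 2 = y"
proof -
  have "(x + y) / 2 + (x - y) / 2 = (2 * x) / 2" by (simp flip: add_divide_distrib)
  then show "(x + y) / 2 + (x - y) / 2 = x" using two by simp
  have "(x + y) / 2 - (x - y) / 2 = (2 * y) / 2" by (simp flip: diff_divide_distrib)
  then show "(x + y) / 2 - (x - y) / 2 = y" using two by simp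
qed

text \<open>Variables \<open>0\<close> to \<open>2\<close> are the common direction, the next
  \<open>r\<close> the factors \<open>y\<close>, and the last \<open>r\<close> the halved traces,
  which have weight zero and are adjoined to the basis for the traceless case.\<close>

lemma gl_variety:
  "irreducible_variety (entry_vars r) (commuting_variety r (gl :: ('k^2^2) set)) \<and>
    normal_variety (entry_vars r) (commuting_variety r (gl :: ('k^2^2) set)) \<and>
    cohen_macaulay_variety (entry_vars r) (commuting_variety r (gl :: ('k^2^2) set))"
proof -
  let ?V = "{..<3 + r} \<union> (\<lambda>i. 3 + r + i) ` {..<r}" and ?w = "wgt 3 r 1"
  let ?y = "\<lambda>i. var (3 + i) :: (nat, 'k) mpoly" and ?z = "\<lambda>i. var (3 + r + i) :: (nat, 'k) mpoly"
  let ?a = "\<lambda>i. ?z i + var 1 * ?y i" and ?b = "\<lambda>i. var 0 * ?y i"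
    and ?c = "\<lambda>i. var 2 * ?y i" and ?d = "\<lambda>i. ?z i - var 1 * ?y i"
  let ?\<tau> = "coord_param ?a ?b ?c ?d" and ?S = "entry_vars r :: (nat \<times> 2 \<times> 2) set"
  have par: "parametrized_variety ?S ?V ?\<tau> (commuting_variety r (gl :: ('k^2^2) set))"
  proof (rule commuting_variety_parametrized[OF infinite_alg_closed])
    show "finite ?V" by simp
    show "?a i \<in> pv ?V \<and> ?b i \<in> pv ?V \<and> ?c i \<in> pv ?V \<and> ?d i \<in> pv ?V" if "i < r" for i
      using that by (intro conjI pv_add pv_diff pv_mult pv_var) auto
    show "(\<forall>i<r. v i \<in> gl) \<and> (\<forall>i<r. \<forall>j<r. lie_bracket (v i) (v j) = 0)"
      if v: "\<And>i. i < r \<Longrightarrow> ent (v i) 1 1 = poly_eval x (?a i) \<and> ent (v i) 1 2 = poly_eval x (?b i) \<and>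
        ent (v i) 2 1 = poly_eval x (?c i) \<and> ent (v i) 2 2 = poly_eval x (?d i)" for x and v :: "nat \<Rightarrow> 'k^2^2"
    proof (intro conjI allI impI)
      fix i j assume ij: "i < r" "j < r"
      show "lie_bracket (v i) (v j) = 0"
        \<comment> \<open>The diagonal entries are \<open>z + x1 y\<close> and
          \<open>z - x1 y\<close>, so their difference carries the factor \<open>2\<close>.\<close>
        by (rule lie_bracket_0_of_rank_one[where p = "x 0" and q = "2 * x 1" and u = "x 2"
              and s = "x (3 + i)" and t = "x (3 + j)"])
          (use v[OF ij(1)] v[OF ij(2)] in \<open>simp_all add: poly_eval_eq_ev\<close>)
    qed (simp add: gl_def)
    fix v :: "nat \<Rightarrow> 'k^2^2" assume "\<forall>i<r. \<forall>j<r. lie_bracket (v i) (v j) = 0"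
    then obtain x0 x1 x2 y where p: "\<And>i. i < r \<Longrightarrow> ent (v i) 1 2 = x0 * y i \<and>
      (ent (v i) 1 1 - ent (v i) 2 2) / 2 = x1 * y i \<and> ent (v i) 2 1 = x2 * y i"
      using commuting_rank_one[of v] by blast
    define x where "x n = (if n = 0 then x0 else if n = 1 then x1 else if n = 2 then x2
      else if n < 3 + r then y (n - 3) else (ent (v (n - 3 - r)) 1 1 + ent (v (n - 3 - r)) 2 2) / 2)" for n
    have x: "x 0 = x0" "x (Suc 0) = x1" "x 2 = x2" "\<And>i. i < r \<Longrightarrow> x (3 + i) = y i"
      "\<And>i. x (3 + r + i) = (ent (v i) 1 1 + ent (v i) 2 2) / 2"
      by (auto simp: x_def)
    have "ent (v i) 1 1 = poly_eval x (?a i) \<and> ent (v i) 1 2 = poly_eval x (?b i) \<and>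
        ent (v i) 2 1 = poly_eval x (?c i) \<and> ent (v i) 2 2 = poly_eval x (?d i)" if i: "i < r" for i
    proof -
      have q: "x1 * y i = (ent (v i) 1 1 - ent (v i) 2 2) / 2" using p[OF i] by metis
      have "ent (v i) 1 1 = x (3 + r + i) + x1 * y i" "ent (v i) 2 2 = x (3 + r + i) - x1 * y i"
        unfolding q x(5) by (simp_all only: halves)
      then show ?thesis
        using p[OF i] x(4)[OF i] by (simp add: poly_eval_eq_ev x(1-3))
    qed
    then show "\<exists>x. \<forall>i<r. ent (v i) 1 1 = poly_eval x (?a i) \<and> ent (v i) 1 2 = poly_eval x (?b i) \<and>
        ent (v i) 2 1 = poly_eval x (?c i) \<and> ent (v i) 2 2 = poly_eval x (?d i)" by blast
  qed
  have z: "?w (3 + r + i) = 0" for i by (simp add: wgt_def)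
  have notin: "3 + r + i \<notin> {..<3 + r}" for i by simp
  have img: "psub ?\<tau> ` pv ?S = invs ?V ?w"
  proof (rule psub_image_eq_invs)
    have xy: "var a * ?y i \<in> invs ?V ?w" if "i < r" "a < 3" for i a
      using that by (intro var_mult_var_invs) (auto simp: wgt_def)
    have zi: "?z i \<in> invs ?V ?w" if "i < r" for i
      using that z by (auto simp: var_def invs_def wt_single)
    show "?\<tau> s \<in> invs ?V ?w" if "s \<in> ?S" for s
      using that xy zi by (auto simp: entry_vars_def coord_param_def intro!: invs_add invs_diff)
    let ?A = "psub ?\<tau> ` pv ?S"
    have S: "(i, j, l) \<in> ?S" if "i < r" for i j l using that by (simp add: entry_vars_def)
    have A: "?a i \<in> ?A" "?b i \<in> ?A" "?c i \<in> ?A" "?d i \<in> ?A" if "i < r" for i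
      using psub_image_var[OF S[OF that, of 1 1], of ?\<tau>] psub_image_var[OF S[OF that, of 1 2], of ?\<tau>]
        psub_image_var[OF S[OF that, of 2 1], of ?\<tau>] psub_image_var[OF S[OF that, of 2 2], of ?\<tau>]
      by simp_all
    \<comment> \<open>The sum of the two diagonal entries is twice \<open>z\<close>; halving puts
      \<open>z\<close> itself, and then \<open>x1 y\<close>, into the subring generated by the
      entries.\<close>
    have half: "cst (1 / 2) * (f + f) = f" for f :: "(nat, 'k) mpoly"
    proof -
      have "cst (1 / 2) * (f + f) = cst (1 / 2 + 1 / 2) * f" by (simp only: cst_add distrib_left distrib_right)
      also have "1 / 2 + 1 / 2 = (1 :: 'k)" using two by (simp flip: add_divide_distrib)
      finally show ?thesis by simp
    qed
    have zA: "?z i \<in> ?A" if "i < r" for i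
    proof -
      have "cst (1 / 2) * (?a i + ?d i) \<in> ?A"
        by (intro psub_image_mult psub_image_cst psub_image_add A that)
      moreover have "?a i + ?d i = ?z i + ?z i" by simp
      ultimately show ?thesis by (simp only: half)
    qed
    have yA: "var 1 * ?y i \<in> ?A" if "i < r" for i
    proof -
      have "?a i + cst (- 1) * ?z i \<in> ?A"
        by (intro psub_image_mult psub_image_cst psub_image_add A zA that)
      then show ?thesis by (simp add: cst_uminus)
    qed
    fix m assume m: "keys m \<subseteq> ?V" "wt ?w m = 0"
    show "single m 1 \<in> ?A"
    proof (rule adjoin_monomial[OF _ notin z _ _ m])
      show "inj_on (\<lambda>i. 3 + r + i) {..<r}" by (simp add: inj_on_def)
      show "var (3 + r + i) * f \<in> ?A" if "f \<in> ?A" "i < r" for f i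
        by (rule psub_image_mult[OF zA[OF that(2)] that(1)])
      show "single m 1 \<in> ?A" if "keys m \<subseteq> {..<3 + r}" "wt ?w m = 0" for m
      proof (rule psub_image_wgt_monomial[OF _ that])
        fix \<alpha> :: "nat \<Rightarrow>\<^sub>0 nat" and i assume \<alpha>: "\<alpha> \<in> exps_eq {..<3} 1" and i: "i < r"
        have "(single \<alpha> 1 :: (nat, 'k) mpoly) \<in> {var 0, var 1, var 2}" using exps_eq_3_1[of \<alpha>] \<alpha> by simp
        then show "single \<alpha> 1 * ?y i \<in> ?A" using A[OF i] yA[OF i] by auto
      qed
    qed
  qed
  obtain \<theta> and E :: "(nat, 'k) mpoly set" where "free_basis (invs {..<3 + r} ?w) \<theta> (r + 2) E"
    using segre_free_basis[OF r] .
  then have "free_basis (invs ?V ?w) (\<lambda>j. if j < r + 2 then \<theta> j else var (3 + r + (j - (r + 2)))) (r + 2 + r) E"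
    by (intro free_basis_adjoin infinite_alg_closed notin z) (simp_all add: inj_on_def)
  \<comment> \<open>There are \<open>3 + 2 * r\<close> variables; the \<open>r + 2\<close>
    parameters of the traceless case and the \<open>r\<close> variables \<open>z\<close> add up to
    one less.\<close>
  moreover have "card ?V - 1 = r + 2 + r"
    by (subst card_Un_disjoint) (auto simp: card_image inj_on_def)
  ultimately have "free_basis (invs ?V ?w) (\<lambda>j. if j < r + 2 then \<theta> j else var (3 + r + (j - (r + 2)))) (card ?V - 1) E"
    by simp
  then show ?thesis
    by (rule variety_from_free_basis[OF par img, rotated 2]) (auto simp: wgt_def intro: UnI1)
qed

lemma sl_variety:
  "irreducible_variety (entry_vars r) (commuting_variety r (sl :: ('k^2^2) set)) \<and>
    normal_variety (entry_vars r) (commuting_variety r (sl :: ('k^2^2) set)) \<and>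
    cohen_macaulay_variety (entry_vars r) (commuting_variety r (sl :: ('k^2^2) set))"
proof -
  let ?V = "{..<3 + r}" and ?w = "wgt 3 r 1"
  let ?y = "\<lambda>i. var (3 + i) :: (nat, 'k) mpoly"
  let ?a = "\<lambda>i. var 1 * ?y i" and ?b = "\<lambda>i. var 0 * ?y i"
    and ?c = "\<lambda>i. var 2 * ?y i" and ?d = "\<lambda>i. - (var 1 * ?y i)"
  let ?\<tau> = "coord_param ?a ?b ?c ?d" and ?S = "entry_vars r :: (nat \<times> 2 \<times> 2) set"
  have par: "parametrized_variety ?S ?V ?\<tau> (commuting_variety r (sl :: ('k^2^2) set))"
  proof (rule commuting_variety_parametrized[OF infinite_alg_closed])
    show "finite ?V" by simp
    show "?a i \<in> pv ?V \<and> ?b i \<in> pv ?V \<and> ?c i \<in> pv ?V \<and> ?d i \<in> pv ?V" if "i < r" for i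
      using that by (intro conjI pv_uminus pv_mult pv_var) auto
    show "(\<forall>i<r. v i \<in> sl) \<and> (\<forall>i<r. \<forall>j<r. lie_bracket (v i) (v j) = 0)"
      if v: "\<And>i. i < r \<Longrightarrow> ent (v i) 1 1 = poly_eval x (?a i) \<and> ent (v i) 1 2 = poly_eval x (?b i) \<and>
        ent (v i) 2 1 = poly_eval x (?c i) \<and> ent (v i) 2 2 = poly_eval x (?d i)" for x and v :: "nat \<Rightarrow> 'k^2^2"
    proof (intro conjI allI impI)
      fix i assume "i < r"
      then show "v i \<in> sl" using v[of i] by (simp add: sl_def sum_zero_matrix_iff poly_eval_eq_ev)
    next
      fix i j assume ij: "i < r" "j < r"
      show "lie_bracket (v i) (v j) = 0"
        by (rule lie_bracket_0_of_rank_one[where p = "x 0" and q = "2 * x 1" and u = "x 2"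
              and s = "x (3 + i)" and t = "x (3 + j)"])
          (use v[OF ij(1)] v[OF ij(2)] in \<open>simp_all add: poly_eval_eq_ev\<close>)
    qed
    fix v :: "nat \<Rightarrow> 'k^2^2" assume vs: "\<forall>i<r. v i \<in> sl" and "\<forall>i<r. \<forall>j<r. lie_bracket (v i) (v j) = 0"
    then obtain x0 x1 x2 y where p: "\<And>i. i < r \<Longrightarrow> ent (v i) 1 2 = x0 * y i \<and>
      (ent (v i) 1 1 - ent (v i) 2 2) / 2 = x1 * y i \<and> ent (v i) 2 1 = x2 * y i"
      using commuting_rank_one[of v] by blast
    define x where "x n = (if n = 0 then x0 else if n = 1 then x1 else if n = 2 then x2 else y (n - 3))" for n
    have x: "x 0 = x0" "x (Suc 0) = x1" "x 2 = x2" "\<And>i. x (3 + i) = y i"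
      by (auto simp: x_def)
    have "ent (v i) 1 1 = poly_eval x (?a i) \<and> ent (v i) 1 2 = poly_eval x (?b i) \<and>
        ent (v i) 2 1 = poly_eval x (?c i) \<and> ent (v i) 2 2 = poly_eval x (?d i)" if i: "i < r" for i
    proof -
      have tr: "ent (v i) 2 2 = - ent (v i) 1 1" using vs i by (simp add: sl_def sum_zero_matrix_iff)
      have "ent (v i) 1 1 = x1 * y i"
        using p[OF i] halves[of "ent (v i) 1 1" "ent (v i) 2 2"] by (simp add: tr)
      then show ?thesis
        using p[OF i] x(4)[of i] tr by (simp add: poly_eval_eq_ev x(1-3))
    qed
    then show "\<exists>x. \<forall>i<r. ent (v i) 1 1 = poly_eval x (?a i) \<and> ent (v i) 1 2 = poly_eval x (?b i) \<and>
        ent (v i) 2 1 = poly_eval x (?c i) \<and> ent (v i) 2 2 = poly_eval x (?d i)" by blast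
  qed
  have img: "psub ?\<tau> ` pv ?S = invs ?V ?w"
  proof (rule psub_image_eq_invs)
    have xy: "var a * ?y i \<in> invs ?V ?w" if "i < r" "a < 3" for i a
      using that by (intro var_mult_var_invs) (auto simp: wgt_def)
    show "?\<tau> s \<in> invs ?V ?w" if "s \<in> ?S" for s
      using that xy by (auto simp: entry_vars_def coord_param_def intro!: invs_uminus)
    let ?A = "psub ?\<tau> ` pv ?S"
    have S: "(i, j, l) \<in> ?S" if "i < r" for i j l using that by (simp add: entry_vars_def)
    have A: "?a i \<in> ?A" "?b i \<in> ?A" "?c i \<in> ?A" if "i < r" for i
      using psub_image_var[OF S[OF that, of 1 1], of ?\<tau>] psub_image_var[OF S[OF that, of 1 2], of ?\<tau>]
        psub_image_var[OF S[OF that, of 2 1], of ?\<tau>] by simp_all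
    fix m assume "keys m \<subseteq> ?V" "wt ?w m = 0"
    then show "single m 1 \<in> ?A"
    proof (rule psub_image_wgt_monomial[rotated])
      fix \<alpha> :: "nat \<Rightarrow>\<^sub>0 nat" and i assume \<alpha>: "\<alpha> \<in> exps_eq {..<3} 1" and i: "i < r"
      have "(single \<alpha> 1 :: (nat, 'k) mpoly) \<in> {var 0, var 1, var 2}" using exps_eq_3_1[of \<alpha>] \<alpha> by simp
      then show "single \<alpha> 1 * ?y i \<in> ?A" using A[OF i] by auto
    qed
  qed
  obtain \<theta> and E :: "(nat, 'k) mpoly set" where "free_basis (invs ?V ?w) \<theta> (r + 2) E"
    using segre_free_basis[OF r] .
  then have "free_basis (invs ?V ?w) \<theta> (card ?V - 1) E" by (simp add: add.commute)
  then show ?thesis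
    by (rule variety_from_free_basis[OF par img, rotated 2]) (auto simp: wgt_def)
qed

text \<open>A square root of \<open>x0\<close> determines \<open>t\<close> by division. If
  \<open>x0 = 0\<close>, then \<open>x1 = 0\<close> as well, and a square root of
  \<open>- x2\<close> is taken instead.\<close>

lemma nilpotent_square_roots:
  fixes x0 x1 x2 :: 'k
  assumes "x1 * x1 + x0 * x2 = 0"
  shows "\<exists>s t. x0 = s * s \<and> x1 = s * t \<and> x2 = - (t * t)"
proof (cases "x0 = 0")
  case True
  obtain t where "t ^ 2 = - x2" using nth_root_exists[of 2 "- x2"] by auto
  then show ?thesis
    using True assms by (intro exI[of _ 0] exI[of _ t]) (simp add: power2_eq_square)
next
  case False
  obtain s where s: "s ^ 2 = x0" using nth_root_exists[of 2 x0] by auto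
  then have s0: "s \<noteq> 0" using False by auto
  have "x0 * x2 = - (x1 * x1)" using assms by (simp add: eq_neg_iff_add_eq_0 add.commute)
  then have "x0 * x2 / x0 = - (x1 * x1) / x0" by (rule arg_cong)
  then have "x2 = - (x1 * x1) / x0" using False by (simp del: minus_divide_left)
  then have "x2 = - (x1 / s * (x1 / s))" by (simp add: s[symmetric] power2_eq_square)
  then show ?thesis
    using s s0 by (intro exI[of _ s] exI[of _ "x1 / s"]) (simp add: power2_eq_square)
qed

lemma nilpotent_cone_variety:
  "irreducible_variety (entry_vars r) (commuting_variety r (nilpotent_cone :: ('k^2^2) set)) \<and>
    normal_variety (entry_vars r) (commuting_variety r (nilpotent_cone :: ('k^2^2) set)) \<and>
    cohen_macaulay_variety (entry_vars r) (commuting_variety r (nilpotent_cone :: ('k^2^2) set))"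
proof -
  let ?V = "{..<2 + r}" and ?w = "wgt 2 r 2"
  let ?y = "\<lambda>i. var (2 + i) :: (nat, 'k) mpoly"
  let ?a = "\<lambda>i. var 0 * var 1 * ?y i" and ?b = "\<lambda>i. var 0 * var 0 * ?y i"
    and ?c = "\<lambda>i. - (var 1 * var 1 * ?y i)" and ?d = "\<lambda>i. - (var 0 * var 1 * ?y i)"
  let ?\<tau> = "coord_param ?a ?b ?c ?d" and ?S = "entry_vars r :: (nat \<times> 2 \<times> 2) set"
  have par: "parametrized_variety ?S ?V ?\<tau> (commuting_variety r (nilpotent_cone :: ('k^2^2) set))"
  proof (rule commuting_variety_parametrized[OF infinite_alg_closed])
    show "finite ?V" by simp
    show "?a i \<in> pv ?V \<and> ?b i \<in> pv ?V \<and> ?c i \<in> pv ?V \<and> ?d i \<in> pv ?V" if "i < r" for i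
      using that by (intro conjI pv_uminus pv_mult pv_var) auto
    show "(\<forall>i<r. v i \<in> nilpotent_cone) \<and> (\<forall>i<r. \<forall>j<r. lie_bracket (v i) (v j) = 0)"
      if v: "\<And>i. i < r \<Longrightarrow> ent (v i) 1 1 = poly_eval x (?a i) \<and> ent (v i) 1 2 = poly_eval x (?b i) \<and>
        ent (v i) 2 1 = poly_eval x (?c i) \<and> ent (v i) 2 2 = poly_eval x (?d i)" for x and v :: "nat \<Rightarrow> 'k^2^2"
    proof (intro conjI allI impI)
      fix i assume "i < r"
      then have e: "ent (v i) 1 1 = x 0 * x 1 * x (2 + i)" "ent (v i) 1 2 = x 0 * x 0 * x (2 + i)"
        "ent (v i) 2 1 = - (x 1 * x 1 * x (2 + i))" "ent (v i) 2 2 = - (x 0 * x 1 * x (2 + i))"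
        using v[of i] by (simp_all add: poly_eval_eq_ev)
      have tr: "trace (v i) = 0" unfolding sum_zero_matrix_iff e ..
      have "nilpotent_matrix (v i)"
        unfolding nilpotent_matrix_2[OF tr] e by (simp add: mult_ac)
      then show "v i \<in> nilpotent_cone" using tr by (simp add: nilpotent_cone_def sl_def)
    next
      fix i j assume ij: "i < r" "j < r"
      show "lie_bracket (v i) (v j) = 0"
        by (rule lie_bracket_0_of_rank_one[where p = "x 0 * x 0" and q = "2 * (x 0 * x 1)" and u = "- (x 1 * x 1)"
              and s = "x (2 + i)" and t = "x (2 + j)"])
          (use v[OF ij(1)] v[OF ij(2)] in \<open>simp_all add: poly_eval_eq_ev\<close>)
    qed
    fix v :: "nat \<Rightarrow> 'k^2^2" assume vs: "\<forall>i<r. v i \<in> nilpotent_cone" and "\<forall>i<r. \<forall>j<r. lie_bracket (v i) (v j) = 0"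
    then obtain x0 x1 x2 y where p: "\<And>i. i < r \<Longrightarrow> ent (v i) 1 2 = x0 * y i \<and>
      (ent (v i) 1 1 - ent (v i) 2 2) / 2 = x1 * y i \<and> ent (v i) 2 1 = x2 * y i"
      using commuting_rank_one[of v] by blast
    have e: "ent (v i) 2 2 = - ent (v i) 1 1 \<and> ent (v i) 1 1 = x1 * y i \<and>
      ent (v i) 1 2 = x0 * y i \<and> ent (v i) 2 1 = x2 * y i \<and> (x1 * x1 + x0 * x2) * (y i * y i) = 0" if i: "i < r" for i
    proof -
      have t0: "trace (v i) = 0" and nil: "nilpotent_matrix (v i)"
        using vs i by (simp_all add: nilpotent_cone_def sl_def)
      have tr: "ent (v i) 2 2 = - ent (v i) 1 1" using t0 by (simp add: sum_zero_matrix_iff)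
      have h: "ent (v i) 1 1 = x1 * y i"
        using p[OF i] halves[of "ent (v i) 1 1" "ent (v i) 2 2"] by (simp add: tr)
      have "ent (v i) 1 1 * ent (v i) 1 1 + ent (v i) 1 2 * ent (v i) 2 1 = 0"
        using nil nilpotent_matrix_2[OF t0] by simp
      then have "(x1 * x1 + x0 * x2) * (y i * y i) = 0"
        using p[OF i] h by (simp add: algebra_simps)
      then show ?thesis using tr h p[OF i] by simp
    qed
    \<comment> \<open>If all \<open>y i\<close> are zero, nilpotency does not constrain the
      direction, which may lie off the cone; the zero tuple is then parametrized by zeros.\<close>
    have "\<exists>s t y'. \<forall>i<r. x0 * y i = s * s * y' i \<and> x1 * y i = s * t * y' i \<and> x2 * y i = - (t * t * y' i)"
    proof (cases "\<forall>i<r. y i = 0")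
      case True
      then show ?thesis by (intro exI[of _ 0] exI[of _ "\<lambda>_. 0"]) simp
    next
      case False
      then have "x1 * x1 + x0 * x2 = 0" using e by auto
      then obtain s t where "x0 = s * s" "x1 = s * t" "x2 = - (t * t)"
        using nilpotent_square_roots by blast
      then show ?thesis by (intro exI[of _ s] exI[of _ t] exI[of _ y]) simp
    qed
    then obtain s t y' where st: "\<And>i. i < r \<Longrightarrow> x0 * y i = s * s * y' i \<and> x1 * y i = s * t * y' i \<and> x2 * y i = - (t * t * y' i)"
      by blast
    define x where "x n = (if n = 0 then s else if n = 1 then t else y' (n - 2))" for n
    have x: "x 0 = s" "x (Suc 0) = t" "\<And>i. x (2 + i) = y' i" by (auto simp: x_def)
    have "ent (v i) 1 1 = poly_eval x (?a i) \<and> ent (v i) 1 2 = poly_eval x (?b i) \<and>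
        ent (v i) 2 1 = poly_eval x (?c i) \<and> ent (v i) 2 2 = poly_eval x (?d i)" if i: "i < r" for i
      using e[OF i] st[OF i] x(3)[of i] by (simp add: poly_eval_eq_ev x(1,2))
    then show "\<exists>x. \<forall>i<r. ent (v i) 1 1 = poly_eval x (?a i) \<and> ent (v i) 1 2 = poly_eval x (?b i) \<and>
        ent (v i) 2 1 = poly_eval x (?c i) \<and> ent (v i) 2 2 = poly_eval x (?d i)" by blast
  qed
  have img: "psub ?\<tau> ` pv ?S = invs ?V ?w"
  proof (rule psub_image_eq_invs)
    have xy: "var a * var b * ?y i \<in> invs ?V ?w" if "i < r" "a < 2" "b < 2" for i a b
      using that by (intro var_mult_var_var_invs) (auto simp: wgt_def)
    show "?\<tau> s \<in> invs ?V ?w" if "s \<in> ?S" for s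
      using that xy by (auto simp: entry_vars_def coord_param_def intro!: invs_uminus)
    let ?A = "psub ?\<tau> ` pv ?S"
    have S: "(i, j, l) \<in> ?S" if "i < r" for i j l using that by (simp add: entry_vars_def)
    have A: "?a i \<in> ?A" "?b i \<in> ?A" "?c i \<in> ?A" if "i < r" for i
      using psub_image_var[OF S[OF that, of 1 1], of ?\<tau>] psub_image_var[OF S[OF that, of 1 2], of ?\<tau>]
        psub_image_var[OF S[OF that, of 2 1], of ?\<tau>] by simp_all
    have A': "var 1 * var 1 * ?y i \<in> ?A" if "i < r" for i
      using psub_image_mult[OF psub_image_cst[of "- 1"] A(3)[OF that]] by (simp add: cst_uminus)
    fix m assume "keys m \<subseteq> ?V" "wt ?w m = 0"
    then show "single m 1 \<in> ?A"
    proof (rule psub_image_wgt_monomial[rotated])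
      fix \<alpha> :: "nat \<Rightarrow>\<^sub>0 nat" and i assume \<alpha>: "\<alpha> \<in> exps_eq {..<2} 2" and i: "i < r"
      have "(single \<alpha> 1 :: (nat, 'k) mpoly) \<in> {var 0 * var 0, var 0 * var 1, var 1 * var 1}"
        using exps_eq_2_2[of \<alpha>] \<alpha> by (simp add: numeral_2_eq_2)
      then show "single \<alpha> 1 * ?y i \<in> ?A" using A[OF i] A'[OF i] by auto
    qed
  qed
  obtain \<theta> and E :: "(nat, 'k) mpoly set" where "free_basis (invs ?V ?w) \<theta> (r + 1) E"
    using nilpotent_free_basis[OF r] .
  then have "free_basis (invs ?V ?w) \<theta> (card ?V - 1) E" by (simp add: add.commute)
  then show ?thesis
    by (rule variety_from_free_basis[OF par img, rotated 2]) (auto simp: wgt_def)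
qed

end

theorem theorem1p2p1:
  fixes p r :: nat
  assumes "CHAR('k::alg_closed_field) = p" and "p > 2" and "r \<ge> 1"
  shows "\<forall>V \<in> {gl :: ('k^2^2) set, sl, nilpotent_cone}.
    irreducible_variety (entry_vars r) (commuting_variety r V) \<and>
    normal_variety (entry_vars r) (commuting_variety r V) \<and>
    cohen_macaulay_variety (entry_vars r) (commuting_variety r V)"
proof -
  have two: "(2 :: 'k) \<noteq> 0"
  proof
    assume "(2 :: 'k) = 0"
    then have "of_nat 2 = (0 :: 'k)" by simp
    then have "CHAR('k) dvd 2" by (simp only: of_nat_eq_0_iff_char_dvd)
    then show False using assms(1,2) by (auto dest: dvd_imp_le)
  qed
  have r: "0 < r" using assms(3) by simp
  show ?thesis
    using gl_variety[OF two r] sl_variety[OF two r] nilpotent_cone_variety[OF two r] by blast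
qed

end
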